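(* Let $G$ be a graph and $k\geq 1$ an integer. The following conditions are equivalent: (1) $G$ has a loose tree-decomposition of width $k$; (2) $G$ is a minor of $T\Box K_k$ for some tree $T$ (i.e. $\mathsf{ctp}(G)\leq k$); (3) every tight bramble of $G$ has order at most $k$; (4) $\mathsf{avms}(G)\leq k$; (5) $\mathsf{mavms}(G)\leq k$.
   Context: All graphs are finite, simple, loopless. $A\ominus B$ denotes symmetric difference. Cartesian tree product number: for a tree $T$ and $k\ge1$, $T\Box K_k$ has vertex set $V(T)\times[k]$, with $(x,i)(y,j)$ an edge iff ($x=y$ and $i\neq j$) or ($xy\in E(T)$ and $i=j$). $\mathsf{ctp}(G)=\min\{k: G \text{ is a minor of } T\Box K_k \text{ for some tree } T\}$. Loose tree-decomposition of $G$: a pair $(T,\chi)$ with $T$ a tree and $\chi:V(T)\to 2^{V(G)}$ such that (L1) for each $x\in V(G)$ the nodes $t$ with $x\in\chi(t)$ induce a nonempty connected subtree of $T$; (L2) for every edge $xy\in E(G)$ there is a tree edge $t_1t_2\in E(T)$ with $xy\in E(G[\chi(t_1)\cup\chi(t_2)])$; (L3) for every tree edge $t_1t_2$, $|E(G[\chi(t_1)\cup\chi(t_2)])\setminus(E(G[\chi(t_1)])\cup E(G[\chi(t_2)]))|\le1$. Its width is $\max_t|\chi(t)|$. Two sets $S_1,S_2\subseteq V(G)$ are touching if $S_1\cap S_2\ne\emptyset$ or there are two distinct edges $x_1x_2,y_1y_2\in E(G)$ with $x_1,y_1\in S_1$, $x_2,y_2\in S_2$. A tight bramble of $G$ is a set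 $\mathcal B$ of pairwise touching subsets of $V(G)$, each inducing a connected subgraph and of size at least two. A cover of $\mathcal B$ is a set $S\subseteq V(G)$ meeting every element of $\mathcal B$; the order of $\mathcal B$ is the minimum size of a cover. Mixed search game against an agile visible fugitive. A searchers' position is a subset of $V(G)$. A pair $(S,S')$ of positions is a legitimate move if $|S\ominus S'|\in\{1,2\}$ and, when $|S\ominus S'|=2$, $S\ominus S'$ is an edge of $G$ (so: placing a searcher, removing a searcher, or sliding a searcher along an edge $xy$ from $x$ to $y$). Define $\mathsf{clear}(S,S')=\{xy\in E(G): x\in S\}$ if $S'\setminus S=\{y\}$, and $\emptyset$ if $S'\setminus S=\emptyset$. A pathway is a sequence $\langle e_1,\dots,e_\ell\rangle$ of edges where consecutive edges are distinct and share a vertex. A pathway $\langle f_1,\dots,f_t\rangle$, $t\ge2$, is $(S,S')$-avoiding if (i) for each $j\in[2,t]$ the common vertex of $f_{j-1},f_j$ is not in $S\cap S'$, and (ii) if $(S,S')$ is a slide along $xy$ (i.e. $S'\setminus\{y\}=S\setminus\{x\}$) and $xy$ occurs in the pathway, then $xy=f_1$ or $xy=f_t$, and if $xy=f_1=f_t$ then $t>2$. Let $A(S,e,S')$ be the set of edges $e'$ not having both endpoints in $S'$ such that there is an $(S,S')$-avoiding pathway from $e$ to $e'$, and $\mathsf{fsp}(S,e,S')=(\{e\}\setminus\mathsf{clear}(S,S'))\cup A(S,e,S')$. A search strategy is a function $\mathbf s$ assigning to each pair $(S,e)$ ($S\subseteq V(G)$, $e\in E(G)$) a position $\mathbf s(S,e)$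 with $(S,\mathbf s(S,e))$ legitimate. A fugitive strategy is a pair $(e_1,\mathbf f)$ with $e_1\in E(G)$ and $\mathbf f(S,e,S')\in\mathsf{fsp}(S,e,S')$ if this set is nonempty, and $\mathbf f(S,e,S')=\star$ otherwise. They generate the play $\langle S_0,e_1,S_1,e_2,S_2,\dots\rangle$ with $S_0=\emptyset$, $S_i=\mathbf s(S_{i-1},e_i)$, $e_{i+1}=\mathbf f(S_{i-1},e_i,S_i)$, ending (finite) when $\star$ appears (capture). The cost of a search strategy is the maximum of $|S_i|$ over all plays against all fugitive strategies; it is winning if every play is finite; it is monotone if in every play, for every $i$ and every $j\le i$, $e_i\notin\mathsf{clear}(S_{j-1},S_j)$. $\mathsf{avms}(G)$ is the minimum cost of a winning search strategy and $\mathsf{mavms}(G)$ the minimum cost of a monotone winning search strategy.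
   Formalization: Width k means at most k. Monotone: e_i is not cleared by moves j<i (j=i would bar every capture). In a slide from x to y, an avoiding pathway has xy only as f_1, left through y, or as f_t, entered through x; otherwise the path on 3 vertices with k=1 is a counterexample. *)

theory Defs
  imports Main "HOL-Library.Extended_Nat"
begin

section \<open>Finite simple graphs\<close>

record 'a ugraph =
  verts :: "'a set"
  edges :: "'a set set"

definition simple_graph :: "'a ugraph \<Rightarrow> bool" where
  "simple_graph G \<longleftrightarrow>
     finite (verts G) \<and> (\<forall>e\<in>edges G. e \<subseteq> verts G \<and> card e = 2)"

definition induced :: "'a ugraph \<Rightarrow> 'a set \<Rightarrow> 'a ugraph" where
  "induced G X = \<lparr>verts = verts G \<inter> X, edges = {e \<in> edges G. e \<subseteq> X}\<rparr>"

text \<open>Connected graphs are nonempty by convention.\<close>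

definition connected_graph :: "'a ugraph \<Rightarrow> bool" where
  "connected_graph G \<longleftrightarrow> verts G \<noteq> {} \<and>
     (\<forall>u\<in>verts G. \<forall>v\<in>verts G. (u, v) \<in> {(a, b). {a, b} \<in> edges G}\<^sup>*)"

definition is_cycle :: "'a ugraph \<Rightarrow> 'a list \<Rightarrow> bool" where
  "is_cycle G c \<longleftrightarrow> length c \<ge> 3 \<and> distinct c \<and>
     (\<forall>i<length c. {c ! i, c ! (Suc i mod length c)} \<in> edges G)"

definition is_tree :: "'a ugraph \<Rightarrow> bool" where
  "is_tree T \<longleftrightarrow> simple_graph T \<and> connected_graph T \<and> (\<nexists>c. is_cycle T c)"


section \<open>Minors and the Cartesian tree product number\<close>

text \<open>\<open>\<phi>\<close> is the map sending each vertex to its branch set.\<close>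

definition is_minor :: "'a ugraph \<Rightarrow> 'b ugraph \<Rightarrow> bool" where
  "is_minor G H \<longleftrightarrow> (\<exists>\<phi> :: 'a \<Rightarrow> 'b set.
     (\<forall>v\<in>verts G. \<phi> v \<subseteq> verts H \<and> connected_graph (induced H (\<phi> v))) \<and>
     (\<forall>u\<in>verts G. \<forall>v\<in>verts G. u \<noteq> v \<longrightarrow> \<phi> u \<inter> \<phi> v = {}) \<and>
     (\<forall>u v. {u, v} \<in> edges G \<longrightarrow> (\<exists>a\<in>\<phi> u. \<exists>b\<in>\<phi> v. {a, b} \<in> edges H)))"

definition box_clique :: "'b ugraph \<Rightarrow> nat \<Rightarrow> ('b \<times> nat) ugraph" where
  "box_clique T k =
     \<lparr>verts = verts T \<times> {1..k},
      edges = {{(x, i), (y, j)} | x i y j.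
         x \<in> verts T \<and> y \<in> verts T \<and> i \<in> {1..k} \<and> j \<in> {1..k} \<and>
         ((x = y \<and> i \<noteq> j) \<or> ({x, y} \<in> edges T \<and> i = j))}\<rparr>"

text \<open>Trees are finite, so up to isomorphism their nodes may be taken to be natural
  numbers; this makes ``for some tree'' a quantifier over a single type.\<close>

definition minor_of_tree_product :: "'a ugraph \<Rightarrow> nat \<Rightarrow> bool" where
  "minor_of_tree_product G k \<longleftrightarrow>
     (\<exists>T :: nat ugraph. is_tree T \<and> is_minor G (box_clique T k))"

text \<open>Minima of numerical parameters are infima in \<open>enat\<close>, so that a minimum over an
  empty set would be \<open>\<infinity>\<close> and not an unspecified number.\<close>

definition ctp :: "'a ugraph \<Rightarrow> enat" where
  "ctp G = Inf (enat ` {k. k \<ge> 1 \<and> minor_of_tree_product G k})"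


section \<open>Loose tree-decompositions\<close>

definition loose_tree_decomposition ::
    "'a ugraph \<Rightarrow> 'b ugraph \<Rightarrow> ('b \<Rightarrow> 'a set) \<Rightarrow> bool" where
  "loose_tree_decomposition G T \<chi> \<longleftrightarrow>
     is_tree T \<and> (\<forall>t\<in>verts T. \<chi> t \<subseteq> verts G) \<and>
     (\<forall>x\<in>verts G. connected_graph (induced T {t \<in> verts T. x \<in> \<chi> t})) \<and>
     (\<forall>e\<in>edges G. \<exists>t1 t2. {t1, t2} \<in> edges T \<and> e \<in> edges (induced G (\<chi> t1 \<union> \<chi> t2))) \<and>
     (\<forall>t1 t2. {t1, t2} \<in> edges T \<longrightarrow>
        card (edges (induced G (\<chi> t1 \<union> \<chi> t2)) -
              (edges (induced G (\<chi> t1)) \<union> edges (induced G (\<chi> t2)))) \<le> 1)"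

definition decomposition_width :: "'b ugraph \<Rightarrow> ('b \<Rightarrow> 'a set) \<Rightarrow> nat" where
  "decomposition_width T \<chi> = Max ((\<lambda>t. card (\<chi> t)) ` verts T)"


section \<open>Tight brambles\<close>

definition touching :: "'a ugraph \<Rightarrow> 'a set \<Rightarrow> 'a set \<Rightarrow> bool" where
  "touching G S1 S2 \<longleftrightarrow> S1 \<inter> S2 \<noteq> {} \<or>
     (\<exists>x1 x2 y1 y2. {x1, x2} \<in> edges G \<and> {y1, y2} \<in> edges G \<and> {x1, x2} \<noteq> {y1, y2} \<and>
        x1 \<in> S1 \<and> y1 \<in> S1 \<and> x2 \<in> S2 \<and> y2 \<in> S2)"

definition tight_bramble :: "'a ugraph \<Rightarrow> 'a set set \<Rightarrow> bool" where
  "tight_bramble G \<B> \<longleftrightarrow>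
     (\<forall>S\<in>\<B>. S \<subseteq> verts G \<and> connected_graph (induced G S) \<and> card S \<ge> 2) \<and>
     (\<forall>S1\<in>\<B>. \<forall>S2\<in>\<B>. touching G S1 S2)"

definition is_cover :: "'a ugraph \<Rightarrow> 'a set set \<Rightarrow> 'a set \<Rightarrow> bool" where
  "is_cover G \<B> S \<longleftrightarrow> S \<subseteq> verts G \<and> (\<forall>X\<in>\<B>. S \<inter> X \<noteq> {})"

definition bramble_order :: "'a ugraph \<Rightarrow> 'a set set \<Rightarrow> nat" where
  "bramble_order G \<B> = Min (card ` {S. is_cover G \<B> S})"


section \<open>The mixed search game against an agile visible fugitive\<close>

text \<open>\<open>slide G S S' x y\<close>: a searcher slides from \<open>x\<close> to \<open>y\<close>.\<close>

definition slide :: "'a ugraph \<Rightarrow> 'a set \<Rightarrow> 'a set \<Rightarrow> 'a \<Rightarrow> 'a \<Rightarrow> bool" where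
  "slide G S S' x y \<longleftrightarrow>
     {x, y} \<in> edges G \<and> x \<in> S \<and> y \<notin> S \<and> S' = insert y (S - {x})"

text \<open>When the symmetric difference is an edge, one of its ends is left and the other one
  is entered: placing or removing two searchers at once is not a move.\<close>

definition legitimate :: "'a ugraph \<Rightarrow> 'a set \<Rightarrow> 'a set \<Rightarrow> bool" where
  "legitimate G S S' \<longleftrightarrow> S \<subseteq> verts G \<and> S' \<subseteq> verts G \<and>
     (card (sym_diff S S') = 1 \<or> (\<exists>x y. slide G S S' x y))"

definition clear :: "'a ugraph \<Rightarrow> 'a set \<Rightarrow> 'a set \<Rightarrow> 'a set set" where
  "clear G S S' = {{x, y} | x y. {x, y} \<in> edges G \<and> x \<in> S \<and> S' - S = {y}}"

definition pathway :: "'a ugraph \<Rightarrow> 'a set list \<Rightarrow> bool" where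
  "pathway G fs \<longleftrightarrow> fs \<noteq> [] \<and> set fs \<subseteq> edges G \<and>
     (\<forall>j. Suc j < length fs \<longrightarrow> fs ! j \<noteq> fs ! Suc j \<and> fs ! j \<inter> fs ! Suc j \<noteq> {})"

text \<open>During a slide from \<open>x\<close> to \<open>y\<close> the searcher is moving along the edge \<open>{x, y}\<close>, which the
  fugitive cannot traverse.  A pathway may start at this edge, in which case the fugitive runs
  ahead of the searcher and leaves through \<open>y\<close>, and it may end there, in which case he enters
  through \<open>x\<close>, behind the searcher.  The last two conjuncts express this.  Without them he could
  pass the sliding searcher: on a path with three vertices a searcher in the middle
  could never capture him, as sliding towards his edge would let him escape
  to the other one, and the search number of that path would be 2.\<close>

definition avoiding :: "'a ugraph \<Rightarrow> 'a set \<Rightarrow> 'a set \<Rightarrow> 'a set list \<Rightarrow> bool" where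
  "avoiding G S S' fs \<longleftrightarrow> pathway G fs \<and> length fs \<ge> 2 \<and>
     (\<forall>j. Suc j < length fs \<longrightarrow> fs ! j \<inter> fs ! Suc j \<inter> (S \<inter> S') = {}) \<and>
     (\<forall>x y. slide G S S' x y \<longrightarrow>
        (\<forall>j<length fs. fs ! j = {x, y} \<longrightarrow> j = 0 \<or> j = length fs - 1) \<and>
        (hd fs = {x, y} \<and> last fs = {x, y} \<longrightarrow> length fs > 2) \<and>
        (hd fs = {x, y} \<longrightarrow> hd fs \<inter> fs ! 1 = {y}) \<and>
        (last fs = {x, y} \<longrightarrow> fs ! (length fs - 2) \<inter> last fs = {x}))"

definition accessible :: "'a ugraph \<Rightarrow> 'a set \<Rightarrow> 'a set \<Rightarrow> 'a set \<Rightarrow> 'a set set" where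
  "accessible G S e S' = {e' \<in> edges G. \<not> e' \<subseteq> S' \<and>
     (\<exists>fs. avoiding G S S' fs \<and> hd fs = e \<and> last fs = e')}"

definition fsp :: "'a ugraph \<Rightarrow> 'a set \<Rightarrow> 'a set \<Rightarrow> 'a set \<Rightarrow> 'a set set" where
  "fsp G S e S' = ({e} - clear G S S') \<union> accessible G S e S'"

definition search_strategy :: "'a ugraph \<Rightarrow> ('a set \<Rightarrow> 'a set \<Rightarrow> 'a set) \<Rightarrow> bool" where
  "search_strategy G s \<longleftrightarrow>
     (\<forall>S e. S \<subseteq> verts G \<and> e \<in> edges G \<longrightarrow> legitimate G S (s S e))"

text \<open>Capture is represented by \<open>None\<close>.\<close>

definition fugitive_strategy ::
    "'a ugraph \<Rightarrow> 'a set \<Rightarrow> ('a set \<Rightarrow> 'a set \<Rightarrow> 'a set \<Rightarrow> 'a set option) \<Rightarrow> bool" where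
  "fugitive_strategy G e1 f \<longleftrightarrow> e1 \<in> edges G \<and>
     (\<forall>S e S'. e \<in> edges G \<and> legitimate G S S' \<longrightarrow>
        (if fsp G S e S' = {} then f S e S' = None
         else (\<exists>e'\<in>fsp G S e S'. f S e S' = Some e')))"

text \<open>\<open>play s e1 f i\<close> is the pair consisting of \<open>S\<close> with index \<open>i\<close> and \<open>e\<close> with index \<open>i + 1\<close>;
  after capture it stays constant.\<close>

primrec play ::
    "('a set \<Rightarrow> 'a set \<Rightarrow> 'a set) \<Rightarrow> 'a set \<Rightarrow> ('a set \<Rightarrow> 'a set \<Rightarrow> 'a set \<Rightarrow> 'a set option) \<Rightarrow>
     nat \<Rightarrow> 'a set \<times> 'a set option" where
  "play s e1 f 0 = ({}, Some e1)"
| "play s e1 f (Suc i) =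
     (case play s e1 f i of
        (S, None) \<Rightarrow> (S, None)
      | (S, Some e) \<Rightarrow> (s S e, f S e (s S e)))"

definition winning :: "'a ugraph \<Rightarrow> ('a set \<Rightarrow> 'a set \<Rightarrow> 'a set) \<Rightarrow> bool" where
  "winning G s \<longleftrightarrow>
     (\<forall>e1 f. fugitive_strategy G e1 f \<longrightarrow> (\<exists>i. snd (play s e1 f i) = None))"

text \<open>The fugitive never occupies an edge that was cleared by an earlier move.  The edge
  \<open>snd (play s e1 f i)\<close> is the one occupied after the first \<open>i\<close> moves, and it is compared with
  exactly these moves.  The next move is not included, since the capturing move
  always clears the edge that the fugitive occupies when it is made.\<close>

definition monotone_strategy :: "'a ugraph \<Rightarrow> ('a set \<Rightarrow> 'a set \<Rightarrow> 'a set) \<Rightarrow> bool" where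
  "monotone_strategy G s \<longleftrightarrow>
     (\<forall>e1 f. fugitive_strategy G e1 f \<longrightarrow>
        (\<forall>i e. snd (play s e1 f i) = Some e \<longrightarrow>
           (\<forall>j<i. e \<notin> clear G (fst (play s e1 f j)) (fst (play s e1 f (Suc j))))))"

definition strategy_cost :: "'a ugraph \<Rightarrow> ('a set \<Rightarrow> 'a set \<Rightarrow> 'a set) \<Rightarrow> enat" where
  "strategy_cost G s =
     Sup {enat (card (fst (play s e1 f i))) | e1 f i. fugitive_strategy G e1 f}"

definition avms :: "'a ugraph \<Rightarrow> enat" where
  "avms G = Inf (strategy_cost G ` {s. search_strategy G s \<and> winning G s})"

definition mavms :: "'a ugraph \<Rightarrow> enat" where
  "mavms G = Inf (strategy_cost G `
     {s. search_strategy G s \<and> winning G s \<and> monotone_strategy G s})"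

end

theory Submission
  imports Defs
begin

text \<open>A loose tree-decomposition of width at most \<open>k\<close> is a tree of divisions of the edge set:
  a node has at most \<open>k\<close> interface vertices, or splits off one edge \<open>e\<close> from two parts with at
  most \<open>k\<close> boundary vertices each, which corresponds to a searcher sliding along \<open>e\<close>.
  By submodularity two such trees can be glued along a set of minimum boundary separating disjoint
  leaves.  So if no tree is complete, a minimal upward closed family of edge sets meeting the leaves of
  every tree is pairwise intersecting; on the components of \<open>G - S\<close> with \<open>|S| \<le> k\<close> it
  induces a tight bramble of order above \<open>k\<close>, where divisions of the second kind provide the second
  edge between disjoint elements.  A complete tree is read both as a monotone search and, after
  colouring, as a minor model.  Conversely, the fugitive survives by moving between bramble elements
  missed by the searchers, and in a tree each bag missing an element points towards it, so that two
  adjacent bags point to each other.\<close>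

section \<open>Trees\<close>

text \<open>Every implication passes through the bramble condition: no search is repaired into a
  monotone one, and neither a decomposition nor a minor model is turned into a search. Monotonicity
  comes for free, since the search obtained from a complete tree only ever shrinks the part of the
  graph open to the fugitive. The obstacle is the sliding move. For placements alone, divisions
  would be partitions with an interface of at most \<open>k\<close> vertices; a slide needs a
  three-part division whose interface may have \<open>k + 1\<close> vertices while each large part
  keeps a boundary of at most \<open>k\<close>. Gluing works because this second kind survives when
  a set of minimum boundary is moved into one part: either the edge remains a part of its own, or it
  is swallowed and two complementary parts are left, a division of the first kind. Leaves with fewer
  than two edges count as finished because one searcher clears a single edge by sliding along it,
  and the same threshold excludes bramble elements with one vertex.\<close>

abbreviation adj :: "'b ugraph \<Rightarrow> ('b \<times> 'b) set" where
  "adj T \<equiv> {(a, b). {a, b} \<in> edges T}"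

section \<open>Acyclicity in terms of bridges\<close>

definition adj_cut :: "'b ugraph \<Rightarrow> 'b \<Rightarrow> 'b \<Rightarrow> ('b \<times> 'b) set" where
  "adj_cut T a b = {(u, v). {u, v} \<in> edges T \<and> {u, v} \<noteq> {a, b}}"

lemma sym_adj_cut: "sym (adj_cut T a b)"
  by (auto simp: adj_cut_def sym_def insert_commute)

lemma adj_cut_commute: "adj_cut T a b = adj_cut T b a"
  by (auto simp: adj_cut_def insert_commute)

lemma edge_neq: "simple_graph T \<Longrightarrow> {a, b} \<in> edges T \<Longrightarrow> a \<noteq> b"
  by (auto simp: simple_graph_def)

lemma edge_verts:
  assumes "simple_graph T" "{a, b} \<in> edges T"
  shows "a \<in> verts T" "b \<in> verts T"
  using assms by (auto simp: simple_graph_def)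

lemma finite_vertices: "simple_graph G \<Longrightarrow> S \<subseteq> verts G \<Longrightarrow> finite S"
  by (auto simp: simple_graph_def intro: finite_subset)

lemma rtrancl_distinct_walk:
  assumes "(a, b) \<in> R\<^sup>*"
  shows "\<exists>xs. xs \<noteq> [] \<and> hd xs = a \<and> last xs = b \<and> distinct xs \<and>
    (\<forall>i. Suc i < length xs \<longrightarrow> (xs ! i, xs ! Suc i) \<in> R)"
  using assms
proof (induction rule: rtrancl_induct)
  case base
  show ?case by (rule exI[of _ "[a]"]) auto
next
  case (step b c)
  then obtain xs where xs: "xs \<noteq> []" "hd xs = a" "last xs = b" "distinct xs"
    "\<And>i. Suc i < length xs \<Longrightarrow> (xs ! i, xs ! Suc i) \<in> R" by blast
  show ?case
  proof (cases "c \<in> set xs")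
    case True
    then obtain m where m: "m < length xs" "xs ! m = c" by (auto simp: in_set_conv_nth)
    let ?ys = "take (Suc m) xs"
    have "last ?ys = c" using m by (simp add: take_Suc_conv_app_nth)
    moreover have "hd ?ys = a" using xs by simp
    ultimately show ?thesis using xs m by (intro exI[of _ ?ys]) auto
  next
    case False
    have "((xs @ [c]) ! i, (xs @ [c]) ! Suc i) \<in> R" if i: "Suc i < length (xs @ [c])" for i
    proof (cases "Suc i < length xs")
      case True then show ?thesis using xs(5)[of i] by (simp add: nth_append)
    next
      case nl: False
      then have "i = length xs - 1" "Suc i = length xs" using i by auto
      then have "(xs @ [c]) ! i = b" "(xs @ [c]) ! Suc i = c"
        using xs(1,3) by (auto simp: nth_append last_conv_nth)
      then show ?thesis using step(2) by simp
    qed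
    then show ?thesis using xs False by (intro exI[of _ "xs @ [c]"]) auto
  qed
qed

text \<open>Acyclicity as a statement about reachability: gluing two trees then needs only
  inductions along walks and no surgery on cyclic lists.\<close>

definition all_bridges :: "'b ugraph \<Rightarrow> bool" where
  "all_bridges T \<longleftrightarrow> (\<forall>a b. {a, b} \<in> edges T \<longrightarrow> (a, b) \<notin> (adj_cut T a b)\<^sup>*)"

text \<open>A walk from \<open>a\<close> to \<open>b\<close> without repeated vertices and without
  the edge \<open>{a, b}\<close> closes up along that edge. It has at least three vertices: one
  would give \<open>a = b\<close>, and two would use the edge itself.\<close>

lemma acyclic_imp_all_bridges:
  assumes "simple_graph T" and "\<nexists>c. is_cycle T c"
  shows "all_bridges T"
  unfolding all_bridges_def
proof (intro allI impI notI)
  fix a b assume e: "{a, b} \<in> edges T" and r: "(a, b) \<in> (adj_cut T a b)\<^sup>*"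
  have "a \<noteq> b" using assms(1) e by (rule edge_neq)
  obtain xs where xs: "xs \<noteq> []" "hd xs = a" "last xs = b" "distinct xs"
    "\<And>i. Suc i < length xs \<Longrightarrow> (xs ! i, xs ! Suc i) \<in> adj_cut T a b"
    using rtrancl_distinct_walk[OF r] by blast
  have h: "xs ! 0 = a" "xs ! (length xs - 1) = b" using xs by (auto simp: hd_conv_nth last_conv_nth)
  have "length xs \<noteq> 1" using h \<open>a \<noteq> b\<close> by auto
  moreover have "length xs \<noteq> 2" using h xs(5)[of 0] by (auto simp: adj_cut_def)
  ultimately have "length xs \<ge> 3" using xs(1) by (cases "length xs") auto
  moreover have "{xs ! i, xs ! (Suc i mod length xs)} \<in> edges T" if "i < length xs" for i
  proof (cases "Suc i < length xs")
    case True then show ?thesis using xs(5)[of i] by (auto simp: adj_cut_def)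
  next
    case False
    then have "Suc i = length xs" using that by simp
    then have "i = length xs - 1" "Suc i mod length xs = 0" by auto
    then show ?thesis using h e by (simp add: insert_commute)
  qed
  ultimately have "is_cycle T xs" using xs by (auto simp: is_cycle_def)
  then show False using assms(2) by blast
qed

text \<open>Going round a cycle the long way from \<open>c ! 1\<close> to \<open>c ! 0\<close> joins
  the ends of its first edge without using it; distinctness and length at least three keep the other
  edges of the cycle different from that one.\<close>

lemma all_bridges_imp_acyclic:
  assumes "all_bridges T"
  shows "\<nexists>c. is_cycle T c"
proof
  assume "\<exists>c. is_cycle T c"
  then obtain c where c: "length c \<ge> 3" "distinct c"
    "\<And>i. i < length c \<Longrightarrow> {c ! i, c ! (Suc i mod length c)} \<in> edges T"
    by (auto simp: is_cycle_def)
  have c_ne: "c \<noteq> []" using c(1) by auto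
  let ?n = "length c"
  let ?R = "adj_cut T (c ! 0) (c ! 1)"
  have step: "(c ! i, c ! Suc i) \<in> ?R" if "1 \<le> i" "Suc i < ?n" for i
  proof -
    have "c ! i \<noteq> c ! 0" "c ! Suc i \<noteq> c ! 0"
      using that c(1,2) c_ne nth_eq_iff_index_eq[of c i 0] nth_eq_iff_index_eq[of c "Suc i" 0] by simp_all
    then show ?thesis using c(3)[of i] that by (auto simp: adj_cut_def doubleton_eq_iff)
  qed
  have walk: "(c ! 1, c ! j) \<in> ?R\<^sup>*" if "1 \<le> j" "j < ?n" for j
    using that
  proof (induction j)
    case (Suc j)
    show ?case
    proof (cases "j = 0")
      case False
      then have "(c ! 1, c ! j) \<in> ?R\<^sup>*" using Suc by simp
      moreover have "(c ! j, c ! Suc j) \<in> ?R" using step[of j] False Suc by simp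
      ultimately show ?thesis by (rule rtrancl_into_rtrancl)
    qed simp
  qed simp
  have "{c ! (?n - 1), c ! 0} \<in> edges T" using c(3)[of "?n - 1"] c(1)
    by (metis (no_types, lifting) Suc_diff_1 diff_less less_numeral_extra(1) mod_self
        numeral_3_eq_3 order_less_le_trans zero_less_Suc)
  moreover have "c ! (?n - 1) \<noteq> c ! 1" "c ! (?n - 1) \<noteq> c ! 0"
    using c(1,2) c_ne nth_eq_iff_index_eq[of c "?n - 1" 1] nth_eq_iff_index_eq[of c "?n - 1" 0] by auto
  ultimately have "(c ! (?n - 1), c ! 0) \<in> ?R" by (auto simp: adj_cut_def doubleton_eq_iff)
  moreover have "(c ! 1, c ! (?n - 1)) \<in> ?R\<^sup>*" using walk[of "?n - 1"] c(1) by simp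
  ultimately have "(c ! 1, c ! 0) \<in> ?R\<^sup>*" by (rule rtrancl_into_rtrancl[rotated])
  then have "(c ! 1, c ! 0) \<in> (adj_cut T (c ! 1) (c ! 0))\<^sup>*" by (simp add: adj_cut_commute)
  moreover have "{c ! 1, c ! 0} \<in> edges T" using c(3)[of 0] c(1) c_ne by (simp add: insert_commute)
  ultimately show False using assms by (auto simp: all_bridges_def)
qed

lemma is_tree_iff:
  "is_tree T \<longleftrightarrow> simple_graph T \<and> connected_graph T \<and> all_bridges T"
  using acyclic_imp_all_bridges all_bridges_imp_acyclic unfolding is_tree_def by blast

section \<open>Joining two trees by an edge\<close>

lemma connected_graph_trans:
  assumes "w \<in> verts H" "\<And>v. v \<in> verts H \<Longrightarrow> (w, v) \<in> (adj H)\<^sup>*"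
  shows "connected_graph H"
  unfolding connected_graph_def
proof (intro conjI ballI)
  show "verts H \<noteq> {}" using assms by auto
  fix u v assume "u \<in> verts H" "v \<in> verts H"
  have "sym ((adj H)\<^sup>*)" by (rule sym_rtrancl) (auto simp: sym_def insert_commute)
  then have "(u, w) \<in> (adj H)\<^sup>*" using assms(2)[OF \<open>u \<in> _\<close>] by (auto dest: symD)
  then show "(u, v) \<in> (adj H)\<^sup>*" using assms(2)[OF \<open>v \<in> _\<close>] by (rule rtrancl_trans)
qed

definition join :: "'b ugraph \<Rightarrow> 'b ugraph \<Rightarrow> 'b \<Rightarrow> 'b \<Rightarrow> 'b ugraph" where
  "join T1 T2 r1 r2 = \<lparr>verts = verts T1 \<union> verts T2, edges = insert {r1, r2} (edges T1 \<union> edges T2)\<rparr>"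

lemma join_commute: "join T1 T2 r1 r2 = join T2 T1 r2 r1"
  by (auto simp: join_def)

lemma connected_join:
  assumes "connected_graph H1" "connected_graph H2" "r1 \<in> verts H1" "r2 \<in> verts H2"
  shows "connected_graph (join H1 H2 r1 r2)"
proof (rule connected_graph_trans[of r1])
  show "r1 \<in> verts (join H1 H2 r1 r2)" using assms by (simp add: join_def)
  fix v assume v: "v \<in> verts (join H1 H2 r1 r2)"
  have m: "(adj H1)\<^sup>* \<subseteq> (adj (join H1 H2 r1 r2))\<^sup>*" "(adj H2)\<^sup>* \<subseteq> (adj (join H1 H2 r1 r2))\<^sup>*"
    by (auto intro!: rtrancl_mono simp: join_def)
  show "(r1, v) \<in> (adj (join H1 H2 r1 r2))\<^sup>*"
  proof (cases "v \<in> verts H1")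
    case True
    then show ?thesis using assms m unfolding connected_graph_def by blast
  next
    case False
    then have "(r2, v) \<in> (adj H2)\<^sup>*" using assms v by (auto simp: join_def connected_graph_def)
    moreover have "(r1, r2) \<in> adj (join H1 H2 r1 r2)" by (simp add: join_def)
    ultimately show ?thesis using m by (meson converse_rtrancl_into_rtrancl subsetD)
  qed
qed

text \<open>Contracting the second tree to the attachment vertex turns a walk around an edge of
  the first tree into one inside the first tree.\<close>

lemma join_bridge:
  assumes s: "simple_graph T1" "simple_graph T2" "verts T1 \<inter> verts T2 = {}"
    and r: "r1 \<in> verts T1" "r2 \<in> verts T2" and b: "all_bridges T1"
    and e: "{a, b} \<in> edges T1"
  shows "(a, b) \<notin> (adj_cut (join T1 T2 r1 r2) a b)\<^sup>*"
proof
  let ?h = "\<lambda>v. if v \<in> verts T1 then v else r1"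
  assume ab: "(a, b) \<in> (adj_cut (join T1 T2 r1 r2) a b)\<^sup>*"
  have "(?h a, ?h v) \<in> (adj_cut T1 a b)\<^sup>*" if "(a, v) \<in> (adj_cut (join T1 T2 r1 r2) a b)\<^sup>*" for v
    using that
  proof (induction rule: rtrancl_induct)
    case (step y z)
    from step(2) consider "{y, z} = {r1, r2}" | "{y, z} \<in> edges T1" "{y, z} \<noteq> {a, b}"
      | "{y, z} \<in> edges T2" by (auto simp: adj_cut_def join_def)
    then have "?h y = ?h z \<or> (?h y, ?h z) \<in> adj_cut T1 a b"
    proof cases
      case 1 then show ?thesis using r s(3) by (auto simp: doubleton_eq_iff)
    next
      case 2 then show ?thesis using edge_verts[OF s(1)] by (auto simp: adj_cut_def)
    next
      case 3 then show ?thesis using edge_verts[OF s(2)] s(3) by auto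
    qed
    then show ?case
    proof
      assume "?h y = ?h z" then show ?thesis using step(3) by (simp only:)
    next
      assume "(?h y, ?h z) \<in> adj_cut T1 a b"
      with step(3) show ?thesis by (rule rtrancl_into_rtrancl)
    qed
  qed simp
  note this[OF ab]
  moreover have "a \<in> verts T1" "b \<in> verts T1" using edge_verts[OF s(1) e] by auto
  ultimately show False using b e by (auto simp: all_bridges_def)
qed

text \<open>An old edge stays a bridge by contracting the other tree, in either order of the two.
  The new edge is a bridge because every other edge stays inside one tree, so that membership in
  \<open>verts T1\<close> is constant along walks avoiding it.\<close>

lemma tree_join:
  assumes t: "is_tree T1" "is_tree T2" and d: "verts T1 \<inter> verts T2 = {}"
    and r: "r1 \<in> verts T1" "r2 \<in> verts T2"
  shows "is_tree (join T1 T2 r1 r2)"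
proof -
  note t' = t[unfolded is_tree_iff]
  have "r1 \<noteq> r2" using d r by auto
  then have s: "simple_graph (join T1 T2 r1 r2)"
    using t' r unfolding simple_graph_def join_def by force
  have "all_bridges (join T1 T2 r1 r2)"
    unfolding all_bridges_def
  proof (intro allI impI)
    fix a b assume "{a, b} \<in> edges (join T1 T2 r1 r2)"
    then consider "{a, b} = {r1, r2}" | "{a, b} \<in> edges T1" | "{a, b} \<in> edges T2"
      by (auto simp: join_def)
    then show "(a, b) \<notin> (adj_cut (join T1 T2 r1 r2) a b)\<^sup>*"
    proof cases
      case 1
      have "v \<in> verts T1 \<longleftrightarrow> a \<in> verts T1" if "(a, v) \<in> (adj_cut (join T1 T2 r1 r2) a b)\<^sup>*" for v
        using that
      proof (induction rule: rtrancl_induct)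
        case (step y z)
        then have "{y, z} \<in> edges T1 \<or> {y, z} \<in> edges T2" using 1 by (auto simp: adj_cut_def join_def)
        then show ?case using step(3) edge_verts[of T1 y z] edge_verts[of T2 y z] t' d by auto
      qed simp
      moreover have "a \<in> verts T1 \<longleftrightarrow> b \<notin> verts T1" using 1 r d by (auto simp: doubleton_eq_iff)
      ultimately show ?thesis by blast
    next
      case 2
      then show ?thesis using join_bridge[of T1 T2 r1 r2 a b] t' d r by auto
    next
      case 3
      then show ?thesis using join_bridge[of T2 T1 r2 r1 a b] t' d r by (auto simp: join_commute)
    qed
  qed
  then show ?thesis using s connected_join t' r by (auto simp: is_tree_iff)
qed

section \<open>The two sides of a tree edge, and nodes pointing at neighbours\<close>

lemma tree_bridge:
  assumes "is_tree T" "{a, b} \<in> edges T"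
  shows "(a, b) \<notin> (adj_cut T a b)\<^sup>*"
  using assms unfolding is_tree_iff all_bridges_def by blast

definition adj_del :: "'b ugraph \<Rightarrow> 'b \<Rightarrow> ('b \<times> 'b) set" where
  "adj_del T t = {(u, v). {u, v} \<in> edges T \<and> u \<noteq> t \<and> v \<noteq> t}"

text \<open>The arguments form an arrow: this is the part of the tree beyond \<open>t'\<close> as
  seen from \<open>t\<close>, so swapping them gives the opposite part.\<close>

definition side :: "'b ugraph \<Rightarrow> 'b \<Rightarrow> 'b \<Rightarrow> 'b set" where
  "side T t t' = {u. (t', u) \<in> (adj_cut T t t')\<^sup>*}"

lemma rtrancl_adj_del_cut: "(adj_del T t)\<^sup>* \<subseteq> (adj_cut T t t')\<^sup>*"
  by (rule rtrancl_mono) (auto simp: adj_del_def adj_cut_def doubleton_eq_iff)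

lemma side_disjoint:
  assumes "is_tree T" "{t, t'} \<in> edges T"
  shows "side T t t' \<inter> side T t' t = {}"
proof (rule ccontr)
  assume "side T t t' \<inter> side T t' t \<noteq> {}"
  then obtain u where u: "(t', u) \<in> (adj_cut T t t')\<^sup>*" "(t, u) \<in> (adj_cut T t t')\<^sup>*"
    unfolding side_def using adj_cut_commute[of T t' t] by auto
  then have "(u, t') \<in> (adj_cut T t t')\<^sup>*"
    using sym_rtrancl[OF sym_adj_cut, of T t t'] by (auto dest: symD)
  then have "(t, t') \<in> (adj_cut T t t')\<^sup>*" using u(2) by (meson rtrancl_trans)
  then show False using tree_bridge[OF assms] by simp
qed

lemma side_edge:
  assumes "{u, v} \<in> edges T" "{u, v} \<noteq> {t, t'}" "u \<in> side T t t'"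
  shows "v \<in> side T t t'"
  using assms unfolding side_def adj_cut_def by (auto intro: rtrancl_into_rtrancl)

lemma side_crossing:
  assumes T: "is_tree T" "{t, t'} \<in> edges T" and uv: "{u, v} \<in> edges T"
    and u: "u \<in> side T t t'" and v: "v \<in> side T t' t"
  shows "u = t' \<and> v = t"
proof -
  have "{u, v} = {t, t'}" using side_edge[OF uv _ u] side_disjoint[OF T] v by blast
  moreover have "t' \<in> side T t t'" by (simp add: side_def)
  then have "v \<noteq> t'" using v side_disjoint[OF T] by blast
  ultimately show ?thesis by (auto simp: doubleton_eq_iff)
qed

lemma side_cover:
  assumes "is_tree T" "{t, t'} \<in> edges T" "u \<in> verts T"
  shows "u \<in> side T t t' \<or> u \<in> side T t' t"
proof -
  have "t \<in> verts T" using edge_verts[of T t t'] assms by (auto simp: is_tree_def)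
  then have "(t, u) \<in> (adj T)\<^sup>*" using assms by (auto simp: is_tree_def connected_graph_def)
  then show ?thesis
  proof (induction rule: rtrancl_induct)
    case base then show ?case by (simp add: side_def)
  next
    case (step y z)
    show ?case
    proof (cases "{y, z} = {t, t'}")
      case True then show ?thesis by (auto simp: side_def doubleton_eq_iff)
    next
      case False
      then show ?thesis using step side_edge[of y z T] by (auto simp: insert_commute)
    qed
  qed
qed

text \<open>The neighbour is the one entered when the walk leaves \<open>t\<close> for the last
  time; each return to \<open>t\<close> in the induction discards what came before.\<close>

lemma first_step:
  assumes "(t, u) \<in> (adj T)\<^sup>*" "u \<noteq> t"
  shows "\<exists>t'. {t, t'} \<in> edges T \<and> (t', u) \<in> (adj_del T t)\<^sup>*"
  using assms
proof (induction rule: rtrancl_induct)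
  case (step y z)
  show ?case
  proof (cases "y = t")
    case True then show ?thesis using step by auto
  next
    case False
    then obtain t' where "{t, t'} \<in> edges T" "(t', y) \<in> (adj_del T t)\<^sup>*" using step by blast
    moreover have "(y, z) \<in> adj_del T t" using step False by (auto simp: adj_del_def)
    ultimately show ?thesis by (meson rtrancl_into_rtrancl)
  qed
qed simp

text \<open>Choose the node whose branch in the chosen direction is smallest.\<close>

lemma mutual_neighbours:
  assumes T: "is_tree T" and p: "\<And>t. t \<in> verts T \<Longrightarrow> {t, p t} \<in> edges T"
  shows "\<exists>t\<in>verts T. p (p t) = t"
proof (rule ccontr)
  assume none: "\<not> ?thesis"
  have s: "simple_graph T" using T by (simp add: is_tree_def)
  let ?H = "\<lambda>t. {u. (p t, u) \<in> (adj_del T t)\<^sup>*}"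
  have ne: "verts T \<noteq> {}" using T by (simp add: is_tree_def connected_graph_def)
  have fin: "finite (?H t)" if t: "t \<in> verts T" for t
  proof -
    have "?H t \<subseteq> verts T"
    proof
      fix u assume "u \<in> ?H t"
      then have "(p t, u) \<in> (adj_del T t)\<^sup>*" by simp
      then show "u \<in> verts T"
        by (induction rule: rtrancl_induct)
          (use edge_verts[OF s] p[OF t] in \<open>auto simp: adj_del_def\<close>)
    qed
    then show ?thesis using s by (auto simp: simple_graph_def finite_subset)
  qed
  obtain t where t: "t \<in> verts T" and min: "\<And>u. u \<in> verts T \<Longrightarrow> card (?H t) \<le> card (?H u)"
    using ne ex_has_least_nat[of "\<lambda>t. t \<in> verts T" _ "\<lambda>t. card (?H t)"] by blast
  let ?t' = "p t" and ?t'' = "p (p t)"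
  have t': "?t' \<in> verts T" using edge_verts[OF s p[OF t]] by simp
  have e: "{t, ?t'} \<in> edges T" "{?t', ?t''} \<in> edges T" using p t t' by auto
  have neq: "?t'' \<noteq> t" using none t by auto
  have d: "?t' \<noteq> t" "?t'' \<noteq> ?t'" using edge_neq[OF s e(1)] edge_neq[OF s e(2)] by auto
  \<comment> \<open>A walk from \<open>?t''\<close> avoiding \<open>?t'\<close> cannot come back to
    \<open>t\<close>: preceded by the step from \<open>?t'\<close> to \<open>?t''\<close>, it would
    lead from \<open>?t'\<close> to \<open>t\<close> around the edge between them.\<close>
  have nt: "u \<noteq> t" if "(?t'', u) \<in> (adj_del T ?t')\<^sup>*" for u
  proof
    assume "u = t"
    then have "(?t'', t) \<in> (adj_cut T ?t' t)\<^sup>*" using that rtrancl_adj_del_cut[of T ?t' t] by blast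
    moreover have "(?t', ?t'') \<in> adj_cut T ?t' t"
      using e neq d by (auto simp: adj_cut_def doubleton_eq_iff)
    ultimately have "(?t', t) \<in> (adj_cut T ?t' t)\<^sup>*" by (meson converse_rtrancl_into_rtrancl)
    then show False using tree_bridge[OF T, of ?t' t] e by (simp add: insert_commute)
  qed
  have "u \<in> ?H t \<and> u \<noteq> ?t'" if "(?t'', u) \<in> (adj_del T ?t')\<^sup>*" for u
    using that
  proof (induction rule: rtrancl_induct)
    case base
    have "(?t', ?t'') \<in> adj_del T t" using e d neq by (auto simp: adj_del_def)
    then show ?case using d by auto
  next
    case (step y z)
    have "y \<noteq> t" "z \<noteq> t" using nt step(1,2) by (blast intro: rtrancl_into_rtrancl)+
    then have "(y, z) \<in> adj_del T t" using step(2) by (auto simp: adj_del_def)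
    then show ?case using step by (auto simp: adj_del_def intro: rtrancl_into_rtrancl)
  qed
  then have "?H ?t' \<subseteq> ?H t - {?t'}" by auto
  moreover have "?t' \<in> ?H t" by simp
  ultimately have "?H ?t' \<subset> ?H t" by blast
  then have "card (?H ?t') < card (?H t)" using fin[OF t] by (rule psubset_card_mono[rotated])
  then show False using min[OF t'] by simp
qed

section \<open>Tree-like structures bound the order of tight brambles\<close>

lemma induced_simps [simp]:
  "verts (induced G X) = verts G \<inter> X"
  "edges (induced G X) = {e \<in> edges G. e \<subseteq> X}"
  by (simp_all add: induced_def)

text \<open>Connectivity as an induction principle: whatever spreads along the edges inside
  \<open>X\<close> reaches all of \<open>X\<close>. Typical choices of \<open>P\<close> are lying on
  one side of a tree edge and being reachable by the fugitive.\<close>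

lemma connected_induced_const:
  assumes con: "connected_graph (induced G X)" and X: "u \<in> verts G \<inter> X" "v \<in> verts G \<inter> X"
    and step: "\<And>a b. {a, b} \<in> edges G \<Longrightarrow> a \<in> X \<Longrightarrow> b \<in> X \<Longrightarrow> P a \<Longrightarrow> P b"
    and "P u"
  shows "P v"
proof -
  have "(u, v) \<in> (adj (induced G X))\<^sup>*" using con X by (simp add: connected_graph_def)
  then show ?thesis
    by (induction rule: rtrancl_induct) (use assms in auto)
qed

lemma bramble_uncovered:
  assumes "simple_graph G" "tight_bramble G \<B>" "\<not> bramble_order G \<B> \<le> k"
    and "S \<subseteq> verts G" "card S \<le> k"
  shows "\<exists>B\<in>\<B>. B \<inter> S = {}"
proof (rule ccontr)
  assume "\<not> ?thesis"
  then have "is_cover G \<B> S" using assms(4) unfolding is_cover_def by blast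
  moreover have "finite (card ` {S. is_cover G \<B> S})"
    by (rule finite_imageI, rule finite_subset[of _ "Pow (verts G)"])
      (use assms(1) in \<open>auto simp: is_cover_def simple_graph_def\<close>)
  ultimately have "bramble_order G \<B> \<le> card S" unfolding bramble_order_def by (intro Min_le) auto
  then show False using assms(3,5) by simp
qed

lemma bramble_element_ne:
  "tight_bramble G \<B> \<Longrightarrow> B \<in> \<B> \<Longrightarrow> B \<noteq> {} \<and> B \<subseteq> verts G \<and> connected_graph (induced G B)"
  unfolding tight_bramble_def by fastforce

text \<open>Each node points to the branch containing an element of the bramble that its bag misses;
  two adjacent nodes pointing to each other locate the obstruction.\<close>

lemma bramble_tree_edge:
  fixes \<tau> :: "'a \<Rightarrow> 'b set"
  assumes T: "is_tree T" and G: "simple_graph G" and B: "tight_bramble G \<B>"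
    and sub: "\<And>x. x \<in> verts G \<Longrightarrow> connected_graph (induced T (\<tau> x)) \<and> \<tau> x \<subseteq> verts T"
    and edge: "\<And>x y. {x, y} \<in> edges G \<Longrightarrow> \<exists>a\<in>\<tau> x. \<exists>b\<in>\<tau> y. a = b \<or> {a, b} \<in> edges T"
    and unc: "\<And>t. t \<in> verts T \<Longrightarrow> \<exists>B\<in>\<B>. \<forall>x\<in>B. t \<notin> \<tau> x"
  shows "\<exists>t t' B B'. {t, t'} \<in> edges T \<and> B \<in> \<B> \<and> B' \<in> \<B> \<and>
    (\<forall>x\<in>B. \<tau> x \<subseteq> side T t t') \<and> (\<forall>x\<in>B'. \<tau> x \<subseteq> side T t' t)"
proof -
  have Ts: "simple_graph T" using T by (simp add: is_tree_def)
  have "\<exists>t' B. B \<in> \<B> \<and> {t, t'} \<in> edges T \<and> (\<forall>x\<in>B. \<tau> x \<subseteq> side T t t')" if t: "t \<in> verts T" for t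
  proof -
    obtain B0 where B0: "B0 \<in> \<B>" "\<And>x. x \<in> B0 \<Longrightarrow> t \<notin> \<tau> x" using unc[OF t] by blast
    have B0v: "B0 \<noteq> {}" "B0 \<subseteq> verts G" "connected_graph (induced G B0)"
      using bramble_element_ne[OF B B0(1)] by auto
    obtain x0 where x0: "x0 \<in> B0" using B0v by blast
    then have c0: "connected_graph (induced T (\<tau> x0))" "\<tau> x0 \<subseteq> verts T" using sub B0v by auto
    then obtain u where u: "u \<in> \<tau> x0" "u \<in> verts T" by (auto simp: connected_graph_def)
    have "u \<noteq> t" using u x0 B0(2) by auto
    have "(t, u) \<in> (adj T)\<^sup>*" using T t u by (auto simp: is_tree_def connected_graph_def)
    from first_step[OF this \<open>u \<noteq> t\<close>] obtain t' where t': "{t, t'} \<in> edges T"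
      and "(t', u) \<in> (adj_del T t)\<^sup>*" by blast
    then have us: "u \<in> side T t t'" using rtrancl_adj_del_cut[of T t t'] by (auto simp: side_def)
    \<comment> \<open>A subtree avoiding \<open>t\<close> cannot use the edge \<open>{t, t'}\<close>
      and so stays on one side. The same holds for the step between the subtrees of adjacent
      vertices, so that connectivity of \<open>B0\<close> carries the side to all its
      vertices.\<close>
    have one: "\<tau> x \<subseteq> side T t t'" if x: "x \<in> B0" and v: "v \<in> \<tau> x" "v \<in> side T t t'" for x v
    proof
      fix w assume w: "w \<in> \<tau> x"
      have c: "connected_graph (induced T (\<tau> x))" "\<tau> x \<subseteq> verts T" using x sub B0v by auto
      show "w \<in> side T t t'"
      proof (rule connected_induced_const[OF c(1), of v w])
        fix a b assume ab: "{a, b} \<in> edges T" "a \<in> \<tau> x" "b \<in> \<tau> x" "a \<in> side T t t'"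
        have "{a, b} \<noteq> {t, t'}" using B0(2)[OF x] ab(2,3) by auto
        then show "b \<in> side T t t'" using side_edge ab by metis
      qed (use v w c in auto)
    qed
    have "\<tau> x \<subseteq> side T t t'" if x: "x \<in> B0" for x
    proof (rule connected_induced_const[OF B0v(3), of x0 x])
      fix a b assume ab: "{a, b} \<in> edges G" "a \<in> B0" "b \<in> B0" "\<tau> a \<subseteq> side T t t'"
      obtain p q where pq: "p \<in> \<tau> a" "q \<in> \<tau> b" "p = q \<or> {p, q} \<in> edges T" using edge[OF ab(1)] by blast
      have "p \<noteq> t" "q \<noteq> t" using pq B0(2) ab by auto
      then have "{p, q} \<noteq> {t, t'}" by auto
      then have "q \<in> side T t t'" using pq ab(4) side_edge[of p q T] by blast
      then show "\<tau> b \<subseteq> side T t t'" using one[OF ab(3) pq(2)] by simp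
    qed (use x x0 B0v one[OF x0 u(1) us] in auto)
    then show ?thesis using t' B0 by blast
  qed
  then obtain p \<beta> where p: "\<And>t. t \<in> verts T \<Longrightarrow> \<beta> t \<in> \<B> \<and> {t, p t} \<in> edges T \<and>
      (\<forall>x\<in>\<beta> t. \<tau> x \<subseteq> side T t (p t))"
    by metis
  obtain t where t: "t \<in> verts T" "p (p t) = t" using mutual_neighbours[OF T, of p] p by blast
  have "p t \<in> verts T" using edge_verts[OF Ts, of t "p t"] p t by auto
  then have "{t, p t} \<in> edges T \<and> \<beta> t \<in> \<B> \<and> \<beta> (p t) \<in> \<B> \<and>
    (\<forall>x\<in>\<beta> t. \<tau> x \<subseteq> side T t (p t)) \<and> (\<forall>x\<in>\<beta> (p t). \<tau> x \<subseteq> side T (p t) t)"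
    using p[of t] p[of "p t"] t by simp
  then show ?thesis by blast
qed

text \<open>Opposite pointers give two elements living on opposite sides of a tree edge. They are
  disjoint, so touching provides two distinct edges between them, and both would be counted by the
  condition on that tree edge, which allows only one.\<close>

lemma loose_imp_bramble:
  fixes T :: "'b ugraph"
  assumes G: "simple_graph G" and L: "loose_tree_decomposition G T \<chi>" and w: "decomposition_width T \<chi> \<le> k"
    and B: "tight_bramble G \<B>"
  shows "bramble_order G \<B> \<le> k"
proof (rule ccontr)
  assume big: "\<not> bramble_order G \<B> \<le> k"
  have T: "is_tree T" and bag: "\<And>t. t \<in> verts T \<Longrightarrow> \<chi> t \<subseteq> verts G"
    and L1: "\<And>x. x \<in> verts G \<Longrightarrow> connected_graph (induced T {t \<in> verts T. x \<in> \<chi> t})"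
    and L2: "\<And>e. e \<in> edges G \<Longrightarrow> \<exists>t1 t2. {t1, t2} \<in> edges T \<and> e \<subseteq> \<chi> t1 \<union> \<chi> t2"
    and L3: "\<And>t1 t2. {t1, t2} \<in> edges T \<Longrightarrow> card ({e \<in> edges G. e \<subseteq> \<chi> t1 \<union> \<chi> t2} -
        ({e \<in> edges G. e \<subseteq> \<chi> t1} \<union> {e \<in> edges G. e \<subseteq> \<chi> t2})) \<le> 1"
    using L by (auto simp: loose_tree_decomposition_def)
  have Ts: "simple_graph T" using T by (simp add: is_tree_def)
  let ?\<tau> = "\<lambda>x. {t \<in> verts T. x \<in> \<chi> t}"
  have unc: "\<exists>B\<in>\<B>. \<forall>x\<in>B. t \<notin> ?\<tau> x" if t: "t \<in> verts T" for t
  proof -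
    have "card (\<chi> t) \<le> decomposition_width T \<chi>" using t Ts
      by (simp add: decomposition_width_def simple_graph_def)
    then have "card (\<chi> t) \<le> k" using w by simp
    then show ?thesis using bramble_uncovered[OF G B big bag[OF t]] by blast
  qed
  have edge: "\<exists>a\<in>?\<tau> x. \<exists>b\<in>?\<tau> y. a = b \<or> {a, b} \<in> edges T" if "{x, y} \<in> edges G" for x y
  proof -
    obtain t1 t2 where "{t1, t2} \<in> edges T" "{x, y} \<subseteq> \<chi> t1 \<union> \<chi> t2" using L2[OF \<open>{x, y} \<in> edges G\<close>] by blast
    moreover have "t1 \<in> verts T" "t2 \<in> verts T" using edge_verts[OF Ts] calculation by auto
    moreover have "{t2, t1} \<in> edges T" using calculation by (simp add: insert_commute)
    ultimately show ?thesis by auto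
  qed
  have "\<exists>t t' B B'. {t, t'} \<in> edges T \<and> B \<in> \<B> \<and> B' \<in> \<B> \<and>
    (\<forall>x\<in>B. ?\<tau> x \<subseteq> side T t t') \<and> (\<forall>x\<in>B'. ?\<tau> x \<subseteq> side T t' t)"
    by (rule bramble_tree_edge[OF T G B]) (use L1 edge unc in auto)
  then obtain t t' B1 B2 where tt: "{t, t'} \<in> edges T" and B12: "B1 \<in> \<B>" "B2 \<in> \<B>"
    and s12: "\<forall>x\<in>B1. ?\<tau> x \<subseteq> side T t t'" "\<forall>x\<in>B2. ?\<tau> x \<subseteq> side T t' t"
    by (elim exE conjE)
  note s1 = s12(1)[rule_format] and s2 = s12(2)[rule_format]
  note dis = side_disjoint[OF T tt]
  have Bv: "B1 \<subseteq> verts G" "B2 \<subseteq> verts G" using bramble_element_ne[OF B] B12 by auto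
  have "B1 \<inter> B2 = {}"
  proof (rule ccontr)
    assume "B1 \<inter> B2 \<noteq> {}"
    then obtain x where x: "x \<in> B1" "x \<in> B2" by blast
    then have "?\<tau> x = {}" using s1 s2 dis by blast
    moreover have "connected_graph (induced T (?\<tau> x))" using L1 x Bv by blast
    ultimately show False by (metis connected_graph_def induced_simps(1) Int_empty_right)
  qed
  let ?C = "{e \<in> edges G. e \<subseteq> \<chi> t \<union> \<chi> t'} - ({e \<in> edges G. e \<subseteq> \<chi> t} \<union> {e \<in> edges G. e \<subseteq> \<chi> t'})"
  \<comment> \<open>The tree edge covering \<open>{x, y}\<close> has to cross from one side to the
    other, hence it is \<open>{t, t'}\<close>; neither of its bags contains both ends, since the
    subtrees of \<open>x\<close> and \<open>y\<close> are disjoint.\<close>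
  have cross: "{x, y} \<in> ?C" if xy: "{x, y} \<in> edges G" "x \<in> B1" "y \<in> B2" for x y
  proof -
    obtain t1 t2 where t12: "{t1, t2} \<in> edges T" "{x, y} \<subseteq> \<chi> t1 \<union> \<chi> t2" using L2[OF xy(1)] by blast
    have t12v: "t1 \<in> verts T" "t2 \<in> verts T" using edge_verts[OF Ts t12(1)] by auto
    have nd: "\<not> (x \<in> \<chi> s \<and> y \<in> \<chi> s)" if "s \<in> verts T" for s using s1[OF xy(2)] s2[OF xy(3)] dis that by blast
    have "\<exists>a b. {a, b} \<in> edges T \<and> x \<in> \<chi> a \<and> y \<in> \<chi> b"
    proof (cases "x \<in> \<chi> t1")
      case True
      then have "y \<in> \<chi> t2" using t12 nd[OF t12v(1)] by auto
      then show ?thesis using True t12 by blast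
    next
      case False
      then have "x \<in> \<chi> t2" "y \<in> \<chi> t1" using t12 nd[OF t12v(2)] by auto
      then show ?thesis using t12 by (metis insert_commute)
    qed
    then obtain a b where ab: "{a, b} \<in> edges T" "x \<in> \<chi> a" "y \<in> \<chi> b" by blast
    have "a \<in> verts T" "b \<in> verts T" using edge_verts[OF Ts ab(1)] by auto
    then have "a \<in> side T t t'" "b \<in> side T t' t" using s1[OF xy(2)] s2[OF xy(3)] ab by auto
    then have "a = t' \<and> b = t" using side_crossing[OF T tt ab(1)] by simp
    then show ?thesis using ab xy(1) nd edge_verts[OF Ts tt] by auto
  qed
  have "touching G B1 B2" using B B12 by (auto simp: tight_bramble_def)
  then obtain x1 x2 y1 y2 where "{x1, x2} \<in> edges G" "{y1, y2} \<in> edges G" "{x1, x2} \<noteq> {y1, y2}"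
    "x1 \<in> B1" "y1 \<in> B1" "x2 \<in> B2" "y2 \<in> B2"
    using \<open>B1 \<inter> B2 = {}\<close> unfolding touching_def by metis
  then have c: "{x1, x2} \<in> ?C" "{y1, y2} \<in> ?C" and ne: "{x1, x2} \<noteq> {y1, y2}" using cross by auto
  have le: "card ?C \<le> Suc 0" using L3[OF tt] by simp
  have fin: "finite ?C"
    by (rule finite_subset[of _ "Pow (verts G)"]) (use G in \<open>auto simp: simple_graph_def\<close>)
  show False using card_le_Suc0_iff_eq[OF fin, THEN iffD1, OF le, rule_format, OF c] ne by simp
qed

section \<open>Minors of tree products\<close>

lemma box_clique_edge:
  "{p, q} \<in> edges (box_clique T k) \<longleftrightarrow>
     fst p \<in> verts T \<and> fst q \<in> verts T \<and> snd p \<in> {1..k} \<and> snd q \<in> {1..k} \<and>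
     (fst p = fst q \<and> snd p \<noteq> snd q \<or> {fst p, fst q} \<in> edges T \<and> snd p = snd q)"
  (is "?l \<longleftrightarrow> ?r")
proof
  assume ?l
  then show ?r unfolding box_clique_def by (auto simp: doubleton_eq_iff insert_commute)
next
  assume ?r
  then show ?l unfolding box_clique_def
    by (cases p; cases q) auto
qed

text \<open>A discrete intermediate value argument, read off at the least \<open>m\<close> with
  \<open>Q m\<close>: the two properties hold together there or change over within one step.\<close>

lemma switch_point:
  fixes P Q :: "nat \<Rightarrow> bool"
  assumes "P 0" "Q k" "\<And>m. P m \<or> Q m"
  shows "\<exists>l m. P l \<and> Q m \<and> (l = m \<or> Suc l = m)"
proof -
  obtain m where m: "Q m" "\<And>j. j < m \<Longrightarrow> \<not> Q j" using assms(2) exists_least_iff[of Q] by blast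
  show ?thesis
  proof (cases m)
    case 0 then show ?thesis using m assms(1) by blast
  next
    case (Suc l) then show ?thesis using m assms(3)[of l] by blast
  qed
qed

text \<open>A tree edge yields \<open>k\<close> parallel edges of the product, one in each layer, so
  two elements pointing at each other may be joined by several edges. The node \<open>t\<close> is
  therefore exchanged for \<open>t'\<close> one layer at a time. Each intermediate set has one
  vertex per layer and still misses an element, which lies on one side; where the side changes, only
  the edge in a single layer can join the two elements. Disjointness of the branch sets then
  determines both ends of a connecting edge, while touching asks for two distinct ones.\<close>

lemma minor_imp_bramble:
  fixes T :: "'b ugraph"
  assumes G: "simple_graph G" and T: "is_tree T" and M: "is_minor G (box_clique T k)"
    and B: "tight_bramble G \<B>"
  shows "bramble_order G \<B> \<le> k"
proof (rule ccontr)
  assume big: "\<not> bramble_order G \<B> \<le> k"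
  have vb: "verts (box_clique T k) = verts T \<times> {1..k}" by (simp add: box_clique_def)
  obtain \<phi> :: "'a \<Rightarrow> ('b \<times> nat) set" where
    \<phi>: "\<And>v. v \<in> verts G \<Longrightarrow> \<phi> v \<subseteq> verts T \<times> {1..k} \<and> connected_graph (induced (box_clique T k) (\<phi> v))"
    and disj: "\<And>u v. u \<in> verts G \<Longrightarrow> v \<in> verts G \<Longrightarrow> u \<noteq> v \<Longrightarrow> \<phi> u \<inter> \<phi> v = {}"
    and \<phi>e: "\<And>u v. {u, v} \<in> edges G \<Longrightarrow> \<exists>a\<in>\<phi> u. \<exists>b\<in>\<phi> v. {a, b} \<in> edges (box_clique T k)"
    using M unfolding is_minor_def vb by metis
  have Ts: "simple_graph T" using T by (simp add: is_tree_def)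
  have range: "i \<in> {1..k}" if "(s, i) \<in> \<phi> v" "v \<in> B0" "B0 \<in> \<B>" for s i v B0
  proof -
    have "v \<in> verts G" using bramble_element_ne[OF B that(3)] that(2) by auto
    then show ?thesis using \<phi>[of v] that(1) by blast
  qed
  \<comment> \<open>One product vertex is chosen in every layer and each belongs to at most one
    branch set, so at most \<open>k\<close> vertices of \<open>G\<close> are hit.\<close>
  have unc: "\<exists>B\<in>\<B>. \<forall>v\<in>B. \<forall>i. (g i, i) \<notin> \<phi> v" for g :: "nat \<Rightarrow> 'b"
  proof -
    let ?V = "\<lambda>i. {v \<in> verts G. (g i, i) \<in> \<phi> v}"
    let ?S = "\<Union>i\<in>{1..k}. ?V i"
    have "card (?V i) \<le> 1" for i
    proof -
      have "finite (?V i)" using G by (simp add: simple_graph_def)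
      moreover have "\<forall>a\<in>?V i. \<forall>b\<in>?V i. a = b" using disj by blast
      ultimately show ?thesis using card_le_Suc0_iff_eq[of "?V i"] by simp
    qed
    then have "(\<Sum>i\<in>{1..k}. card (?V i)) \<le> (\<Sum>i\<in>{1..k}. 1)" by (intro sum_mono) simp
    then have "card ?S \<le> k" using card_UN_le[of "{1..k}" ?V] by simp
    then obtain B' where B': "B' \<in> \<B>" "B' \<inter> ?S = {}" using bramble_uncovered[OF G B big, of ?S] by auto
    have "(g i, i) \<notin> \<phi> v" if v: "v \<in> B'" for v i
    proof
      assume m: "(g i, i) \<in> \<phi> v"
      have "v \<in> verts G" using bramble_element_ne[OF B B'(1)] v by auto
      then show False using m range[OF m v B'(1)] B'(2) v by blast
    qed
    then show ?thesis using B'(1) by blast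
  qed
  let ?\<tau> = "\<lambda>v. fst ` \<phi> v"
  have sub: "connected_graph (induced T (?\<tau> x)) \<and> ?\<tau> x \<subseteq> verts T" if x: "x \<in> verts G" for x
  proof
    show sv: "?\<tau> x \<subseteq> verts T" using \<phi>[OF x] by auto
    have c: "connected_graph (induced (box_clique T k) (\<phi> x))" using \<phi>[OF x] by simp
    show "connected_graph (induced T (?\<tau> x))" unfolding connected_graph_def
    proof (intro conjI ballI)
      have "\<phi> x \<noteq> {}" using c by (auto simp: connected_graph_def)
      then show "verts (induced T (?\<tau> x)) \<noteq> {}" using sv by auto
      fix u v assume "u \<in> verts (induced T (?\<tau> x))" "v \<in> verts (induced T (?\<tau> x))"
      then obtain p q where pq: "p \<in> \<phi> x" "q \<in> \<phi> x" "u = fst p" "v = fst q" by auto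
      have "(fst p, fst q) \<in> (adj (induced T (?\<tau> x)))\<^sup>*"
      proof (rule connected_induced_const[OF c, of p q])
        fix a b assume ab: "{a, b} \<in> edges (box_clique T k)" "a \<in> \<phi> x" "b \<in> \<phi> x"
          "(fst p, fst a) \<in> (adj (induced T (?\<tau> x)))\<^sup>*"
        have "fst a = fst b \<or> (fst a, fst b) \<in> adj (induced T (?\<tau> x))"
          using ab(1-3) by (auto simp: box_clique_edge)
        then show "(fst p, fst b) \<in> (adj (induced T (?\<tau> x)))\<^sup>*"
          using ab(4) by (metis (no_types, lifting) rtrancl_into_rtrancl)
      qed (use pq \<phi>[OF x] vb in auto)
      then show "(u, v) \<in> (adj (induced T (?\<tau> x)))\<^sup>*" using pq by simp
    qed
  qed
  have edge: "\<exists>a\<in>?\<tau> x. \<exists>b\<in>?\<tau> y. a = b \<or> {a, b} \<in> edges T" if "{x, y} \<in> edges G" for x y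
    using \<phi>e[OF that] by (auto simp: box_clique_edge)
  have unc': "\<exists>B\<in>\<B>. \<forall>x\<in>B. t \<notin> ?\<tau> x" for t
  proof -
    obtain B0 where "B0 \<in> \<B>" "\<And>v i. v \<in> B0 \<Longrightarrow> (t, i) \<notin> \<phi> v" using unc[of "\<lambda>_. t"] by blast
    then show ?thesis by (intro bexI[of _ B0]) auto
  qed
  have "\<exists>t t' B B'. {t, t'} \<in> edges T \<and> B \<in> \<B> \<and> B' \<in> \<B> \<and>
    (\<forall>x\<in>B. ?\<tau> x \<subseteq> side T t t') \<and> (\<forall>x\<in>B'. ?\<tau> x \<subseteq> side T t' t)"
    by (rule bramble_tree_edge[OF T G B], erule sub, erule edge, rule unc')
  then obtain t t' B1 B2 where tt: "{t, t'} \<in> edges T" and B12: "B1 \<in> \<B>" "B2 \<in> \<B>"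
    and s12: "\<forall>x\<in>B1. ?\<tau> x \<subseteq> side T t t'" "\<forall>x\<in>B2. ?\<tau> x \<subseteq> side T t' t"
    by (elim exE conjE)
  note s1 = s12(1)[rule_format] and s2 = s12(2)[rule_format]
  note dis = side_disjoint[OF T tt]
  have tside: "t \<in> side T t' t" "t' \<in> side T t t'" by (auto simp: side_def)
  \<comment> \<open>The section takes \<open>t'\<close> in the layers up to \<open>m\<close> and
    \<open>t\<close> above. Layers are numbered from 1, so \<open>m = 0\<close> gives all copies of
    \<open>t\<close> and \<open>m = k\<close> all copies of \<open>t'\<close>.\<close>
  let ?g = "\<lambda>m i. (if i \<le> m then t' else t, i)"
  let ?P = "\<lambda>m B. B \<in> \<B> \<and> (\<forall>v\<in>B. \<forall>i. ?g m i \<notin> \<phi> v) \<and> (\<forall>v\<in>B. ?\<tau> v \<subseteq> side T t t')"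
  let ?Q = "\<lambda>m B. B \<in> \<B> \<and> (\<forall>v\<in>B. \<forall>i. ?g m i \<notin> \<phi> v) \<and> (\<forall>v\<in>B. ?\<tau> v \<subseteq> side T t' t)"
  have P0: "?P 0 B1"
  proof (intro conjI ballI allI notI)
    fix v i assume v: "v \<in> B1" "?g 0 i \<in> \<phi> v"
    then have "i \<noteq> 0" using range[OF v(2) v(1) B12(1)] by simp
    then have "t \<in> ?\<tau> v" using v by force
    then show False using s1[OF v(1)] tside dis by blast
  qed (use B12 s1 in auto)
  have Qk: "?Q k B2"
  proof (intro conjI ballI allI notI)
    fix v i assume v: "v \<in> B2" "?g k i \<in> \<phi> v"
    then have "i \<le> k" using range[OF v(2) v(1) B12(2)] by simp
    then have "t' \<in> ?\<tau> v" using v by force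
    then show False using s2[OF v(1)] tside dis by blast
  qed (use B12 s2 in auto)
  have PQ: "\<exists>B. ?P m B \<or> ?Q m B" for m
  proof -
    obtain B0 where B0: "B0 \<in> \<B>" and av: "\<And>v i. v \<in> B0 \<Longrightarrow> ?g m i \<notin> \<phi> v"
      using unc[of "\<lambda>i. if i \<le> m then t' else t"] by blast
    have B0v: "B0 \<noteq> {}" "B0 \<subseteq> verts G" "connected_graph (induced G B0)"
      using bramble_element_ne[OF B B0] by auto
    \<comment> \<open>Every product edge over \<open>{t, t'}\<close> lies in one layer and has an
      end in the section, so branch sets avoiding the section never use it.\<close>
    have inside: "fst b \<in> side T s s'"
      if ss: "{s, s'} = {t, t'}" and "x \<in> B0" "y \<in> B0" "a \<in> \<phi> x" "b \<in> \<phi> y"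
        "{a, b} \<in> edges (box_clique T k)" "fst a \<in> side T s s'" for x y a b s s'
    proof (cases "fst a = fst b")
      case False
      then have e: "{fst a, fst b} \<in> edges T" "snd a = snd b" using that by (auto simp: box_clique_edge)
      show ?thesis
      proof (rule side_edge[OF e(1) _ that(7)])
        show "{fst a, fst b} \<noteq> {s, s'}"
        proof
          assume "{fst a, fst b} = {s, s'}"
          then have "?g m (snd a) = a \<or> ?g m (snd a) = b" using e(2) ss
            by (cases a; cases b) (auto simp: doubleton_eq_iff)
          then show False using av[OF that(2)] av[OF that(3)] that(4,5) by metis
        qed
      qed
    qed (use that in auto)
    have all: "\<forall>y\<in>B0. ?\<tau> y \<subseteq> side T s s'"
      if ss: "{s, s'} = {t, t'}" and x0: "x0 \<in> B0" "p0 \<in> \<phi> x0" "fst p0 \<in> side T s s'" for x0 p0 s s'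
    proof -
      have one: "?\<tau> x \<subseteq> side T s s'" if x: "x \<in> B0" "p \<in> \<phi> x" "fst p \<in> side T s s'" for x p
      proof -
        have c: "connected_graph (induced (box_clique T k) (\<phi> x))" "\<phi> x \<subseteq> verts (box_clique T k)"
          using \<phi>[of x] x B0v vb by auto
        have "fst q \<in> side T s s'" if q: "q \<in> \<phi> x" for q
          by (rule connected_induced_const[OF c(1), of p q])
            (use c q x inside[OF ss x(1) x(1)] in auto)
        then show ?thesis by blast
      qed
      show ?thesis
      proof
        fix y assume y: "y \<in> B0"
        show "?\<tau> y \<subseteq> side T s s'"
        proof (rule connected_induced_const[OF B0v(3), of x0 y])
          fix a b assume ab: "{a, b} \<in> edges G" "a \<in> B0" "b \<in> B0" "?\<tau> a \<subseteq> side T s s'"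
          obtain p q where "p \<in> \<phi> a" "q \<in> \<phi> b" "{p, q} \<in> edges (box_clique T k)" using \<phi>e[OF ab(1)] by blast
          then show "?\<tau> b \<subseteq> side T s s'"
            using inside[OF ss ab(2,3)] ab one[OF ab(3)] by blast
        qed (use y x0 B0v one[OF x0] in auto)
      qed
    qed
    obtain x0 where x0: "x0 \<in> B0" using B0v by blast
    have "x0 \<in> verts G" using x0 B0v by auto
    then obtain p0 where p0: "p0 \<in> \<phi> x0" "fst p0 \<in> verts T" using \<phi>[of x0]
      by (fastforce simp: connected_graph_def)
    have "?P m B0 \<or> ?Q m B0"
      using side_cover[OF T tt p0(2)] all[of t t', OF _ x0 p0(1)] all[of t' t, OF _ x0 p0(1)] B0 av
      by (auto simp: insert_commute)
    then show ?thesis by blast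
  qed
  define P Q where "P = (\<lambda>m. \<exists>B. ?P m B)" and "Q = (\<lambda>m. \<exists>B. ?Q m B)"
  have "P 0" unfolding P_def by (rule exI, rule P0)
  moreover have "Q k" unfolding Q_def by (rule exI, rule Qk)
  moreover have "P m \<or> Q m" for m unfolding P_def Q_def using PQ[of m] by (simp only: ex_disj_distrib)
  ultimately obtain l m where B34: "P l" "Q m" and lm: "l = m \<or> Suc l = m"
    using switch_point[of P Q k] by blast
  obtain B3 where B3: "?P l B3" using B34(1) unfolding P_def by (elim exE)
  obtain B4 where B4: "?Q m B4" using B34(2) unfolding Q_def by (elim exE)
  note b3 = conjunct1[OF B3] conjunct1[OF conjunct2[OF B3]] conjunct2[OF conjunct2[OF B3]]
    and b4 = conjunct1[OF B4] conjunct1[OF conjunct2[OF B4]] conjunct2[OF conjunct2[OF B4]]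
  have v34: "B3 \<subseteq> verts G" "B4 \<subseteq> verts G" using B3 B4 bramble_element_ne[OF B] by auto
  have ne: "\<phi> x \<noteq> {}" if "x \<in> verts G" for x using \<phi>[OF that] by (auto simp: connected_graph_def)
  have "B3 \<inter> B4 = {}"
  proof (rule ccontr)
    assume "B3 \<inter> B4 \<noteq> {}"
    then obtain x where x: "x \<in> B3" "x \<in> B4" by blast
    then have "?\<tau> x = {}" using B3 B4 dis by blast
    then show False using ne[of x] x v34 by auto
  qed
  \<comment> \<open>The layer of a connecting edge is above \<open>l\<close>, as its end over
    \<open>t'\<close> is avoided up to there, and at most \<open>m\<close>, as its end over
    \<open>t\<close> is avoided beyond; so it is \<open>m\<close>.\<close>
  have cross: "(t', m) \<in> \<phi> x \<and> (t, m) \<in> \<phi> y" if xy: "{x, y} \<in> edges G" "x \<in> B3" "y \<in> B4" for x y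
  proof -
    obtain a b where ab: "a \<in> \<phi> x" "b \<in> \<phi> y" "{a, b} \<in> edges (box_clique T k)" using \<phi>e[OF xy(1)] by blast
    have f: "fst a \<in> side T t t'" "fst b \<in> side T t' t"
      using subsetD[OF bspec[OF b3(3) xy(2)] imageI[OF ab(1)]]
        subsetD[OF bspec[OF b4(3) xy(3)] imageI[OF ab(2)]] by simp_all
    then have "fst a \<noteq> fst b" using dis by auto
    then have e: "{fst a, fst b} \<in> edges T" "snd a = snd b" using ab(3) by (auto simp: box_clique_edge)
    have "fst a = t' \<and> fst b = t" using side_crossing[OF T tt e(1) f] .
    then have a': "a = (t', snd a)" "b = (t, snd a)" using e(2) by (metis prod.collapse)+
    have "\<not> snd a \<le> l" using spec[OF bspec[OF b3(2) xy(2)], of "snd a"] ab(1) a'(1) by auto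
    moreover have "snd a \<le> m" using spec[OF bspec[OF b4(2) xy(3)], of "snd a"] ab(2) a'(2) by (auto split: if_splits)
    ultimately have "snd a = m" using lm by auto
    then show ?thesis using a' ab by auto
  qed
  have "touching G B3 B4" using B B3 B4 by (auto simp: tight_bramble_def)
  then obtain x1 x2 y1 y2 where xy: "{x1, x2} \<in> edges G" "{y1, y2} \<in> edges G" "{x1, x2} \<noteq> {y1, y2}"
    "x1 \<in> B3" "y1 \<in> B3" "x2 \<in> B4" "y2 \<in> B4"
    using \<open>B3 \<inter> B4 = {}\<close> unfolding touching_def by metis
  have "x1 = y1" using disj[of x1 y1] cross[OF xy(1,4,6)] cross[OF xy(2,5,7)] xy v34 by blast
  moreover have "x2 = y2" using disj[of x2 y2] cross[OF xy(1,4,6)] cross[OF xy(2,5,7)] xy v34 by blast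
  ultimately show False using xy(3) by simp
qed

section \<open>Searches guided by a decomposition\<close>

definition boundary :: "'a ugraph \<Rightarrow> 'a set set \<Rightarrow> 'a set" where
  "boundary G C = {v. \<exists>e\<in>C. \<exists>f\<in>edges G - C. v \<in> e \<and> v \<in> f}"

text \<open>\<open>clearable G k S C\<close>: from position \<open>S\<close> the searchers can clear \<open>C\<close> without ever giving
  back an edge.  The derivation tree also is a loose tree-decomposition with a root bag \<open>S\<close>.\<close>

inductive clearable :: "'a ugraph \<Rightarrow> nat \<Rightarrow> 'a set \<Rightarrow> 'a set set \<Rightarrow> bool" for G k where
  empty: "S \<subseteq> verts G \<Longrightarrow> card S \<le> k \<Longrightarrow> clearable G k S {}"
| edge: "S \<subseteq> verts G \<Longrightarrow> card S \<le> k \<Longrightarrow> e \<in> edges G \<Longrightarrow> e \<subseteq> S \<Longrightarrow> clearable G k S {e}"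
| union: "clearable G k S C1 \<Longrightarrow> clearable G k S C2 \<Longrightarrow> \<Union>C1 \<inter> \<Union>C2 \<subseteq> S \<Longrightarrow>
    clearable G k S (C1 \<union> C2)"
| remove: "clearable G k S C \<Longrightarrow> v \<in> verts G \<Longrightarrow> v \<notin> S \<Longrightarrow> v \<notin> \<Union>C \<Longrightarrow> card (insert v S) \<le> k \<Longrightarrow>
    clearable G k (insert v S) C"
| place: "clearable G k (insert v S) C \<Longrightarrow> v \<notin> S \<Longrightarrow> v \<in> \<Union>C \<Longrightarrow> boundary G C \<subseteq> S \<Longrightarrow>
    clearable G k S C"
| slide: "clearable G k (insert y A) P \<Longrightarrow> x \<notin> A \<Longrightarrow> y \<notin> A \<Longrightarrow> {x, y} \<in> edges G \<Longrightarrow> x \<notin> \<Union>P \<Longrightarrow>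
    boundary G (insert {x, y} P) \<subseteq> insert x A \<Longrightarrow>
    clearable G k (insert x A) (insert {x, y} P)"

lemma clearable_invariant:
  assumes "simple_graph G" "clearable G k S C"
  shows "S \<subseteq> verts G \<and> card S \<le> k \<and> C \<subseteq> edges G \<and> boundary G C \<subseteq> S"
  using assms(2)
proof (induction rule: clearable.induct)
  case (place v S C)
  have "finite (insert v S)" using place assms(1) by (auto simp: simple_graph_def intro: finite_subset)
  then have "card S \<le> card (insert v S)" by (intro card_mono) auto
  then show ?case using place by auto
next
  case (slide y A P x)
  have f: "finite A" using slide assms(1) by (auto simp: simple_graph_def intro: finite_subset)
  have "x \<in> verts G" using edge_verts[OF assms(1) slide(4)] by simp
  moreover have "card (insert x A) = card (insert y A)" using slide f by simp
  ultimately show ?case using slide by auto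
qed (auto simp: boundary_def)

section \<open>The territory of the fugitive and monotone winning positions\<close>

definition territory :: "'a ugraph \<Rightarrow> 'a set \<Rightarrow> 'a set \<Rightarrow> 'a set set" where
  "territory G S e = {f. (e, f) \<in> {(a, b). a \<in> edges G \<and> b \<in> edges G \<and> \<not> a \<inter> b \<subseteq> S}\<^sup>*}"

lemma territory_refl: "e \<in> territory G S e"
  by (simp add: territory_def)

lemma territory_step:
  "f \<in> territory G S e \<Longrightarrow> f \<in> edges G \<Longrightarrow> g \<in> edges G \<Longrightarrow> w \<in> f \<Longrightarrow> w \<in> g \<Longrightarrow> w \<notin> S \<Longrightarrow>
    g \<in> territory G S e"
  unfolding territory_def by (auto intro: rtrancl_into_rtrancl)

lemma territory_least:
  assumes "f \<in> territory G S e" "e \<in> X"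
    and "\<And>a b w. a \<in> X \<Longrightarrow> a \<in> edges G \<Longrightarrow> b \<in> edges G \<Longrightarrow> w \<in> a \<Longrightarrow> w \<in> b \<Longrightarrow> w \<notin> S \<Longrightarrow> b \<in> X"
  shows "f \<in> X"
  using assms(1) unfolding territory_def mem_Collect_eq
  by (induction rule: rtrancl_induct) (use assms(2,3) in blast)+

text \<open>Winning within \<open>n\<close> moves in a monotone way. At \<open>0\<close> it fails
  because a fugitive on \<open>e\<close> is not captured without a move; capture is the case where
  the quantifier over \<open>fsp\<close> is vacuous. The territories are nested and each avoids what
  the move has cleared, so no cleared edge is entered again.\<close>

primrec wins_within :: "'a ugraph \<Rightarrow> nat \<Rightarrow> nat \<Rightarrow> 'a set \<Rightarrow> 'a set \<Rightarrow> bool" where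
  "wins_within G k 0 S e = False"
| "wins_within G k (Suc n) S e = (\<exists>S'. legitimate G S S' \<and> card S' \<le> k \<and>
     (\<forall>e'\<in>fsp G S e S'. wins_within G k n S' e' \<and>
        territory G S' e' \<subseteq> territory G S e - clear G S S'))"

lemma wins_within_Suc: "wins_within G k n S e \<Longrightarrow> wins_within G k (Suc n) S e"
proof (induction n arbitrary: S e)
  case (Suc n)
  then show ?case by (subst wins_within.simps) (metis wins_within.simps(2))
qed simp

lemma wins_within_mono: "wins_within G k m S e \<Longrightarrow> m \<le> n \<Longrightarrow> wins_within G k n S e"
  by (induction n rule: nat_induct) (auto simp: le_Suc_eq intro: wins_within_Suc simp del: wins_within.simps)

lemma avoidingD:
  assumes "avoiding G S S' fs" "Suc j < length fs" "simple_graph G"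
  shows "fs ! j \<in> edges G" "fs ! Suc j \<in> edges G" "fs ! j \<noteq> fs ! Suc j"
    "\<exists>w. w \<in> fs ! j \<and> w \<in> fs ! Suc j \<and> w \<notin> S \<inter> S'"
proof -
  have p: "pathway G fs" and d: "fs ! j \<inter> fs ! Suc j \<inter> (S \<inter> S') = {}"
    using assms by (auto simp: avoiding_def)
  show "fs ! j \<in> edges G" "fs ! Suc j \<in> edges G" using p assms(2) by (auto simp: pathway_def)
  show "fs ! j \<noteq> fs ! Suc j" using p assms(2) by (simp add: pathway_def)
  have "fs ! j \<inter> fs ! Suc j \<noteq> {}" using p assms(2) by (simp add: pathway_def)
  then show "\<exists>w. w \<in> fs ! j \<and> w \<in> fs ! Suc j \<and> w \<notin> S \<inter> S'" using d by blast
qed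

lemma accessible_territory:
  assumes "simple_graph G" "e' \<in> accessible G S e S'" "S \<inter> S' = S0"
  shows "e' \<in> territory G S0 e"
proof -
  obtain fs where fs: "avoiding G S S' fs" "hd fs = e" "last fs = e'"
    using assms by (auto simp: accessible_def)
  have ne: "fs \<noteq> []" using fs by (auto simp: avoiding_def)
  have "fs ! j \<in> territory G S0 e" if "j < length fs" for j
    using that
  proof (induction j)
    case 0
    then show ?case using fs ne by (simp add: territory_refl hd_conv_nth)
  next
    case (Suc j)
    then show ?case using avoidingD[OF fs(1) Suc.prems assms(1)] territory_step assms(3)
      by (metis Suc_lessD)
  qed
  from this[of "length fs - 1"] show ?thesis using fs ne by (simp add: last_conv_nth)
qed

lemma territory_subset:
  assumes "e \<in> C" "boundary G C \<subseteq> S"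
  shows "territory G S e \<subseteq> C"
proof
  fix f assume "f \<in> territory G S e"
  then show "f \<in> C"
    by (rule territory_least) (use assms in \<open>auto simp: boundary_def\<close>)
qed

lemma territory_trans: "f \<in> territory G S e \<Longrightarrow> territory G S f \<subseteq> territory G S e"
  unfolding territory_def by auto

lemma territory_not_within:
  assumes "f \<in> territory G S e" "\<not> e \<subseteq> S"
  shows "\<not> f \<subseteq> S"
  using territory_least[OF assms(1), of "{f. \<not> f \<subseteq> S}"] assms(2) by auto

lemma clear_subset:
  assumes "e \<in> clear G S S'"
  shows "e \<in> edges G \<and> (e \<subseteq> S' \<or> (\<exists>x y. x \<in> S - S' \<and> S' - S = {y} \<and> e = {x, y}))"
  using assms by (auto simp: clear_def)

lemma fsp_edges: "e \<in> edges G \<Longrightarrow> e' \<in> fsp G S e S' \<Longrightarrow> e' \<in> edges G"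
  by (auto simp: fsp_def accessible_def)

lemma legitimate_toggle:
  assumes "S \<subseteq> verts G" "S' \<subseteq> verts G" "sym_diff S S' = {v}"
  shows "legitimate G S S'"
  using assms unfolding legitimate_def by simp

text \<open>If both ends of \<open>e\<close> become occupied, one of them is the new vertex
  \<open>y\<close> and the other was occupied before, which is precisely when the move clears
  \<open>e\<close>.\<close>

lemma uncleared_not_within:
  assumes G: "simple_graph G" and e: "e \<in> edges G" "\<not> e \<subseteq> S" "e \<notin> clear G S S'"
    and S': "S' - S = {y}" and edge: "e \<subseteq> S' \<Longrightarrow> y \<in> e"
  shows "\<not> e \<subseteq> S'"
proof
  assume sub: "e \<subseteq> S'"
  have "card e = 2" using G e by (auto simp: simple_graph_def)
  then obtain u where u: "e = {u, y}" "u \<noteq> y" using edge[OF sub] by (auto simp: card_2_iff)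
  then have "u \<in> S" using sub S' by auto
  then show False using u e S' by (auto simp: clear_def)
qed

text \<open>Searchers are given up only where \<open>P\<close> has no edge. A walk in the new
  territory is confined to \<open>P\<close> by the boundary, so it never passes through a vertex
  that has been given up.\<close>

lemma territory_relax:
  assumes e': "e' \<in> territory G S e" "e' \<in> P" and P: "boundary G P \<subseteq> S'" "S \<inter> \<Union>P \<subseteq> S'"
  shows "territory G S' e' \<subseteq> territory G S e"
proof -
  have "f \<in> territory G S e \<inter> P" if "f \<in> territory G S' e'" for f
  proof (rule territory_least[OF that])
    fix a b w assume a: "a \<in> territory G S e \<inter> P" "a \<in> edges G" "b \<in> edges G" "w \<in> a" "w \<in> b" "w \<notin> S'"
    then have "w \<notin> S" using P(2) by auto
    then have "b \<in> territory G S e" using territory_step[of a G S e b w] a by auto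
    moreover have "b \<in> P" using a P(1) by (auto simp: boundary_def)
    ultimately show "b \<in> territory G S e \<inter> P" by simp
  qed (use e' in simp)
  then show ?thesis by blast
qed

text \<open>Read from conclusion to premise, \<open>remove\<close> lifts a searcher,
  \<open>place\<close> puts one down and \<open>slide\<close> slides one, while \<open>union\<close>
  is no move but the fugitive's choice of a part, whence the maximum of the two bounds. Edges inside
  \<open>S\<close> are left out because each move is shown to leave the fugitive on an edge with a
  free end.\<close>

lemma clearable_wins:
  assumes G: "simple_graph G" and "clearable G k S C"
  shows "\<exists>n. \<forall>e\<in>C. \<not> e \<subseteq> S \<longrightarrow> wins_within G k n S e"
  using assms(2)
proof (induction rule: clearable.induct)
  case (union S C1 C2)
  then obtain n1 n2 where "\<forall>e\<in>C1. \<not> e \<subseteq> S \<longrightarrow> wins_within G k n1 S e"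
    "\<forall>e\<in>C2. \<not> e \<subseteq> S \<longrightarrow> wins_within G k n2 S e" by blast
  then have "\<forall>e\<in>C1 \<union> C2. \<not> e \<subseteq> S \<longrightarrow> wins_within G k (max n1 n2) S e"
    using wins_within_mono[of G k _ S _ "max n1 n2"] by (meson UnE max.cobounded1 max.cobounded2)
  then show ?case by blast
next
  case (remove S C v)
  then obtain n where n: "\<And>e. e \<in> C \<Longrightarrow> \<not> e \<subseteq> S \<Longrightarrow> wins_within G k n S e" by blast
  have inv: "S \<subseteq> verts G" "card S \<le> k" "C \<subseteq> edges G" "boundary G C \<subseteq> S"
    using clearable_invariant[OF G remove(1)] by auto
  let ?S = "insert v S"
  have cl: "clear G ?S S = {}" by (auto simp: clear_def)
  have leg: "legitimate G ?S S" by (rule legitimate_toggle[of _ _ _ v]) (use inv remove in auto)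
  have "wins_within G k (Suc n) ?S e" if e: "e \<in> C" "\<not> e \<subseteq> ?S" for e
  proof -
    have "wins_within G k n S e' \<and> territory G S e' \<subseteq> territory G ?S e - clear G ?S S"
      if e': "e' \<in> fsp G ?S e S" for e'
    proof -
      have ter: "e' \<in> territory G S e"
        using e' accessible_territory[OF G, of e' ?S e S S] by (auto simp: fsp_def territory_refl)
      have C: "territory G S e \<subseteq> C" using territory_subset[OF e(1) inv(4)] .
      have "territory G S e \<subseteq> territory G ?S e"
        by (rule territory_relax[OF territory_refl e(1) inv(4)]) (use remove in auto)
      then have "territory G S e' \<subseteq> territory G ?S e" using territory_trans[OF ter] by auto
      moreover have "\<not> e' \<subseteq> S" using territory_not_within[OF ter] e(2) by auto
      ultimately show ?thesis using n[of e'] C ter cl by auto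
    qed
    then show ?thesis using leg inv by auto
  qed
  then show ?case by blast
next
  case (place v S C)
  then obtain n where n: "\<And>e. e \<in> C \<Longrightarrow> \<not> e \<subseteq> insert v S \<Longrightarrow> wins_within G k n (insert v S) e" by blast
  have inv: "insert v S \<subseteq> verts G" "card (insert v S) \<le> k" "C \<subseteq> edges G"
    using clearable_invariant[OF G place(1)] by auto
  let ?S' = "insert v S"
  have leg: "legitimate G S ?S'" by (rule legitimate_toggle[of _ _ _ v]) (use inv place in auto)
  have cl: "f \<subseteq> ?S'" if "f \<in> clear G S ?S'" for f using clear_subset[OF that] by auto
  have "wins_within G k (Suc n) S e" if e: "e \<in> C" "\<not> e \<subseteq> S" for e
  proof -
    have "wins_within G k n ?S' e' \<and> territory G ?S' e' \<subseteq> territory G S e - clear G S ?S'"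
      if e': "e' \<in> fsp G S e ?S'" for e'
    proof -
      have ter: "e' \<in> territory G S e"
        using e' accessible_territory[OF G, of e' S e ?S' S] by (auto simp: fsp_def territory_refl)
      have C: "e' \<in> C" using territory_subset[OF e(1) place(4)] ter by auto
      have nsub: "\<not> e' \<subseteq> ?S'"
      proof (cases "e' = e \<and> e' \<notin> clear G S ?S'")
        case True
        have "?S' - S = {v}" using place by auto
        then show ?thesis using uncleared_not_within[OF G, of e S ?S' v] True e inv by blast
      next
        case False
        then show ?thesis using e' by (auto simp: fsp_def accessible_def)
      qed
      have "f \<in> territory G S e" if "f \<in> territory G ?S' e'" for f
        by (rule territory_least[OF that ter]) (auto intro: territory_step)
      moreover have "f \<notin> clear G S ?S'" if "f \<in> territory G ?S' e'" for f
        using territory_not_within[OF that nsub] cl by blast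
      ultimately show ?thesis using n[OF C nsub] by auto
    qed
    then show ?thesis using leg inv by auto
  qed
  then show ?case by blast
next
  case (slide y A P x)
  then obtain n where n: "\<And>e. e \<in> P \<Longrightarrow> \<not> e \<subseteq> insert y A \<Longrightarrow> wins_within G k n (insert y A) e" by blast
  have inv: "insert y A \<subseteq> verts G" "card (insert y A) \<le> k" "P \<subseteq> edges G" "boundary G P \<subseteq> insert y A"
    using clearable_invariant[OF G slide(1)] by auto
  have xy: "x \<noteq> y" using edge_neq[OF G slide(4)] .
  have xV: "x \<in> verts G" using edge_verts[OF G slide(4)] by simp
  let ?S = "insert x A" and ?S' = "insert y A"
  have sl: "slide G ?S ?S' x y" using slide xy by (auto simp: slide_def)
  then have leg: "legitimate G ?S ?S'" using inv xV by (auto simp: legitimate_def)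
  have int: "?S \<inter> ?S' = A" using slide xy by auto
  have diff: "?S' - ?S = {y}" using slide xy by auto
  have cl: "f \<subseteq> ?S' \<or> f = {x, y}" if "f \<in> clear G ?S ?S'" for f
    using clear_subset[OF that] slide xy by auto
  have clxy: "{x, y} \<in> clear G ?S ?S'" using slide diff by (auto simp: clear_def)
  have xyP: "{x, y} \<notin> P" using slide by auto
  have edge_nsub: "\<not> f \<subseteq> ?S'" if f: "f \<in> P" "f \<notin> clear G ?S ?S'" "\<not> f \<subseteq> ?S" for f
    using uncleared_not_within[OF G _ f(3,2) diff] f inv by blast
  have "wins_within G k (Suc n) ?S e" if e: "e \<in> insert {x, y} P" "\<not> e \<subseteq> ?S" for e
  proof -
    have "wins_within G k n ?S' e' \<and> territory G ?S' e' \<subseteq> territory G ?S e - clear G ?S ?S'"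
      if e': "e' \<in> fsp G ?S e ?S'" for e'
    proof -
      \<comment> \<open>This is where the direction of a slide matters. A pathway starting with
        \<open>{x, y}\<close> continues through \<open>y\<close>, which is outside the boundary and
        so leads into \<open>P\<close>; one ending with \<open>{x, y}\<close> would have to arrive
        through \<open>x\<close>, which no edge of \<open>P\<close> contains. Hence after its start
        the pathway stays in \<open>P\<close>.\<close>
      have acc: "e' \<in> P \<and> e' \<in> territory G ?S e" if ac: "e' \<in> accessible G ?S e ?S'"
      proof -
        obtain fs where fs: "avoiding G ?S ?S' fs" "hd fs = e" "last fs = e'"
          using ac by (auto simp: accessible_def)
        have len: "length fs \<ge> 2" using fs by (simp add: avoiding_def)
        then have ne: "fs \<noteq> []" by auto
        have sc: "\<And>j. j < length fs \<Longrightarrow> fs ! j = {x, y} \<Longrightarrow> j = 0 \<or> j = length fs - 1"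
          "hd fs = {x, y} \<Longrightarrow> hd fs \<inter> fs ! 1 = {y}"
          "last fs = {x, y} \<Longrightarrow> fs ! (length fs - 2) \<inter> last fs = {x}"
          using fs(1) sl unfolding avoiding_def by blast+
        have "fs ! j \<in> insert {x, y} P \<and> fs ! j \<in> territory G ?S e \<and> (j > 0 \<longrightarrow> fs ! j \<in> P)"
          if "j < length fs" for j
          using that
        proof (induction j)
          case 0
          then show ?case using fs ne e by (simp add: territory_refl hd_conv_nth)
        next
          case (Suc j)
          let ?a = "fs ! j" and ?b = "fs ! Suc j"
          note av = avoidingD[OF fs(1) Suc.prems G]
          obtain w where w: "w \<in> ?a" "w \<in> ?b" "w \<notin> A" using av(4) int by auto
          have IH: "?a \<in> insert {x, y} P" "?a \<in> territory G ?S e" "j > 0 \<longrightarrow> ?a \<in> P"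
            using Suc by auto
          have "?b \<in> P \<and> ?b \<in> territory G ?S e"
          proof (cases "?a = {x, y}")
            case True
            then have "j = 0" using IH(3) xyP by auto
            then have "hd fs = {x, y}" using True ne by (simp add: hd_conv_nth)
            then have yb: "y \<in> ?b" using sc(2) \<open>j = 0\<close> by auto
            have "?b \<noteq> {x, y}" using av(3) True by simp
            then have "?b \<in> P" using slide(6) yb av(2) slide(3) xy by (auto simp: boundary_def)
            moreover have "?b \<in> territory G ?S e"
              using territory_step[OF IH(2) av(1,2), of y] yb True slide xy by auto
            ultimately show ?thesis by simp
          next
            case False
            then have aP: "?a \<in> P" using IH(1) by simp
            then have wx: "w \<noteq> x" using w slide by auto
            have nb: "?b \<noteq> {x, y}"
            proof
              assume b: "?b = {x, y}"
              then have "Suc j = length fs - 1" using sc(1)[OF Suc.prems] by auto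
              then have j: "j = length fs - 2" by simp
              have "last fs = {x, y}" using b \<open>Suc j = length fs - 1\<close> ne by (simp add: last_conv_nth)
              then have "x \<in> ?a" using sc(3) j by blast
              then show False using aP slide by auto
            qed
            have "?b \<in> P" using slide(6) nb w wx aP av(2) by (auto simp: boundary_def)
            moreover have "?b \<in> territory G ?S e" using territory_step[OF IH(2) av(1,2) w(1,2)] wx w by auto
            ultimately show ?thesis by simp
          qed
          then show ?case by simp
        qed
        from this[of "length fs - 1"] show ?thesis using fs ne len by (simp add: last_conv_nth)
      qed
      have ter: "e' \<in> P \<and> e' \<in> territory G ?S e \<and> \<not> e' \<subseteq> ?S'"
      proof (cases "e' \<in> accessible G ?S e ?S'")
        case True
        then show ?thesis using acc by (auto simp: accessible_def)
      next
        case False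
        then have s: "e' = e" "e' \<notin> clear G ?S ?S'" using e' by (auto simp: fsp_def)
        then have "e' \<in> P" using e clxy by auto
        then show ?thesis using s e edge_nsub territory_refl by metis
      qed
      have tP: "territory G ?S' e' \<subseteq> P" using territory_subset ter inv by blast
      have "territory G ?S' e' \<subseteq> territory G ?S e"
        by (rule territory_relax[of e' G ?S e P]) (use ter inv slide in auto)
      moreover have "f \<notin> clear G ?S ?S'" if "f \<in> territory G ?S' e'" for f
        using territory_not_within[OF that] ter cl tP that xyP by blast
      ultimately show ?thesis using n[of e'] ter by auto
    qed
    then show ?thesis using leg inv by auto
  qed
  then show ?case by blast
qed auto

section \<open>From winning positions to a search strategy\<close>

definition rank :: "'a ugraph \<Rightarrow> nat \<Rightarrow> 'a set \<Rightarrow> 'a set \<Rightarrow> nat" where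
  "rank G k S e = (LEAST n. wins_within G k n S e)"

text \<open>A search strategy sees only the position and the edge, not the number of moves left. The
  least such number for the current pair therefore replaces the counter of
  \<open>wins_within\<close>, and a good move lowers it against every answer.\<close>

definition good_move :: "'a ugraph \<Rightarrow> nat \<Rightarrow> 'a set \<Rightarrow> 'a set \<Rightarrow> 'a set \<Rightarrow> bool" where
  "good_move G k S e S' \<longleftrightarrow> legitimate G S S' \<and> card S' \<le> k \<and>
     (\<forall>e'\<in>fsp G S e S'. (\<exists>n. wins_within G k n S' e') \<and> rank G k S' e' < rank G k S e \<and>
        territory G S' e' \<subseteq> territory G S e - clear G S S')"

lemma good_move_exists:
  assumes "wins_within G k n S e"
  shows "\<exists>S'. good_move G k S e S'"
proof -
  have r: "wins_within G k (rank G k S e) S e" unfolding rank_def using assms by (rule LeastI)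
  then obtain m where m: "rank G k S e = Suc m" by (cases "rank G k S e") auto
  then obtain S' where S': "legitimate G S S'" "card S' \<le> k"
    "\<And>e'. e' \<in> fsp G S e S' \<Longrightarrow> wins_within G k m S' e' \<and>
        territory G S' e' \<subseteq> territory G S e - clear G S S'"
    using r by auto
  have "rank G k S' e' < rank G k S e" if "e' \<in> fsp G S e S'" for e'
    using S'(3)[OF that] m unfolding rank_def[of _ _ S'] by (metis Least_le less_Suc_eq_le)
  then show ?thesis unfolding good_move_def using S' by blast
qed

lemma wins_imp_mavms:
  assumes G: "simple_graph G" and win: "\<And>e. e \<in> edges G \<Longrightarrow> \<exists>n. wins_within G k n {} e"
  shows "mavms G \<le> enat k"
proof -
  define s where "s S e = (if \<exists>n. wins_within G k n S e then SOME S'. good_move G k S e S'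
    else SOME S'. legitimate G S S')" for S e
  have good: "good_move G k S e (s S e)" if "wins_within G k n S e" for n S e
    unfolding s_def using that someI_ex[OF good_move_exists[OF that]] by auto
  have "legitimate G S (s S e)" if "S \<subseteq> verts G" "e \<in> edges G" for S e
  proof (cases "\<exists>n. wins_within G k n S e")
    case True then show ?thesis using good by (auto simp: good_move_def)
  next
    case False
    have "card e = 2" "e \<subseteq> verts G" using that G by (auto simp: simple_graph_def)
    then obtain v where v: "v \<in> verts G" by (auto simp: card_2_iff)
    \<comment> \<open>Strategies are total, so pairs from which no win is known receive some
      legitimate move; toggling an arbitrary vertex shows that one exists.\<close>
    have "legitimate G S (if v \<in> S then S - {v} else insert v S)"
      by (rule legitimate_toggle[of _ _ _ v]) (use that v in auto)
    then have "legitimate G S (SOME S'. legitimate G S S')" by (rule someI)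
    then show ?thesis using False by (simp add: s_def)
  qed
  then have strat: "search_strategy G s" by (auto simp: search_strategy_def)
  {
    fix e1 f assume f: "fugitive_strategy G e1 f"
    have f': "\<And>S e S'. e \<in> edges G \<Longrightarrow> legitimate G S S' \<Longrightarrow> f S e S' = None \<or>
        (\<exists>e'\<in>fsp G S e S'. f S e S' = Some e')" and e1: "e1 \<in> edges G"
      using f unfolding fugitive_strategy_def by (metis, blast)
    let ?p = "play s e1 f"
    \<comment> \<open>The invariant yields the cost, termination with rank plus elapsed moves as a
      potential, and monotonicity, because the edge of the fugitive belongs to its own
      territory.\<close>
    let ?inv = "\<lambda>i. card (fst (?p i)) \<le> k \<and> (\<forall>e. snd (?p i) = Some e \<longrightarrow> e \<in> edges G \<and>
        (\<exists>n. wins_within G k n (fst (?p i)) e) \<and> rank G k (fst (?p i)) e + i \<le> rank G k {} e1 \<and>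
        (\<forall>j<i. territory G (fst (?p i)) e \<inter> clear G (fst (?p j)) (fst (?p (Suc j))) = {}))"
    have inv: "?inv i" for i
    proof (induction i)
      case 0
      then show ?case using e1 win by simp
    next
      case (Suc i)
      show ?case
      proof (cases "?p i")
        case (Pair S o1)
        show ?thesis
        proof (cases o1)
          case None
          then show ?thesis using Suc Pair by simp
        next
          case (Some e)
          have fsi: "fst (?p i) = S" "snd (?p i) = Some e" using Pair Some by auto
          have p: "e \<in> edges G" "rank G k S e + i \<le> rank G k {} e1"
            "\<And>j. j < i \<Longrightarrow> territory G S e \<inter> clear G (fst (?p j)) (fst (?p (Suc j))) = {}"
            and "\<exists>n. wins_within G k n S e"
            using Suc[unfolded fsi] by blast+
          then obtain n where "wins_within G k n S e" by blast
          note gm = good[OF this, unfolded good_move_def]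
          have nxt: "?p (Suc i) = (s S e, f S e (s S e))" using Pair Some by simp
          have fst_nxt: "fst (?p (Suc i)) = s S e" using nxt by simp
          show ?thesis
          proof (intro conjI allI impI)
            show "card (fst (?p (Suc i))) \<le> k" using gm nxt by simp
            fix e' assume "snd (?p (Suc i)) = Some e'"
            then have e': "e' \<in> fsp G S e (s S e)" using f'[OF p(1), of S "s S e"] gm nxt by auto
            then show "e' \<in> edges G" by (rule fsp_edges[OF p(1)])
            note g = bspec[OF conjunct2[OF conjunct2[OF gm]] e']
            show "\<exists>n. wins_within G k n (fst (?p (Suc i))) e'" using g fst_nxt by simp
            show "rank G k (fst (?p (Suc i))) e' + Suc i \<le> rank G k {} e1"
              using g fst_nxt p(2) by simp
            fix j assume "j < Suc i"
            then consider "j < i" | "j = i" by linarith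
            then show "territory G (fst (?p (Suc i))) e' \<inter> clear G (fst (?p j)) (fst (?p (Suc j))) = {}"
            proof cases
              case 1
              then show ?thesis unfolding fst_nxt using g p(3)[OF 1] by blast
            next
              case 2
              then show ?thesis using g fsi(1) fst_nxt by auto
            qed
          qed
        qed
      qed
    qed
    have card: "card (fst (?p i)) \<le> k" for i using inv[of i] by simp
    have fin: "snd (?p (Suc (rank G k {} e1))) = None"
    proof (rule ccontr)
      assume "snd (?p (Suc (rank G k {} e1))) \<noteq> None"
      then obtain e where "snd (?p (Suc (rank G k {} e1))) = Some e" by blast
      then have "rank G k (fst (?p (Suc (rank G k {} e1)))) e + Suc (rank G k {} e1) \<le> rank G k {} e1"
        using inv by blast
      then show False by simp
    qed
    have mono: "e \<notin> clear G (fst (?p j)) (fst (?p (Suc j)))" if "snd (?p i) = Some e" "j < i" for i j e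
      using inv[of i] that territory_refl[of e G "fst (?p i)"] by blast
    note card fin mono
  } note all = this
  have "winning G s" unfolding winning_def using all(2) by blast
  moreover have "monotone_strategy G s" unfolding monotone_strategy_def using all(3) by blast
  moreover have "strategy_cost G s \<le> enat k"
    unfolding strategy_cost_def by (rule Sup_least) (use all(1) in auto)
  ultimately show ?thesis unfolding mavms_def using strat
    by (intro order_trans[OF Inf_lower]) auto
qed

lemma clearable_imp_mavms:
  assumes G: "simple_graph G" and c: "clearable G k {} (edges G)"
  shows "mavms G \<le> enat k"
proof (rule wins_imp_mavms[OF G])
  fix e assume e: "e \<in> edges G"
  obtain n where "\<forall>e\<in>edges G. \<not> e \<subseteq> {} \<longrightarrow> wins_within G k n {} e"
    using clearable_wins[OF G c] by blast
  moreover have "\<not> e \<subseteq> {}" using e G by (auto simp: simple_graph_def)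
  ultimately show "\<exists>n. wins_within G k n {} e" using e by blast
qed

section \<open>Coloured tree-decompositions\<close>

text \<open>In a loose tree-decomposition of this shape the bags of adjacent nodes are nested or differ by
  exchanging \<open>x\<close> for \<open>y\<close>; giving \<open>x\<close> and \<open>y\<close> the same colour turns the colouring into the
  second coordinate of a minor model in \<open>T \<box> K\<^sub>k\<close>.\<close>

definition linked :: "('a \<Rightarrow> nat) \<Rightarrow> 'a set \<Rightarrow> 'a set \<Rightarrow> bool" where
  "linked c A B \<longleftrightarrow> A \<subseteq> B \<or> B \<subseteq> A \<or> (\<exists>D x y. A = insert x D \<and> B = insert y D \<and> c x = c y)"

text \<open>\<open>S\<close>, \<open>U\<close> and \<open>C\<close> record the root bag, the
  vertices in bags and the edges covered so far; gluing at the root depends on these alone.\<close>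

definition coloured_decomposition ::
    "'a ugraph \<Rightarrow> nat \<Rightarrow> nat ugraph \<Rightarrow> (nat \<Rightarrow> 'a set) \<Rightarrow> ('a \<Rightarrow> nat) \<Rightarrow> nat \<Rightarrow>
      'a set \<Rightarrow> 'a set \<Rightarrow> 'a set set \<Rightarrow> bool" where
  "coloured_decomposition G k T \<chi> c r S U C \<longleftrightarrow>
     is_tree T \<and> r \<in> verts T \<and> \<chi> r = S \<and> (\<Union>t\<in>verts T. \<chi> t) = U \<and> U \<subseteq> verts G \<and>
     (\<forall>t\<in>verts T. inj_on c (\<chi> t)) \<and> c ` U \<subseteq> {1..k} \<and>
     (\<forall>x\<in>U. connected_graph (induced T {t \<in> verts T. x \<in> \<chi> t})) \<and>
     (\<forall>t1 t2. {t1, t2} \<in> edges T \<longrightarrow> linked c (\<chi> t1) (\<chi> t2)) \<and>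
     (\<forall>e\<in>C. \<exists>t1 t2. {t1, t2} \<in> edges T \<and> e \<subseteq> \<chi> t1 \<union> \<chi> t2)"

lemma coloured_decompositionD:
  assumes "coloured_decomposition G k T \<chi> c r S U C"
  shows "is_tree T" "r \<in> verts T" "\<chi> r = S" "(\<Union>t\<in>verts T. \<chi> t) = U" "U \<subseteq> verts G"
    "\<forall>t\<in>verts T. inj_on c (\<chi> t)" "c ` U \<subseteq> {1..k}"
    "\<forall>x\<in>U. connected_graph (induced T {t \<in> verts T. x \<in> \<chi> t})"
    "\<And>t1 t2. {t1, t2} \<in> edges T \<Longrightarrow> linked c (\<chi> t1) (\<chi> t2)"
    "\<And>e. e \<in> C \<Longrightarrow> \<exists>t1 t2. {t1, t2} \<in> edges T \<and> e \<subseteq> \<chi> t1 \<union> \<chi> t2"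
proof -
  note d = assms[unfolded coloured_decomposition_def]
  show "is_tree T" "r \<in> verts T" "\<chi> r = S" "(\<Union>t\<in>verts T. \<chi> t) = U" "U \<subseteq> verts G"
    "\<forall>t\<in>verts T. inj_on c (\<chi> t)" "c ` U \<subseteq> {1..k}"
    "\<forall>x\<in>U. connected_graph (induced T {t \<in> verts T. x \<in> \<chi> t})"
    by (insert d, elim conjE, assumption)+
  have 9: "\<forall>t1 t2. {t1, t2} \<in> edges T \<longrightarrow> linked c (\<chi> t1) (\<chi> t2)"
    and 10: "\<forall>e\<in>C. \<exists>t1 t2. {t1, t2} \<in> edges T \<and> e \<subseteq> \<chi> t1 \<union> \<chi> t2"
    by (insert d, elim conjE, assumption)+
  show "linked c (\<chi> t1) (\<chi> t2)" if "{t1, t2} \<in> edges T" for t1 t2 using 9 that by simp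
  show "\<exists>t1 t2. {t1, t2} \<in> edges T \<and> e \<subseteq> \<chi> t1 \<union> \<chi> t2" if "e \<in> C" for e using 10 that by blast
qed

text \<open>The lower bound \<open>N\<close> on the node names keeps the trees to be joined disjoint.\<close>

definition decomposable :: "'a ugraph \<Rightarrow> nat \<Rightarrow> 'a set \<Rightarrow> 'a set \<Rightarrow> 'a set set \<Rightarrow> bool" where
  "decomposable G k S U C \<longleftrightarrow>
     (\<forall>N. \<exists>T \<chi> c r. verts T \<subseteq> {N..} \<and> coloured_decomposition G k T \<chi> c r S U C)"

section \<open>Gluing coloured decompositions\<close>

lemma connected_graph_mono:
  assumes "connected_graph H" "verts H' = verts H" "edges H \<subseteq> edges H'"
  shows "connected_graph H'"
proof -
  have "(adj H)\<^sup>* \<subseteq> (adj H')\<^sup>*" using assms(3) by (intro rtrancl_mono) auto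
  then show ?thesis using assms(1,2) unfolding connected_graph_def by auto
qed

text \<open>The complements of the two images in \<open>{1..k}\<close> have the same size, so any
  bijection between them completes the correspondence between the images.\<close>

lemma extend_to_permutation:
  fixes f g :: "'a \<Rightarrow> nat"
  assumes "inj_on f Z" "inj_on g Z" "f ` Z \<subseteq> {1..k}" "g ` Z \<subseteq> {1..k}"
  shows "\<exists>\<pi>. bij_betw \<pi> {1..k} {1..k} \<and> (\<forall>z\<in>Z. \<pi> (f z) = g z)"
proof -
  have "card (f ` Z) = card (g ` Z)" using assms(1,2) by (simp add: card_image)
  then have "card ({1..k} - f ` Z) = card ({1..k} - g ` Z)"
    using assms(3,4) by (simp add: card_Diff_subset finite_subset)
  then obtain h where h: "bij_betw h ({1..k} - f ` Z) ({1..k} - g ` Z)"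
    using finite_same_card_bij by blast
  let ?p = "\<lambda>i. if i \<in> f ` Z then g (the_inv_into Z f i) else h i"
  have on: "?p (f z) = g z" if "z \<in> Z" for z using that assms(1) by (simp add: the_inv_into_f_f)
  have "bij_betw (\<lambda>i. g (the_inv_into Z f i)) (f ` Z) (g ` Z)"
    using bij_betw_trans[OF bij_betw_the_inv_into[OF inj_on_imp_bij_betw[OF assms(1)]]
        inj_on_imp_bij_betw[OF assms(2)]] by (simp add: comp_def)
  then have 1: "bij_betw ?p (f ` Z) (g ` Z)" by (rule bij_betw_cong[THEN iffD1, rotated]) auto
  have 2: "bij_betw ?p ({1..k} - f ` Z) ({1..k} - g ` Z)"
    using h by (rule bij_betw_cong[THEN iffD1, rotated]) auto
  have "bij_betw ?p (f ` Z \<union> ({1..k} - f ` Z)) (g ` Z \<union> ({1..k} - g ` Z))"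
    by (rule bij_betw_combine[OF 1 2]) auto
  then have "bij_betw ?p {1..k} {1..k}" using assms(3,4) by (simp add: Un_absorb1)
  then show ?thesis using on by blast
qed

lemma decomposable_single:
  assumes G: "simple_graph G" and S: "S \<subseteq> verts G" "card S \<le> k"
  shows "decomposable G k S S {}"
  unfolding decomposable_def
proof
  fix N :: nat
  let ?T = "\<lparr>verts = {N}, edges = {}\<rparr>"
  have "finite S" by (rule finite_vertices[OF G S(1)])
  then obtain c where c: "bij_betw c S {1..card S}" using ex_bij_betw_finite_nat[of S]
    by (metis card_atLeastAtMost diff_Suc_1 finite_atLeastAtMost finite_same_card_bij)
  have con: "connected_graph \<lparr>verts = {N}, edges = {}\<rparr>" by (simp add: connected_graph_def)
  have "all_bridges ?T" by (simp add: all_bridges_def)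
  then have "is_tree ?T" using con by (simp add: is_tree_iff simple_graph_def)
  moreover have "connected_graph (induced ?T {t. t = N \<and> x \<in> S})" if "x \<in> S" for x
    using that con by (simp add: induced_def)
  ultimately have "coloured_decomposition G k ?T (\<lambda>_. S) c N S S {}"
    using c S unfolding coloured_decomposition_def by (auto simp: bij_betw_def)
  moreover have "verts ?T \<subseteq> {N..}" by simp
  ultimately show "\<exists>T \<chi> c r. verts T \<subseteq> {N..} \<and> coloured_decomposition G k T \<chi> c r S S {}"
    by blast
qed

text \<open>The colours of the second tree are permuted to agree with the first on the common
  vertices, which lie in both root bags; a permutation keeps bags injectively coloured. If the roots
  exchange \<open>x\<close> for \<open>y\<close>, the permutation moreover gives \<open>y\<close>
  the colour of \<open>x\<close>, without conflict since \<open>y\<close> does not occur in the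
  first tree and \<open>x\<close> not in the second.\<close>

lemma decomposable_join:
  assumes G: "simple_graph G"
    and D1: "decomposable G k S1 U1 C1" and D2: "decomposable G k S2 U2 C2"
    and U: "U1 \<inter> U2 \<subseteq> S1 \<inter> S2"
    and link: "S1 \<subseteq> S2 \<or> S2 \<subseteq> S1 \<or>
      (\<exists>D x y. S1 = insert x D \<and> S2 = insert y D \<and> x \<notin> D \<and> y \<notin> D \<and> x \<notin> U2 \<and> y \<notin> U1)"
  shows "decomposable G k S1 (U1 \<union> U2) (C1 \<union> C2 \<union> {e. e \<subseteq> S1 \<union> S2})"
  unfolding decomposable_def
proof
  fix N :: nat
  obtain T1 \<chi>1 c1 r1 where N1: "verts T1 \<subseteq> {N..}"
    and cd1: "coloured_decomposition G k T1 \<chi>1 c1 r1 S1 U1 C1" using D1 unfolding decomposable_def by blast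
  note T1 = coloured_decompositionD[OF cd1]
  have s1: "simple_graph T1" using T1(1) by (simp add: is_tree_def)
  let ?M = "Max (insert N (verts T1))"
  obtain T2 \<chi>2 c2 r2 where N2: "verts T2 \<subseteq> {Suc ?M..}"
    and cd2: "coloured_decomposition G k T2 \<chi>2 c2 r2 S2 U2 C2" using D2 unfolding decomposable_def by blast
  note T2 = coloured_decompositionD[OF cd2]
  have s2: "simple_graph T2" using T2(1) by (simp add: is_tree_def)
  have fin1: "finite (insert N (verts T1))" using s1 by (simp add: simple_graph_def)
  have le: "t \<le> ?M" if "t \<in> verts T1" for t using Max_ge[OF fin1] that by simp
  have "N \<le> ?M" using Max_ge[OF fin1] by simp
  then have N2': "verts T2 \<subseteq> {N..}" using N2 by fastforce
  have dis: "verts T1 \<inter> verts T2 = {}"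
  proof (rule ccontr)
    assume "verts T1 \<inter> verts T2 \<noteq> {}"
    then obtain t where "t \<in> verts T1" "t \<in> verts T2" by blast
    then show False using le[of t] N2 by auto
  qed
  have SU: "S1 \<subseteq> U1" "S2 \<subseteq> U2" using T1(2-4) T2(2-4) by blast+
  have inj1: "inj_on c1 S1" and inj2: "inj_on c2 S2" using T1 T2 by auto
  have rg1: "c1 ` A \<subseteq> {1..k}" if "A \<subseteq> U1" for A using image_mono[OF that] T1(7) by (rule order_trans)
  have rg2: "c2 ` A \<subseteq> {1..k}" if "A \<subseteq> U2" for A using image_mono[OF that] T2(7) by (rule order_trans)
  have perm: "\<exists>\<pi>. bij_betw \<pi> {1..k} {1..k} \<and> (\<forall>z\<in>S1 \<inter> S2. \<pi> (c2 z) = c1 z)"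
    by (rule extend_to_permutation[OF inj_on_subset[OF inj2 Int_lower2] inj_on_subset[OF inj1 Int_lower1] rg2 rg1])
      (use SU in auto)
  have "\<exists>\<pi>. bij_betw \<pi> {1..k} {1..k} \<and> (\<forall>z\<in>S1 \<inter> S2. \<pi> (c2 z) = c1 z) \<and>
    (S1 \<subseteq> S2 \<or> S2 \<subseteq> S1 \<or> (\<exists>D x y. S1 = insert x D \<and> S2 = insert y D \<and> y \<notin> U1 \<and> c1 x = \<pi> (c2 y)))"
    using link
  proof (elim disjE exE conjE)
    fix D x y assume D: "S1 = insert x D" "S2 = insert y D" "x \<notin> D" "y \<notin> D" "x \<notin> U2" "y \<notin> U1"
    have "x \<noteq> y" using D SU by auto
    let ?g = "\<lambda>z. c1 (if z = y then x else z)"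
    have "inj_on ?g S2"
    proof (rule inj_onI)
      fix u v assume "u \<in> S2" "v \<in> S2" "?g u = ?g v"
      moreover have "(if u = y then x else u) \<in> S1" "(if v = y then x else v) \<in> S1"
        using D calculation by auto
      ultimately have "(if u = y then x else u) = (if v = y then x else v)" 
        by (intro inj_onD[OF inj1]) auto
      then show "u = v" using D \<open>u \<in> S2\<close> \<open>v \<in> S2\<close> by (auto split: if_splits)
    qed
    moreover have "?g ` S2 \<subseteq> {1..k}"
    proof (rule image_subsetI)
      fix z assume "z \<in> S2"
      then have "(if z = y then x else z) \<in> U1" using SU D by auto
      then show "?g z \<in> {1..k}" by (rule subsetD[OF T1(7) imageI])
    qed
    moreover have "c2 ` S2 \<subseteq> {1..k}" by (rule rg2[OF SU(2)])
    ultimately obtain \<pi> where "bij_betw \<pi> {1..k} {1..k}" "\<forall>z\<in>S2. \<pi> (c2 z) = ?g z"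
      using extend_to_permutation[OF inj2, of ?g k] by blast
    then have "bij_betw \<pi> {1..k} {1..k} \<and> (\<forall>z\<in>S1 \<inter> S2. \<pi> (c2 z) = c1 z) \<and> c1 x = \<pi> (c2 y)"
      using D SU by auto
    then show ?thesis using D by blast
  qed (use perm in blast)+
  then obtain \<pi> where pi: "bij_betw \<pi> {1..k} {1..k}" "\<And>z. z \<in> S1 \<Longrightarrow> z \<in> S2 \<Longrightarrow> \<pi> (c2 z) = c1 z"
    and lk: "S1 \<subseteq> S2 \<or> S2 \<subseteq> S1 \<or> (\<exists>D x y. S1 = insert x D \<and> S2 = insert y D \<and> y \<notin> U1 \<and> c1 x = \<pi> (c2 y))"
    by blast
  define c where "c v = (if v \<in> U1 then c1 v else \<pi> (c2 v))" for v
  define \<chi> where "\<chi> t = (if t \<in> verts T1 then \<chi>1 t else \<chi>2 t)" for t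
  let ?T = "join T1 T2 r1 r2"
  have c_1: "c v = c1 v" if "v \<in> U1" for v using that by (simp add: c_def)
  have c_2: "c v = \<pi> (c2 v)" if "v \<in> U2" for v
  proof (cases "v \<in> U1")
    case True
    then have "v \<in> S1" "v \<in> S2" using U that by auto
    then show ?thesis using pi(2)[of v] True by (simp add: c_def)
  qed (simp add: c_def)
  have \<chi>_1: "\<chi> t = \<chi>1 t" if "t \<in> verts T1" for t using that by (simp add: \<chi>_def)
  have \<chi>_2: "\<chi> t = \<chi>2 t" if "t \<in> verts T2" for t using that dis by (auto simp: \<chi>_def)
  have sub1: "\<chi>1 t \<subseteq> U1" if "t \<in> verts T1" for t using T1(4) that by auto
  have sub2: "\<chi>2 t \<subseteq> U2" if "t \<in> verts T2" for t using T2(4) that by auto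
  have vT: "verts ?T = verts T1 \<union> verts T2" and eT: "edges ?T = insert {r1, r2} (edges T1 \<union> edges T2)"
    by (simp_all add: join_def)
  have inj: "inj_on c (\<chi> t)" if "t \<in> verts ?T" for t
  proof (cases "t \<in> verts T1")
    case True
    have "inj_on c1 (\<chi>1 t)" using T1(6) True by blast
    then have "inj_on c (\<chi>1 t)" using c_1 sub1[OF True] by (simp add: inj_on_def subset_iff)
    then show ?thesis using \<chi>_1[OF True] by simp
  next
    case False
    then have t: "t \<in> verts T2" using that vT by auto
    have "inj_on \<pi> (c2 ` \<chi>2 t)" using bij_betw_imp_inj_on[OF pi(1)]
      by (rule inj_on_subset) (rule rg2[OF sub2[OF t]])
    then have "inj_on (\<pi> \<circ> c2) (\<chi>2 t)" using T2(6) t by (intro comp_inj_on) auto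
    then have "inj_on c (\<chi>2 t)" using c_2 sub2[OF t] by (simp add: inj_on_def subset_iff)
    then show ?thesis using \<chi>_2[OF t] by simp
  qed
  have "c v \<in> {1..k}" if "v \<in> U1 \<union> U2" for v
  proof (cases "v \<in> U1")
    case True then show ?thesis using subsetD[OF T1(7) imageI[OF True]] c_1 by simp
  next
    case False
    then have "v \<in> U2" using that by simp
    then have "c2 v \<in> {1..k}" "c v = \<pi> (c2 v)" using subsetD[OF T2(7) imageI] c_2 by simp_all
    then show ?thesis using bij_betwE[OF pi(1)] by auto
  qed
  then have range: "c ` (U1 \<union> U2) \<subseteq> {1..k}" by auto
  have con: "connected_graph (induced ?T {t \<in> verts ?T. x \<in> \<chi> t})" if x: "x \<in> U1 \<union> U2" for x
  proof -
    let ?X1 = "{t \<in> verts T1. x \<in> \<chi>1 t}" and ?X2 = "{t \<in> verts T2. x \<in> \<chi>2 t}"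
    have X: "{t \<in> verts ?T. x \<in> \<chi> t} = ?X1 \<union> ?X2" using \<chi>_1 \<chi>_2 vT by auto
    show ?thesis
    proof (cases "x \<in> U1 \<and> x \<in> U2")
      case True
      then have "x \<in> S1" "x \<in> S2" using U by auto
      then have "connected_graph (join (induced T1 ?X1) (induced T2 ?X2) r1 r2)"
        using True T1 T2 by (intro connected_join) auto
      then show ?thesis unfolding X
        by (rule connected_graph_mono) (use T1(2,3) T2(2,3) \<open>x \<in> S1\<close> \<open>x \<in> S2\<close> in \<open>auto simp: join_def\<close>)
    next
      case False
      then consider "x \<in> U1" "x \<notin> U2" | "x \<in> U2" "x \<notin> U1" using x by blast
      then show ?thesis
      proof cases
        case 1
        have e: "?X2 = {}" using 1 sub2 by auto
        have "connected_graph (induced T1 ?X1)" using T1(8) 1 by blast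
        then show ?thesis unfolding X e
          by (rule connected_graph_mono) (auto simp: join_def)
      next
        case 2
        have e: "?X1 = {}" using 2 sub1 by auto
        have "connected_graph (induced T2 ?X2)" using T2(8) 2 by blast
        then show ?thesis unfolding X e
          by (rule connected_graph_mono) (auto simp: join_def)
      qed
    qed
  qed
  have linked_rs: "linked c S1 S2 \<and> linked c S2 S1"
  proof -
    have "c x = c y" if "S1 = insert x D" "S2 = insert y D" "y \<notin> U1" "c1 x = \<pi> (c2 y)" for D x y
      using that c_1[of x] c_2[of y] SU by auto
    then show ?thesis using lk unfolding linked_def by metis
  qed
  have lnk: "linked c (\<chi> t1) (\<chi> t2)" if e: "{t1, t2} \<in> edges ?T" for t1 t2
  proof -
    consider "{t1, t2} = {r1, r2}" | "{t1, t2} \<in> edges T1" | "{t1, t2} \<in> edges T2" using e eT by auto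
    then show ?thesis
    proof cases
      case 1
      then have "t1 = r1 \<and> t2 = r2 \<or> t1 = r2 \<and> t2 = r1" by (auto simp: doubleton_eq_iff)
      then show ?thesis using linked_rs \<chi>_1[OF T1(2)] \<chi>_2[OF T2(2)] T1(3) T2(3) by auto
    next
      case 2
      then have t: "t1 \<in> verts T1" "t2 \<in> verts T1" using edge_verts[OF s1] by auto
      have "linked c (\<chi>1 t1) (\<chi>1 t2)"
        using T1(9)[OF 2] sub1[OF t(1)] sub1[OF t(2)] c_1 unfolding linked_def by (metis insert_subset)
      then show ?thesis using \<chi>_1 t by simp
    next
      case 3
      then have t: "t1 \<in> verts T2" "t2 \<in> verts T2" using edge_verts[OF s2] by auto
      have "linked c (\<chi>2 t1) (\<chi>2 t2)"
        using T2(9)[OF 3] sub2[OF t(1)] sub2[OF t(2)] c_2 unfolding linked_def by (metis insert_subset)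
      then show ?thesis using \<chi>_2 t by simp
    qed
  qed
  have cov: "\<exists>t1 t2. {t1, t2} \<in> edges ?T \<and> e \<subseteq> \<chi> t1 \<union> \<chi> t2" if e: "e \<in> C1 \<union> C2 \<union> {e. e \<subseteq> S1 \<union> S2}" for e
  proof -
    consider "e \<in> C1" | "e \<in> C2" | "e \<subseteq> S1 \<union> S2" using e by blast
    then show ?thesis
    proof cases
      case 1
      then obtain t1 t2 where t: "{t1, t2} \<in> edges T1" "e \<subseteq> \<chi>1 t1 \<union> \<chi>1 t2" using T1(10) by blast
      then have "{t1, t2} \<in> edges ?T \<and> e \<subseteq> \<chi> t1 \<union> \<chi> t2"
        using edge_verts[OF s1 t(1)] \<chi>_1 eT by simp
      then show ?thesis by blast
    next
      case 2
      then obtain t1 t2 where t: "{t1, t2} \<in> edges T2" "e \<subseteq> \<chi>2 t1 \<union> \<chi>2 t2" using T2(10) by blast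
      then have "{t1, t2} \<in> edges ?T \<and> e \<subseteq> \<chi> t1 \<union> \<chi> t2"
        using edge_verts[OF s2 t(1)] \<chi>_2 eT by simp
      then show ?thesis by blast
    next
      case 3
      then have "{r1, r2} \<in> edges ?T \<and> e \<subseteq> \<chi> r1 \<union> \<chi> r2"
        using \<chi>_1[OF T1(2)] \<chi>_2[OF T2(2)] T1(3) T2(3) eT by simp
      then show ?thesis by blast
    qed
  qed
  have bags: "(\<Union>t\<in>verts ?T. \<chi> t) = U1 \<union> U2" using vT \<chi>_1 \<chi>_2 T1(4) T2(4) by auto
  have "coloured_decomposition G k ?T \<chi> c r1 S1 (U1 \<union> U2) (C1 \<union> C2 \<union> {e. e \<subseteq> S1 \<union> S2})"
    unfolding coloured_decomposition_def
    using tree_join[OF T1(1) T2(1) dis T1(2) T2(2)] T1(2,3,5) T2(5) \<chi>_1[OF T1(2)] vT bags inj range con lnk cov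
    by auto
  moreover have "verts ?T \<subseteq> {N..}" using N1 N2' vT by auto
  ultimately show "\<exists>T \<chi> c r. verts T \<subseteq> {N..} \<and>
      coloured_decomposition G k T \<chi> c r S1 (U1 \<union> U2) (C1 \<union> C2 \<union> {e. e \<subseteq> S1 \<union> S2})"
    by blast
qed

lemma decomposable_mono:
  assumes d: "decomposable G k S U C" and C: "C' \<subseteq> C" and U: "U' = U"
  shows "decomposable G k S U' C'"
  unfolding decomposable_def
proof
  fix N
  obtain T \<chi> c r where N: "verts T \<subseteq> {N..}" and cd: "coloured_decomposition G k T \<chi> c r S U C"
    using d unfolding decomposable_def by blast
  note D = coloured_decompositionD[OF cd]
  have "\<forall>e\<in>C'. \<exists>t1 t2. {t1, t2} \<in> edges T \<and> e \<subseteq> \<chi> t1 \<union> \<chi> t2" using D(10) C by (meson subsetD)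
  then have "coloured_decomposition G k T \<chi> c r S U' C'"
    unfolding coloured_decomposition_def U by (intro conjI allI impI D(1-9))
  then show "\<exists>T \<chi> c r. verts T \<subseteq> {N..} \<and> coloured_decomposition G k T \<chi> c r S U' C'" using N by blast
qed

text \<open>Each rule for a new position puts a root with that position as its bag next to the old
  one. The conditions on \<open>\<Union>C\<close> in the rules keep the nodes containing a vertex
  connected: what the two sides share lies in both roots.\<close>

lemma clearable_decomposable:
  assumes G: "simple_graph G" and c: "clearable G k S C"
  shows "decomposable G k S (S \<union> \<Union>C) C"
  using c
proof (induction rule: clearable.induct)
  case (empty S)
  then show ?case using decomposable_single[OF G] by simp
next
  case (edge S e)
  \<comment> \<open>Covering an edge takes a tree edge, so the bag \<open>S\<close> is
    doubled.\<close>
  have "decomposable G k S (S \<union> S) ({} \<union> {} \<union> {e. e \<subseteq> S \<union> S})"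
    by (rule decomposable_join[OF G]) (use decomposable_single[OF G] edge in auto)
  then show ?case by (rule decomposable_mono) (use edge in auto)
next
  case (union S C1 C2)
  have "decomposable G k S ((S \<union> \<Union>C1) \<union> (S \<union> \<Union>C2)) (C1 \<union> C2 \<union> {e. e \<subseteq> S \<union> S})"
    by (rule decomposable_join[OF G]) (use union in auto)
  then show ?case by (rule decomposable_mono) auto
next
  case (remove S C v)
  have "decomposable G k (insert v S) (insert v S \<union> (S \<union> \<Union>C)) ({} \<union> C \<union> {e. e \<subseteq> insert v S \<union> S})"
    by (rule decomposable_join[OF G decomposable_single[OF G]])
      (use remove clearable_invariant[OF G remove(1)] in auto)
  then show ?case by (rule decomposable_mono) auto
next
  case (place v S C)
  have "clearable G k S C" using place by (auto intro: clearable.place)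
  from clearable_invariant[OF G this]
  have "decomposable G k S (S \<union> (insert v S \<union> \<Union>C)) ({} \<union> C \<union> {e. e \<subseteq> S \<union> insert v S})"
    by (intro decomposable_join[OF G decomposable_single[OF G]]) (use place in auto)
  then show ?case by (rule decomposable_mono) (use place in auto)
next
  case (slide y A P x)
  have "clearable G k (insert x A) (insert {x, y} P)" using slide by (auto intro: clearable.slide)
  note inv = clearable_invariant[OF G this]
  have xy: "x \<noteq> y" using edge_neq[OF G slide(4)] .
  have "decomposable G k (insert x A) (insert x A \<union> (insert y A \<union> \<Union>P))
      ({} \<union> P \<union> {e. e \<subseteq> insert x A \<union> insert y A})"
  proof (rule decomposable_join[OF G decomposable_single[OF G] slide(7)])
    show "insert x A \<inter> (insert y A \<union> \<Union>P) \<subseteq> insert x A \<inter> insert y A" using slide by auto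
    have "insert x A = insert x A \<and> insert y A = insert y A \<and> x \<notin> A \<and> y \<notin> A \<and>
        x \<notin> insert y A \<union> \<Union>P \<and> y \<notin> insert x A" using slide xy by auto
    then show "insert x A \<subseteq> insert y A \<or> insert y A \<subseteq> insert x A \<or>
      (\<exists>D xa ya. insert x A = insert xa D \<and> insert y A = insert ya D \<and> xa \<notin> D \<and> ya \<notin> D \<and>
        xa \<notin> insert y A \<union> \<Union>P \<and> ya \<notin> insert x A)" by blast
  qed (use inv in auto)
  then show ?case by (rule decomposable_mono) auto
qed

text \<open>Isolated vertices are missed by the edge sets and are added one by one as bags of their
  own next to the empty root bag, which uses \<open>k \<ge> 1\<close>.\<close>

lemma clearable_imp_decomposable:
  assumes G: "simple_graph G" and k: "k \<ge> 1" and c: "clearable G k {} (edges G)"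
  shows "decomposable G k {} (verts G) (edges G)"
proof -
  have eV: "\<Union>(edges G) \<subseteq> verts G" using G by (auto simp: simple_graph_def)
  have "decomposable G k {} (\<Union>(edges G) \<union> I) (edges G)" if "finite I" "I \<subseteq> verts G" for I
    using that
  proof (induction I rule: finite_induct)
    case empty
    then show ?case using clearable_decomposable[OF G c] by simp
  next
    case (insert v I)
    show ?case
    proof (cases "v \<in> \<Union>(edges G) \<union> I")
      case True
      then have "\<Union>(edges G) \<union> insert v I = \<Union>(edges G) \<union> I" by auto
      then show ?thesis using insert by simp
    next
      case False
      have "decomposable G k {v} {v} {}" by (rule decomposable_single[OF G]) (use insert k in auto)
      then have "decomposable G k {} ((\<Union>(edges G) \<union> I) \<union> {v}) (edges G \<union> {} \<union> {e. e \<subseteq> {} \<union> {v}})"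
        by (intro decomposable_join[OF G]) (use insert False in auto)
      then show ?thesis by (rule decomposable_mono) auto
    qed
  qed
  from this[of "verts G"] show ?thesis using G eV by (simp add: simple_graph_def Un_absorb1)
qed

text \<open>Injective colours from \<open>{1..k}\<close> bound the bags. Nested bags have no edge
  across, and bags exchanging \<open>x\<close> for \<open>y\<close> at most \<open>{x, y}\<close>,
  as an edge across must contain both.\<close>

lemma decomposable_imp_loose:
  assumes G: "simple_graph G" and d: "decomposable G k S (verts G) (edges G)"
  shows "\<exists>(T :: nat ugraph) \<chi>. loose_tree_decomposition G T \<chi> \<and> decomposition_width T \<chi> \<le> k"
proof -
  obtain T \<chi> c r where "coloured_decomposition G k T \<chi> c r S (verts G) (edges G)"
    using d unfolding decomposable_def by blast
  note TT = coloured_decompositionD[OF this]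
  note T = TT(1,2,4,6,7,8,9,10)
  have "card (\<chi> t) \<le> k" if t: "t \<in> verts T" for t
  proof -
    have "inj_on c (\<chi> t)" "c ` \<chi> t \<subseteq> {1..k}" using T(3-5) t by auto
    then have "card (\<chi> t) \<le> card {1..k}" by (intro card_inj_on_le) auto
    then show ?thesis by simp
  qed
  moreover have "finite (verts T)" "verts T \<noteq> {}" using T(1,2) by (auto simp: is_tree_def simple_graph_def)
  ultimately have w: "decomposition_width T \<chi> \<le> k" by (simp add: decomposition_width_def)
  have "card ({e \<in> edges G. e \<subseteq> \<chi> t1 \<union> \<chi> t2} - ({e \<in> edges G. e \<subseteq> \<chi> t1} \<union> {e \<in> edges G. e \<subseteq> \<chi> t2})) \<le> 1"
    (is "card ?C \<le> 1") if e: "{t1, t2} \<in> edges T" for t1 t2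
  proof -
    consider "\<chi> t1 \<subseteq> \<chi> t2 \<or> \<chi> t2 \<subseteq> \<chi> t1"
      | D x y where "\<chi> t1 = insert x D" "\<chi> t2 = insert y D" using T(7)[OF e] unfolding linked_def by blast
    then show ?thesis
    proof cases
      case 1
      then have "card ?C = 0" by (intro card_eq_0_iff[THEN iffD2] disjI1) auto
      then show ?thesis by linarith
    next
      case 2
      have "?C \<subseteq> {{x, y}}"
      proof
        fix f assume f: "f \<in> ?C"
        then have "x \<in> f" "y \<in> f" "x \<noteq> y" using 2 by auto
        moreover have "card f = 2" using f G by (auto simp: simple_graph_def)
        ultimately have "f = {x, y}" by (auto simp: card_2_iff)
        then show "f \<in> {{x, y}}" by simp
      qed
      then have "card ?C \<le> card {{x, y}}" by (intro card_mono) auto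
      then show ?thesis by simp
    qed
  qed
  moreover have "\<exists>t1 t2. {t1, t2} \<in> edges T \<and> e \<in> edges (induced G (\<chi> t1 \<union> \<chi> t2))" if "e \<in> edges G" for e
    using T(8)[OF that] that by auto
  ultimately have "loose_tree_decomposition G T \<chi>"
    unfolding loose_tree_decomposition_def using T(1,3,6) by auto
  then show ?thesis using w by blast
qed

text \<open>The branch set of \<open>v\<close> is its subtree in the layer of its colour;
  injectivity on bags makes branch sets disjoint. An edge inside a bag becomes an edge of a clique,
  whereas an edge across an exchange has ends of equal colour and becomes a tree edge within that
  layer.\<close>

lemma decomposable_imp_minor:
  assumes G: "simple_graph G" and d: "decomposable G k S (verts G) (edges G)"
  shows "minor_of_tree_product G k"
proof -
  obtain T \<chi> c r where "coloured_decomposition G k T \<chi> c r S (verts G) (edges G)"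
    using d unfolding decomposable_def by blast
  note TT = coloured_decompositionD[OF this]
  note T = TT(1,4,6,7,8,9,10)
  have s: "simple_graph T" using T(1) by (simp add: is_tree_def)
  let ?\<phi> = "\<lambda>v. {t \<in> verts T. v \<in> \<chi> t} \<times> {c v}"
  let ?H = "box_clique T k"
  have vH: "verts ?H = verts T \<times> {1..k}" by (simp add: box_clique_def)
  have "?\<phi> v \<subseteq> verts ?H \<and> connected_graph (induced ?H (?\<phi> v))" if v: "v \<in> verts G" for v
  proof
    have cv: "c v \<in> {1..k}" by (rule subsetD[OF T(4) imageI[OF v]])
    then show sub: "?\<phi> v \<subseteq> verts ?H" unfolding vH by auto
    have con: "connected_graph (induced T {t \<in> verts T. v \<in> \<chi> t})" using T(5) v by blast
    show "connected_graph (induced ?H (?\<phi> v))" unfolding connected_graph_def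
    proof (intro conjI ballI)
      have "{t \<in> verts T. v \<in> \<chi> t} \<noteq> {}" using con by (auto simp: connected_graph_def)
      then show "verts (induced ?H (?\<phi> v)) \<noteq> {}" using sub by auto
      fix p q assume "p \<in> verts (induced ?H (?\<phi> v))" "q \<in> verts (induced ?H (?\<phi> v))"
      then obtain t u where tu: "p = (t, c v)" "q = (u, c v)" "t \<in> verts T" "u \<in> verts T" "v \<in> \<chi> t" "v \<in> \<chi> u"
        by auto
      have "(p, (u, c v)) \<in> (adj (induced ?H (?\<phi> v)))\<^sup>*"
      proof (rule connected_induced_const[OF con, of t u])
        fix a b assume ab: "{a, b} \<in> edges T" "a \<in> {t \<in> verts T. v \<in> \<chi> t}" "b \<in> {t \<in> verts T. v \<in> \<chi> t}"
          "(p, (a, c v)) \<in> (adj (induced ?H (?\<phi> v)))\<^sup>*"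
        have "((a, c v), (b, c v)) \<in> adj (induced ?H (?\<phi> v))"
          using ab cv by (simp add: box_clique_edge)
        with ab(4) show "(p, (b, c v)) \<in> (adj (induced ?H (?\<phi> v)))\<^sup>*" by (rule rtrancl_into_rtrancl)
      qed (use tu in auto)
      then show "(p, q) \<in> (adj (induced ?H (?\<phi> v)))\<^sup>*" using tu by simp
    qed
  qed
  moreover have "?\<phi> u \<inter> ?\<phi> v = {}" if "u \<noteq> v" for u v
  proof (rule ccontr)
    assume "?\<phi> u \<inter> ?\<phi> v \<noteq> {}"
    then obtain t where "t \<in> verts T" "u \<in> \<chi> t" "v \<in> \<chi> t" "c u = c v" by auto
    then show False using T(3) that by (meson inj_onD)
  qed
  moreover have "\<exists>a\<in>?\<phi> u. \<exists>b\<in>?\<phi> v. {a, b} \<in> edges ?H" if e: "{u, v} \<in> edges G" for u v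
  proof -
    have uv: "u \<noteq> v" "u \<in> verts G" "v \<in> verts G" using edge_neq[OF G e] edge_verts[OF G e] by auto
    have cuv: "c u \<in> {1..k}" "c v \<in> {1..k}" using subsetD[OF T(4) imageI] uv by auto
    have same: ?thesis if t: "t \<in> verts T" "u \<in> \<chi> t" "v \<in> \<chi> t" for t
    proof -
      have "c u \<noteq> c v" using T(3) t uv(1) by (meson inj_onD)
      then have "{(t, c u), (t, c v)} \<in> edges ?H" using t cuv by (simp add: box_clique_edge)
      then show ?thesis using t by blast
    qed
    obtain t1 t2 where t: "{t1, t2} \<in> edges T" "{u, v} \<subseteq> \<chi> t1 \<union> \<chi> t2" using T(7)[OF e] by blast
    have tv: "t1 \<in> verts T" "t2 \<in> verts T" using edge_verts[OF s t(1)] by auto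
    have cross: ?thesis if ab: "{a, b} \<in> edges T" "a \<in> verts T" "b \<in> verts T"
      "u \<in> \<chi> a" "v \<in> \<chi> b" "v \<notin> \<chi> a" "u \<notin> \<chi> b" for a b
    proof -
      obtain D x y where "\<chi> a = insert x D" "\<chi> b = insert y D" "c x = c y"
        using T(6)[OF ab(1)] ab unfolding linked_def by blast
      then have "c u = c v" using ab by auto
      then have "{(a, c u), (b, c v)} \<in> edges ?H" using ab cuv by (simp add: box_clique_edge)
      then show ?thesis using ab by blast
    qed
    show ?thesis
    proof (cases "(u \<in> \<chi> t1 \<and> v \<in> \<chi> t1) \<or> (u \<in> \<chi> t2 \<and> v \<in> \<chi> t2)")
      case True then show ?thesis using same tv by blast
    next
      case False
      then have "u \<in> \<chi> t1 \<and> v \<in> \<chi> t2 \<and> v \<notin> \<chi> t1 \<and> u \<notin> \<chi> t2 \<or> u \<in> \<chi> t2 \<and> v \<in> \<chi> t1 \<and> v \<notin> \<chi> t2 \<and> u \<notin> \<chi> t1"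
        using t(2) by auto
      moreover have "{t2, t1} \<in> edges T" using t(1) by (simp add: insert_commute)
      ultimately show ?thesis using cross[of t1 t2] cross[of t2 t1] t(1) tv by blast
    qed
  qed
  ultimately have "is_minor G ?H" unfolding is_minor_def by (intro exI[of _ ?\<phi>]) blast
  then show ?thesis unfolding minor_of_tree_product_def using T(1) by blast
qed

section \<open>A tight bramble is a refuge for the fugitive\<close>

text \<open>The predicate \<open>ok\<close> serves to bar the edge along which a searcher slides,
  and \<open>R\<close> stands for the vertices occupied both before and after the move.\<close>

definition free_steps :: "'a ugraph \<Rightarrow> 'a set \<Rightarrow> ('a set \<Rightarrow> bool) \<Rightarrow> ('a set \<times> 'a set) set" where
  "free_steps G R ok = {(a, b). a \<in> edges G \<and> b \<in> edges G \<and> a \<noteq> b \<and> ok a \<and> ok b \<and>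
     a \<inter> b \<noteq> {} \<and> a \<inter> b \<inter> R = {}}"

text \<open>Barring the slid edge altogether makes the conditions on its place and direction in
  \<open>avoiding\<close> vacuous, so only the occupied vertices matter.\<close>

lemma free_steps_avoiding:
  assumes r: "(e, e') \<in> (free_steps G (S \<inter> S') ok)\<^sup>*" and ne: "e \<noteq> e'"
    and ok: "\<And>x y. slide G S S' x y \<Longrightarrow> \<not> ok {x, y}"
  shows "\<exists>fs. avoiding G S S' fs \<and> hd fs = e \<and> last fs = e'"
proof -
  obtain fs where fs: "fs \<noteq> []" "hd fs = e" "last fs = e'"
    "\<And>i. Suc i < length fs \<Longrightarrow> (fs ! i, fs ! Suc i) \<in> free_steps G (S \<inter> S') ok"
    using rtrancl_distinct_walk[OF r] by blast
  have len: "length fs \<ge> 2"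
  proof (rule ccontr)
    assume "\<not> length fs \<ge> 2"
    then have "length fs = Suc 0" using fs(1) by (cases "length fs") auto
    then have "hd fs = last fs" by (auto simp: length_Suc_conv)
    then show False using fs ne by simp
  qed
  have el: "fs ! i \<in> edges G \<and> ok (fs ! i)" if "i < length fs" for i
  proof (cases "Suc i < length fs")
    case True
    then show ?thesis using fs(4)[of i] by (simp add: free_steps_def)
  next
    case False
    then have "Suc (i - 1) = i" using that len by simp
    then show ?thesis using fs(4)[of "i - 1"] that by (simp add: free_steps_def)
  qed
  have "pathway G fs" unfolding pathway_def
    using fs(1,4) el by (auto simp: free_steps_def in_set_conv_nth)
  moreover have "fs ! j \<inter> fs ! Suc j \<inter> (S \<inter> S') = {}" if "Suc j < length fs" for j
    using fs(4)[OF that] by (simp add: free_steps_def)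
  moreover have el': "fs ! j \<noteq> {x, y}" if "slide G S S' x y" "j < length fs" for x y j
    using el[OF that(2)] ok[OF that(1)] by auto
  moreover have "hd fs \<noteq> {x, y}" "last fs \<noteq> {x, y}" if "slide G S S' x y" for x y
    using el'[OF that, of 0] el'[OF that, of "length fs - 1"] fs(1)
    by (auto simp: hd_conv_nth last_conv_nth)
  ultimately have "avoiding G S S' fs" unfolding avoiding_def using len by blast
  then show ?thesis using fs by blast
qed

text \<open>The first and the last edge need only one end in \<open>B\<close>. Thus an edge leaving
  \<open>B\<close> can serve as the hinge to another element of the bramble.\<close>

lemma free_steps_within:
  assumes G: "simple_graph G" and con: "connected_graph (induced G B)" and B: "B \<subseteq> verts G" "B \<inter> R = {}"
    and ok: "\<And>f. f \<in> edges G \<Longrightarrow> f \<subseteq> B \<Longrightarrow> ok f"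
    and e: "e \<in> edges G" "ok e" "u \<in> e" "u \<in> B"
    and f: "f \<in> edges G" "ok f" "v \<in> f" "v \<in> B"
  shows "(e, f) \<in> (free_steps G R ok)\<^sup>*"
proof -
  have inter: "a \<inter> b = {w}" if ab: "a \<in> edges G" "b \<in> edges G" "a \<noteq> b" "w \<in> a" "w \<in> b" for a b w
  proof -
    have "card a = 2" "card b = 2" using G ab by (auto simp: simple_graph_def)
    then obtain p q where "a = {w, p}" "b = {w, q}" using ab(4,5) by (auto simp: card_2_iff)
    then show ?thesis using ab(3) by auto
  qed
  have step: "(a, b) \<in> (free_steps G R ok)\<^sup>*"
    if ab: "a \<in> edges G" "b \<in> edges G" "ok a" "ok b" "w \<in> a" "w \<in> b" "w \<in> B" for a b w
  proof (cases "a = b")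
    case False
    then have "a \<inter> b = {w}" using inter ab by blast
    then have "(a, b) \<in> free_steps G R ok" using ab False B(2) by (auto simp: free_steps_def)
    then show ?thesis by (rule r_into_rtrancl)
  qed simp
  have "\<forall>g. g \<in> edges G \<and> ok g \<and> v \<in> g \<longrightarrow> (e, g) \<in> (free_steps G R ok)\<^sup>*"
  proof (rule connected_induced_const[OF con, of u v])
    show "\<forall>g. g \<in> edges G \<and> ok g \<and> u \<in> g \<longrightarrow> (e, g) \<in> (free_steps G R ok)\<^sup>*"
      using step[of e _ u] e by blast
    fix a b assume ab: "{a, b} \<in> edges G" "a \<in> B" "b \<in> B"
      and IH: "\<forall>g. g \<in> edges G \<and> ok g \<and> a \<in> g \<longrightarrow> (e, g) \<in> (free_steps G R ok)\<^sup>*"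
    have oab: "ok {a, b}" using ok ab by simp
    then have r: "(e, {a, b}) \<in> (free_steps G R ok)\<^sup>*" using IH ab by blast
    show "\<forall>g. g \<in> edges G \<and> ok g \<and> b \<in> g \<longrightarrow> (e, g) \<in> (free_steps G R ok)\<^sup>*"
    proof (intro allI impI)
      fix g assume "g \<in> edges G \<and> ok g \<and> b \<in> g"
      then have "({a, b}, g) \<in> (free_steps G R ok)\<^sup>*" using step[of "{a, b}" g b] ab oab by blast
      with r show "(e, g) \<in> (free_steps G R ok)\<^sup>*" by (rule rtrancl_trans)
    qed
  qed (use e f B in auto)
  then show ?thesis using f by blast
qed

lemma connected_neighbour:
  assumes con: "connected_graph (induced G B)" and B: "B \<subseteq> verts G" "card B \<ge> 2" and u: "u \<in> B"
  shows "\<exists>w. {u, w} \<in> edges G \<and> {u, w} \<subseteq> B"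
proof -
  have "B \<noteq> {u}" using B(2) by auto
  then obtain v where v: "v \<in> B" "v \<noteq> u" using u by blast
  then have "(u, v) \<in> (adj (induced G B))\<^sup>*" using con B(1) u by (auto simp: connected_graph_def)
  then obtain w where "(u, w) \<in> adj (induced G B)" using v(2) by (metis converse_rtranclE)
  then have "{u, w} \<in> edges G \<and> {u, w} \<subseteq> B" by simp
  then show ?thesis by blast
qed

text \<open>The fugitive lives on edges, and this is what the lower bound two on the size of bramble
  elements provides.\<close>

lemma connected_has_edge:
  assumes "connected_graph (induced G B)" "B \<subseteq> verts G" "card B \<ge> 2"
  shows "\<exists>e\<in>edges G. e \<subseteq> B"
proof -
  have "B \<noteq> {}" using assms(3) by auto
  then show ?thesis using connected_neighbour[OF assms] by blast
qed

text \<open>Both elements avoid the vertices that stay occupied during the move. If they meet, the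
  fugitive passes through a common vertex; if not, two distinct edges join them and a slide blocks
  only one of these.\<close>

lemma bramble_escape:
  assumes G: "simple_graph G" and Br: "tight_bramble G \<B>" and leg: "legitimate G S S'"
    and B: "B \<in> \<B>" "B \<inter> S = {}" and B': "B' \<in> \<B>" "B' \<inter> S' = {}"
    and e: "e \<in> edges G" "e \<subseteq> B"
  shows "\<exists>e'\<in>fsp G S e S'. e' \<subseteq> B'"
proof -
  have p: "B \<subseteq> verts G" "connected_graph (induced G B)" "B' \<subseteq> verts G" "connected_graph (induced G B')" "card B' \<ge> 2"
    and tch: "touching G B B'"
    using Br B(1) B'(1) unfolding tight_bramble_def by blast+
  obtain e' where e': "e' \<in> edges G" "e' \<subseteq> B'" using connected_has_edge[OF p(4,3,5)] by blast
  define ok where "ok f \<longleftrightarrow> \<not> (\<exists>x y. slide G S S' x y \<and> f = {x, y})" for f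
  have dis: "B \<inter> (S \<inter> S') = {}" "B' \<inter> (S \<inter> S') = {}" using B B' by auto
  \<comment> \<open>The slid edge starts in \<open>S\<close> and ends in \<open>S'\<close>, hence
    lies neither within \<open>B\<close> nor within \<open>B'\<close>.\<close>
  have okB: "ok f" if "f \<subseteq> B" for f using that B(2) by (auto simp: ok_def slide_def)
  have okB': "ok f" if "f \<subseteq> B'" for f using that B'(2) by (auto simp: ok_def slide_def)
  have edge_ne: "\<exists>u. u \<in> f" if "f \<in> edges G" for f
    using that G by (auto simp: simple_graph_def card_2_iff)
  have r: "(e, e') \<in> (free_steps G (S \<inter> S') ok)\<^sup>*"
  proof (cases "B \<inter> B' = {}")
    case False
    then obtain w where w: "w \<in> B" "w \<in> B'" by blast
    obtain z where g: "{w, z} \<in> edges G" "{w, z} \<subseteq> B'"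
      using connected_neighbour[OF p(4,3,5) w(2)] by blast
    obtain u u' where u: "u \<in> e" "u' \<in> e'" using edge_ne e(1) e'(1) by blast
    have "(e, {w, z}) \<in> (free_steps G (S \<inter> S') ok)\<^sup>*"
      by (rule free_steps_within[OF G p(2,1) dis(1), of ok e u "{w, z}" w]) (use okB okB' e g u w in auto)
    moreover have "({w, z}, e') \<in> (free_steps G (S \<inter> S') ok)\<^sup>*"
      by (rule free_steps_within[OF G p(4,3) dis(2), of ok "{w, z}" w e' u']) (use okB' e' g u w in auto)
    ultimately show ?thesis by (rule rtrancl_trans)
  next
    case True
    then have "\<exists>x1 x2 y1 y2. {x1, x2} \<in> edges G \<and> {y1, y2} \<in> edges G \<and> {x1, x2} \<noteq> {y1, y2} \<and>
        x1 \<in> B \<and> y1 \<in> B \<and> x2 \<in> B' \<and> y2 \<in> B'" using tch unfolding touching_def by simp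
    then obtain x1 x2 y1 y2 where xy: "{x1, x2} \<in> edges G" "{y1, y2} \<in> edges G" "{x1, x2} \<noteq> {y1, y2}"
      "x1 \<in> B" "y1 \<in> B" "x2 \<in> B'" "y2 \<in> B'" by (elim exE conjE)
    have one: "f = {x, y}" if f: "\<not> ok f" "slide G S S' x y" for f x y
    proof -
      obtain x' y' where s': "slide G S S' x' y'" "f = {x', y'}" using f(1) by (auto simp: ok_def)
      have d: "S - S' = {a} \<and> S' - S = {b}" if "slide G S S' a b" for a b
        using that by (auto simp: slide_def)
      have "x' = x" "y' = y" using d[OF f(2)] d[OF s'(1)] by auto
      then show ?thesis using s' by simp
    qed
    have "ok {x1, x2} \<or> ok {y1, y2}"
    proof (rule ccontr)
      assume n: "\<not> (ok {x1, x2} \<or> ok {y1, y2})"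
      then obtain x y where "slide G S S' x y" by (auto simp: ok_def)
      then have "{x1, x2} = {x, y}" "{y1, y2} = {x, y}" using one n by blast+
      then show False using xy(3) by simp
    qed
    then obtain a b where ab: "{a, b} \<in> edges G" "a \<in> B" "b \<in> B'" "ok {a, b}" using xy by blast
    obtain u u' where u: "u \<in> e" "u' \<in> e'" using edge_ne e(1) e'(1) by blast
    have "(e, {a, b}) \<in> (free_steps G (S \<inter> S') ok)\<^sup>*"
      by (rule free_steps_within[OF G p(2,1) dis(1), of ok e u "{a, b}" a]) (use okB e ab u in auto)
    moreover have "({a, b}, e') \<in> (free_steps G (S \<inter> S') ok)\<^sup>*"
      by (rule free_steps_within[OF G p(4,3) dis(2), of ok "{a, b}" b e' u']) (use okB' e' ab u in auto)
    ultimately show ?thesis by (rule rtrancl_trans)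
  qed
  have "e' \<in> fsp G S e S'"
  proof (cases "e = e'")
    case True
    \<comment> \<open>Staying put is not an avoiding pathway, which has at least two edges; instead
      the edge must escape being cleared, and it does because the new vertex is not in
      \<open>B'\<close>.\<close>
    have "e \<notin> clear G S S'"
    proof
      assume "e \<in> clear G S S'"
      then obtain x y where "e = {x, y}" "S' - S = {y}" by (auto simp: clear_def)
      then show False using True e' B'(2) by blast
    qed
    then show ?thesis using True by (simp add: fsp_def)
  next
    case False
    obtain fs where "avoiding G S S' fs" "hd fs = e" "last fs = e'"
      using free_steps_avoiding[OF r False] by (auto simp: ok_def)
    moreover have "\<not> e' \<subseteq> S'" using e' edge_ne[OF e'(1)] B'(2) by blast
    ultimately show ?thesis using e' by (auto simp: fsp_def accessible_def)
  qed
  then show ?thesis using e' by blast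
qed

section \<open>Brambles bound the search number\<close>

lemma Inf_enat_leD:
  assumes "Inf X \<le> enat k"
  shows "\<exists>x\<in>X. x \<le> enat k"
proof -
  have "X \<noteq> {}" using assms by (auto simp: Inf_enat_def)
  then have "Inf X \<in> X" by (auto simp: Inf_enat_def intro: LeastI)
  then show ?thesis using assms by blast
qed

text \<open>For each position of at most \<open>k\<close> searchers an element missed by it is fixed
  in advance; the fugitive always answers with an edge inside the element chosen for the new
  position, so capture never occurs.\<close>

lemma avms_imp_bramble:
  assumes G: "simple_graph G" and avms: "avms G \<le> enat k" and Br: "tight_bramble G \<B>"
  shows "bramble_order G \<B> \<le> k"
proof (rule ccontr)
  assume big: "\<not> bramble_order G \<B> \<le> k"
  from Inf_enat_leD[OF avms[unfolded avms_def]] obtain s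
    where s: "search_strategy G s" "winning G s" "strategy_cost G s \<le> enat k" by auto
  have legs: "\<And>S e. S \<subseteq> verts G \<Longrightarrow> e \<in> edges G \<Longrightarrow> legitimate G S (s S e)"
    using s(1) by (auto simp: search_strategy_def)
  have "\<forall>S. \<exists>B. S \<subseteq> verts G \<and> card S \<le> k \<longrightarrow> B \<in> \<B> \<and> B \<inter> S = {}"
    using bramble_uncovered[OF G Br big] by blast
  then obtain \<beta> where \<beta>: "\<And>S. S \<subseteq> verts G \<Longrightarrow> card S \<le> k \<Longrightarrow> \<beta> S \<in> \<B> \<and> \<beta> S \<inter> S = {}"
    by metis
  define f where "f S e S' = (if fsp G S e S' = {} then None
    else if \<exists>e'\<in>fsp G S e S'. e' \<subseteq> \<beta> S' then Some (SOME e'. e' \<in> fsp G S e S' \<and> e' \<subseteq> \<beta> S')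
    else Some (SOME e'. e' \<in> fsp G S e S'))" for S e S'
  have f_good: "\<exists>e'. f S e S' = Some e' \<and> e' \<in> fsp G S e S' \<and> e' \<subseteq> \<beta> S'"
    if "\<exists>e'\<in>fsp G S e S'. e' \<subseteq> \<beta> S'" for S e S'
    using that someI_ex[of "\<lambda>e'. e' \<in> fsp G S e S' \<and> e' \<subseteq> \<beta> S'"] unfolding f_def by auto
  have f_any: "\<exists>e'\<in>fsp G S e S'. f S e S' = Some e'" if "fsp G S e S' \<noteq> {}" for S e S'
  proof (cases "\<exists>e'\<in>fsp G S e S'. e' \<subseteq> \<beta> S'")
    case True then show ?thesis using f_good by blast
  next
    case False
    then show ?thesis using that some_in_eq[of "fsp G S e S'"] by (simp add: f_def)
  qed
  have b0: "\<beta> {} \<in> \<B>" using \<beta>[of "{}"] by simp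
  then have "\<beta> {} \<subseteq> verts G" "connected_graph (induced G (\<beta> {}))" "card (\<beta> {}) \<ge> 2"
    using Br unfolding tight_bramble_def by blast+
  from connected_has_edge[OF this(2,1,3)] obtain e1 where e1: "e1 \<in> edges G" "e1 \<subseteq> \<beta> {}" by blast
  have fs: "fugitive_strategy G e1 f"
    unfolding fugitive_strategy_def using e1(1) f_any by (simp add: f_def)
  let ?p = "play s e1 f"
  have cost: "card (fst (?p i)) \<le> k" for i
  proof -
    have "enat (card (fst (?p i))) \<le> strategy_cost G s"
      unfolding strategy_cost_def by (rule Sup_upper) (use fs in blast)
    also have "\<dots> \<le> enat k" by (rule s(3))
    finally show ?thesis by simp
  qed
  have "\<exists>e. snd (?p i) = Some e \<and> e \<in> edges G \<and> e \<subseteq> \<beta> (fst (?p i)) \<and> fst (?p i) \<subseteq> verts G" for i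
  proof (induction i)
    case 0
    then show ?case using e1 by simp
  next
    case (Suc i)
    then obtain S e where p: "?p i = (S, Some e)" "e \<in> edges G" "e \<subseteq> \<beta> S" "S \<subseteq> verts G"
      by (cases "?p i") auto
    let ?S' = "s S e"
    have nxt: "?p (Suc i) = (?S', f S e ?S')" using p by simp
    have leg: "legitimate G S ?S'" using legs p by blast
    then have S': "?S' \<subseteq> verts G" by (simp add: legitimate_def)
    have "card S \<le> k" "card ?S' \<le> k" using cost[of i] cost[of "Suc i"] p nxt by auto
    then have bb: "\<beta> S \<in> \<B>" "\<beta> S \<inter> S = {}" "\<beta> ?S' \<in> \<B>" "\<beta> ?S' \<inter> ?S' = {}" using \<beta> p(4) S' by auto
    obtain e' where "f S e ?S' = Some e'" "e' \<in> fsp G S e ?S'" "e' \<subseteq> \<beta> ?S'"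
      using f_good[OF bramble_escape[OF G Br leg bb p(2,3)]] by blast
    then show ?case using nxt S' fsp_edges[OF p(2)] by auto
  qed
  then have "\<forall>i. snd (?p i) \<noteq> None" by (metis option.distinct(1))
  then show False using s(2) fs unfolding winning_def by blast
qed

lemma avms_le_mavms: "avms G \<le> mavms G"
  unfolding avms_def mavms_def by (rule Inf_superset_mono) auto

section \<open>Duality\<close>

definition interface :: "'a set set set \<Rightarrow> 'a set" where
  "interface \<Q> = {v. \<exists>P\<in>\<Q>. \<exists>Q\<in>\<Q>. P \<noteq> Q \<and> v \<in> \<Union>P \<and> v \<in> \<Union>Q}"

definition partition_of :: "'a ugraph \<Rightarrow> 'a set set set \<Rightarrow> bool" where
  "partition_of G \<Q> \<longleftrightarrow> \<Union>\<Q> = edges G \<and> (\<forall>P\<in>\<Q>. \<forall>Q\<in>\<Q>. P \<noteq> Q \<longrightarrow> P \<inter> Q = {})"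

text \<open>The second kind of division is the edge of the tree whose two bags exchange the ends of \<open>e\<close>;
  its interface may have \<open>k + 1\<close> vertices.\<close>

definition division :: "'a ugraph \<Rightarrow> nat \<Rightarrow> 'a set set set \<Rightarrow> bool" where
  "division G k \<Q> \<longleftrightarrow> partition_of G \<Q> \<and>
     (card (interface \<Q>) \<le> k \<or>
      (\<exists>e P1 P2. \<Q> = {{e}, P1, P2} \<and> e \<notin> P1 \<and> e \<notin> P2 \<and> P1 \<inter> P2 = {} \<and>
         card (boundary G P1) \<le> k \<and> card (boundary G P2) \<le> k))"

text \<open>\<open>displayed G k \<L>\<close>: some tree glued from divisions has exactly the leaves \<open>\<L>\<close>, apart from
  leaves with fewer than two edges.\<close>

inductive displayed :: "'a ugraph \<Rightarrow> nat \<Rightarrow> 'a set set set \<Rightarrow> bool" for G k where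
  node: "division G k \<Q> \<Longrightarrow> displayed G k {Q \<in> \<Q>. 2 \<le> card Q}"
| glue: "displayed G k \<A> \<Longrightarrow> Y \<in> \<A> \<Longrightarrow> displayed G k \<B> \<Longrightarrow> edges G - Y \<in> \<B> \<Longrightarrow>
    displayed G k ((\<A> - {Y}) \<union> (\<B> - {edges G - Y}))"

section \<open>Boundaries, interfaces and submodularity\<close>

lemma finite_edges: "simple_graph G \<Longrightarrow> finite (edges G)"
  by (rule finite_subset[of _ "Pow (verts G)"]) (auto simp: simple_graph_def)

lemma boundary_subset: "simple_graph G \<Longrightarrow> boundary G C \<subseteq> verts G"
  by (auto simp: boundary_def simple_graph_def)

lemma finite_boundary: "simple_graph G \<Longrightarrow> finite (boundary G C)"
  by (rule finite_vertices[OF _ boundary_subset])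

lemma boundary_compl: "X \<subseteq> edges G \<Longrightarrow> boundary G (edges G - X) = boundary G X"
  by (auto simp: boundary_def)

lemma interface_subset:
  assumes "simple_graph G" "partition_of G \<Q>"
  shows "interface \<Q> \<subseteq> verts G"
proof
  fix v assume "v \<in> interface \<Q>"
  then obtain P e where "P \<in> \<Q>" "e \<in> P" "v \<in> e" by (auto simp: interface_def)
  moreover have "\<Union>\<Q> = edges G" using assms(2) by (simp add: partition_of_def)
  ultimately show "v \<in> verts G" using assms(1) by (auto simp: simple_graph_def)
qed

lemma part_boundary:
  assumes "partition_of G \<Q>" "P \<in> \<Q>"
  shows "boundary G P = interface \<Q> \<inter> \<Union>P"
proof
  show "boundary G P \<subseteq> interface \<Q> \<inter> \<Union>P"
  proof
    fix v assume "v \<in> boundary G P"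
    then obtain e f where ef: "e \<in> P" "f \<in> edges G - P" "v \<in> e" "v \<in> f" by (auto simp: boundary_def)
    then have "f \<in> \<Union>\<Q>" using assms(1) by (simp add: partition_of_def)
    then obtain Q where "Q \<in> \<Q>" "f \<in> Q" by blast
    moreover have "Q \<noteq> P" using ef calculation by auto
    ultimately show "v \<in> interface \<Q> \<inter> \<Union>P" using ef assms(2) by (auto simp: interface_def)
  qed
  show "interface \<Q> \<inter> \<Union>P \<subseteq> boundary G P"
  proof
    fix v assume v: "v \<in> interface \<Q> \<inter> \<Union>P"
    then obtain Q f where Q: "Q \<in> \<Q>" "Q \<noteq> P" "f \<in> Q" "v \<in> f" by (auto simp: interface_def)
    then have "f \<in> edges G - P" using assms by (auto simp: partition_of_def)
    then show "v \<in> boundary G P" using v Q by (auto simp: boundary_def)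
  qed
qed

lemma interface_insert_empty [simp]: "interface (insert {} \<Q>) = interface \<Q>"
  by (auto simp: interface_def)

lemma partition_of_insert_empty [simp]: "partition_of G \<Q> \<Longrightarrow> partition_of G (insert {} \<Q>)"
  by (auto simp: partition_of_def)

lemma partition_of_compl: "X \<subseteq> edges G \<Longrightarrow> partition_of G {X, edges G - X}"
  by (auto simp: partition_of_def)

lemma interface_compl: "X \<subseteq> edges G \<Longrightarrow> interface {X, edges G - X} = boundary G X"
  by (auto simp: interface_def boundary_def)

text \<open>Submodular inequalities reduce to two inclusions: each element is counted on the left at
  most as often as on the right.\<close>

lemma card_add_le:
  assumes "finite C" "finite D" "A \<union> B \<subseteq> C \<union> D" "A \<inter> B \<subseteq> C \<inter> D"
  shows "card A + card B \<le> card C + card D"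
proof -
  have "finite (A \<union> B)" by (rule finite_subset[OF assms(3)]) (use assms in simp)
  then have f: "finite A" "finite B" by auto
  have "card A + card B = card (A \<union> B) + card (A \<inter> B)" using card_Un_Int f by blast
  also have "\<dots> \<le> card (C \<union> D) + card (C \<inter> D)" using assms by (intro add_mono card_mono) auto
  also have "\<dots> = card C + card D" using card_Un_Int assms by metis
  finally show ?thesis .
qed

lemma boundary_submodular:
  assumes "simple_graph G" "A \<subseteq> edges G" "B \<subseteq> edges G"
  shows "card (boundary G (A \<union> B)) + card (boundary G (A \<inter> B)) \<le> card (boundary G A) + card (boundary G B)"
  by (rule card_add_le) (use finite_boundary[OF assms(1)] assms(2,3) in \<open>auto simp: boundary_def\<close>)

text \<open>All of \<open>F\<close> is moved into the part \<open>Z\<close>. Other parts may become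
  empty, which is harmless since \<open>displayed\<close> keeps only parts with at least two
  edges.\<close>

definition absorb :: "'b set \<Rightarrow> 'b set \<Rightarrow> 'b set set \<Rightarrow> 'b set set" where
  "absorb F Z \<Q> = insert (Z \<union> F) ((\<lambda>l. l - F) ` (\<Q> - {Z}))"

lemma absorb_iff: "Q \<in> absorb F Z \<Q> \<longleftrightarrow> Q = Z \<union> F \<or> (\<exists>l\<in>\<Q>. l \<noteq> Z \<and> Q = l - F)"
  by (auto simp: absorb_def)

lemma partition_of_absorb:
  assumes "partition_of G \<Q>" "Z \<in> \<Q>" "F \<subseteq> edges G"
  shows "partition_of G (absorb F Z \<Q>)"
proof -
  have U: "\<Union>\<Q> = edges G" and d: "\<And>P Q. P \<in> \<Q> \<Longrightarrow> Q \<in> \<Q> \<Longrightarrow> P \<noteq> Q \<Longrightarrow> P \<inter> Q = {}"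
    using assms(1) by (auto simp: partition_of_def)
  have "\<Union>(absorb F Z \<Q>) = edges G"
  proof (intro subset_antisym subsetI)
    fix e assume "e \<in> \<Union>(absorb F Z \<Q>)"
    then obtain Q where "Q \<in> absorb F Z \<Q>" "e \<in> Q" by blast
    moreover have "l \<subseteq> edges G" if "l \<in> \<Q>" for l using U that by blast
    ultimately show "e \<in> edges G" using assms(2,3) unfolding absorb_iff by blast
  next
    fix e assume "e \<in> edges G"
    then obtain P where "P \<in> \<Q>" "e \<in> P" using U by blast
    then have "e \<in> Z \<union> F \<or> P \<noteq> Z \<and> e \<in> P - F" by blast
    then show "e \<in> \<Union>(absorb F Z \<Q>)"
    proof
      assume "e \<in> Z \<union> F" then show ?thesis by (intro UnionI[of "Z \<union> F"]) (simp_all add: absorb_def)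
    next
      assume "P \<noteq> Z \<and> e \<in> P - F"
      then show ?thesis using \<open>P \<in> \<Q>\<close> by (intro UnionI[of "P - F"]) (auto simp: absorb_def)
    qed
  qed
  moreover have "P \<inter> Q = {}" if PQ: "P \<in> absorb F Z \<Q>" "Q \<in> absorb F Z \<Q>" "P \<noteq> Q" for P Q
  proof -
    have Zl: "(Z \<union> F) \<inter> (l - F) = {}" if "l \<in> \<Q>" "l \<noteq> Z" for l using d[OF assms(2) that(1)] that(2) by auto
    have ll: "(l - F) \<inter> (l' - F) = {}" if "l \<in> \<Q>" "l' \<in> \<Q>" "l - F \<noteq> l' - F" for l l'
      using d[OF that(1,2)] that(3) by auto
    from PQ(1,2) show ?thesis
      unfolding absorb_iff using PQ(3) Zl ll by (elim disjE bexE conjE) (auto simp: Int_commute)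
  qed
  ultimately show ?thesis by (simp add: partition_of_def)
qed

text \<open>The analogue of submodularity for partitions. A vertex new to the interface lies in the
  boundary of \<open>F\<close> but meets no edge of \<open>Z\<close>, so it is not in the boundary
  of \<open>Z \<inter> F\<close>. A vertex in the latter but not in the boundary of \<open>F\<close>
  has all its edges in \<open>F\<close> and so leaves the interface.\<close>

lemma interface_absorb:
  assumes G: "simple_graph G" and p: "partition_of G \<Q>" and Z: "Z \<in> \<Q>" and F: "F \<subseteq> edges G"
  shows "card (interface (absorb F Z \<Q>)) + card (boundary G (Z \<inter> F))
    \<le> card (interface \<Q>) + card (boundary G F)"
proof (rule card_add_le)
  note p' = partition_of_absorb[OF p Z F]
  have U: "\<Union>\<Q> = edges G" and d: "\<And>P Q. P \<in> \<Q> \<Longrightarrow> Q \<in> \<Q> \<Longrightarrow> P \<noteq> Q \<Longrightarrow> P \<inter> Q = {}"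
    using p by (auto simp: partition_of_def)
  have fv: "finite (verts G)" using G by (simp add: simple_graph_def)
  show "finite (interface \<Q>)" using interface_subset[OF G p] fv by (rule finite_subset)
  show "finite (boundary G F)" using finite_boundary[OF G] .
  have one: "v \<in> interface \<Q> \<or> v \<in> boundary G F - boundary G (Z \<inter> F)"
    if v: "v \<in> interface (absorb F Z \<Q>)" for v
  proof (rule ccontr)
    assume n: "\<not> ?thesis"
    then have same: "P = Q" if "P \<in> \<Q>" "Q \<in> \<Q>" "v \<in> \<Union>P" "v \<in> \<Union>Q" for P Q
      using that by (auto simp: interface_def)
    obtain P Q where PQ: "P \<in> absorb F Z \<Q>" "Q \<in> absorb F Z \<Q>" "P \<noteq> Q" "v \<in> \<Union>P" "v \<in> \<Union>Q"
      using v by (auto simp: interface_def)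
    have ll: "l - F = l' - F" if "l \<in> \<Q>" "l' \<in> \<Q>" "v \<in> \<Union>(l - F)" "v \<in> \<Union>(l' - F)" for l l'
      using same[of l l'] that by auto
    have "\<exists>l\<in>\<Q>. l \<noteq> Z \<and> v \<in> \<Union>(l - F) \<and> v \<in> \<Union>(Z \<union> F)"
      using PQ(1,2) unfolding absorb_iff
    proof (elim disjE bexE conjE)
      fix l l' assume "l \<in> \<Q>" "l' \<in> \<Q>" "P = l - F" "Q = l' - F"
      then show ?thesis using ll[of l l'] PQ(3-5) by simp
    qed (use PQ(3-5) in auto)
    then obtain l e f where l: "l \<in> \<Q> - {Z}" "e \<in> l - F" "v \<in> e" and f: "f \<in> Z \<union> F" "v \<in> f"
      by (auto 4 3)
    have nZ: "g \<notin> Z" if "v \<in> g" for g using same[of l Z] l Z that by blast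
    then have "f \<in> F" using f by blast
    then have "v \<in> boundary G F" using l U f by (auto simp: boundary_def)
    moreover have "v \<notin> boundary G (Z \<inter> F)" using nZ by (auto simp: boundary_def)
    ultimately show False using n by blast
  qed
  have two: "v \<in> boundary G F \<or> v \<in> interface \<Q> - interface (absorb F Z \<Q>)"
    if v: "v \<in> boundary G (Z \<inter> F)" for v
  proof (rule ccontr)
    assume n: "\<not> ?thesis"
    obtain e f where ef: "e \<in> Z \<inter> F" "v \<in> e" "f \<in> edges G - Z \<inter> F" "v \<in> f" using v by (auto simp: boundary_def)
    have allF: "g \<in> F" if "g \<in> edges G" "v \<in> g" for g using n that ef by (auto simp: boundary_def)
    then have "f \<notin> Z" using ef by blast
    moreover obtain Q where Q: "Q \<in> \<Q>" "f \<in> Q" using U ef by blast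
    ultimately have "v \<in> interface \<Q>" using Z ef by (auto simp: interface_def)
    then have "v \<in> interface (absorb F Z \<Q>)" using n by blast
    then obtain P Q where "P \<in> absorb F Z \<Q>" "Q \<in> absorb F Z \<Q>" "P \<noteq> Q" "v \<in> \<Union>P" "v \<in> \<Union>Q"
      by (auto simp: interface_def)
    then obtain l where "l \<in> \<Q>" "v \<in> \<Union>(l - F)" unfolding absorb_iff by auto
    then obtain g where "l \<in> \<Q>" "g \<in> l - F" "v \<in> g" by blast
    then show False using allF U by blast
  qed
  show "interface (absorb F Z \<Q>) \<union> boundary G (Z \<inter> F) \<subseteq> interface \<Q> \<union> boundary G F"
    using one two by blast
  show "interface (absorb F Z \<Q>) \<inter> boundary G (Z \<inter> F) \<subseteq> interface \<Q> \<inter> boundary G F"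
    using one two by blast
qed

section \<open>Divisions after absorbing a set of minimum boundary\<close>

lemma divisionE:
  assumes "division G k \<Q>"
  obtains "card (interface \<Q>) \<le> k"
  | e P1 P2 where "\<Q> = {{e}, P1, P2}" "e \<notin> P1" "e \<notin> P2" "P1 \<inter> P2 = {}"
    "card (boundary G P1) \<le> k" "card (boundary G P2) \<le> k"
  using assms unfolding division_def by blast

text \<open>For the first kind \<open>interface_absorb\<close> is combined with minimality at
  \<open>Z \<inter> F\<close>. For the second kind the interface may exceed \<open>k\<close>, so the
  boundaries of the two large parts are treated separately: submodularity and minimality show that
  uniting a superset of \<open>X\<close> with \<open>F\<close> never increases the size of its
  boundary.\<close>

lemma division_absorb:
  assumes G: "simple_graph G" and dv: "division G k \<Q>" and Z: "Z \<in> \<Q>" "2 \<le> card Z" and F: "F \<subseteq> edges G"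
    and X: "X \<subseteq> Z" "X \<subseteq> F"
    and min: "\<And>W. X \<subseteq> W \<Longrightarrow> W \<subseteq> F \<Longrightarrow> card (boundary G F) \<le> card (boundary G W)"
  shows "division G k (absorb F Z \<Q>)"
proof -
  have p: "partition_of G \<Q>" using dv by (simp add: division_def)
  note p' = partition_of_absorb[OF p Z(1) F]
  have bound: "card (boundary G (W \<union> F)) \<le> card (boundary G W)" if "W \<subseteq> edges G" "X \<subseteq> W" for W
    using boundary_submodular[OF G that(1) F] min[of "W \<inter> F"] that(2) X by auto
  from dv show ?thesis
  proof (cases rule: divisionE)
    case 1
    have "card (boundary G F) \<le> card (boundary G (Z \<inter> F))" using min[of "Z \<inter> F"] X by auto
    then have "card (interface (absorb F Z \<Q>)) \<le> k" using interface_absorb[OF G p Z(1) F] 1 by simp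
    then show ?thesis using p' by (simp add: division_def)
  next
    case (2 e P1 P2)
    have "Z \<noteq> {e}" using Z(2) by auto
    then have "\<exists>P. \<Q> = {{e}, Z, P} \<and> e \<notin> Z \<and> e \<notin> P \<and> Z \<inter> P = {} \<and>
        card (boundary G Z) \<le> k \<and> card (boundary G P) \<le> k"
    proof (cases "Z = P1")
      case True
      then show ?thesis using 2 by blast
    next
      case False
      then have "Z = P2" using Z(1) 2(1) \<open>Z \<noteq> {e}\<close> by blast
      then show ?thesis using 2 by (intro exI[of _ P1]) auto
    qed
    then obtain P where P: "\<Q> = {{e}, Z, P}" "e \<notin> Z" "e \<notin> P" "Z \<inter> P = {}"
      "card (boundary G Z) \<le> k" "card (boundary G P) \<le> k" by blast
    have U: "insert e (Z \<union> P) = edges G" using p P(1) by (auto simp: partition_of_def)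
    then have sub: "Z \<subseteq> edges G" "P \<subseteq> edges G" by auto
    have Zne: "Z \<noteq> {}" using Z(2) by auto
    then have "Z \<noteq> P" using P(4) by auto
    then have ab: "absorb F Z \<Q> = {{e} - F, Z \<union> F, P - F}"
      unfolding absorb_def P(1) using \<open>Z \<noteq> {e}\<close> by auto
    have b1: "card (boundary G (Z \<union> F)) \<le> k" using bound[OF sub(1) X(1)] P(5) by simp
    \<comment> \<open>The bound is applied to the complement of \<open>P\<close>, which contains
      \<open>X\<close>; uniting it with \<open>F\<close> gives the complement of
      \<open>P - F\<close>.\<close>
    have "card (boundary G ((edges G - P) \<union> F)) \<le> card (boundary G (edges G - P))"
      by (rule bound) (use X P(4) sub in auto)
    moreover have "(edges G - P) \<union> F = edges G - (P - F)" using F by auto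
    ultimately have b2: "card (boundary G (P - F)) \<le> k"
      using boundary_compl[OF sub(2)] boundary_compl[OF subset_trans[OF Diff_subset sub(2)]] P(6) by simp
    show ?thesis
    proof (cases "e \<in> F")
      case True
      \<comment> \<open>Once \<open>F\<close> swallows \<open>e\<close>, two complementary parts and
        an empty one are left; their interface is a single boundary, so the division becomes one of
        the first kind.\<close>
      then have PF: "P - F = edges G - (Z \<union> F)" using U F P(2-4) by auto
      have "absorb F Z \<Q> = insert {} {Z \<union> F, edges G - (Z \<union> F)}" unfolding ab PF using True by simp
      then have "interface (absorb F Z \<Q>) = boundary G (Z \<union> F)"
        using interface_compl[of "Z \<union> F" G] sub F by simp
      then show ?thesis using p' b1 by (simp add: division_def)
    next
      case False
      then have "absorb F Z \<Q> = {{e}, Z \<union> F, P - F} \<and> e \<notin> Z \<union> F \<and> e \<notin> P - F \<and> (Z \<union> F) \<inter> (P - F) = {}"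
        using ab P by auto
      then show ?thesis using p' b1 b2 unfolding division_def by blast
    qed
  qed
qed

section \<open>Leaves of trees of divisions and their exchange\<close>

lemma displayed_invariant:
  assumes G: "simple_graph G" and d: "displayed G k \<L>"
  shows "(\<forall>L\<in>\<L>. L \<subseteq> edges G \<and> 2 \<le> card L \<and> card (boundary G L) \<le> k) \<and>
    (\<forall>L\<in>\<L>. \<forall>M\<in>\<L>. L \<noteq> M \<longrightarrow> L \<inter> M = {})"
  using d
proof (induction rule: displayed.induct)
  case (node \<Q>)
  have p: "partition_of G \<Q>" using node by (simp add: division_def)
  have "card (boundary G L) \<le> k" if L: "L \<in> \<Q>" "2 \<le> card L" for L
  proof -
    from node show ?thesis
    proof (cases rule: divisionE)
      case 1
      have "finite (interface \<Q>)"
        by (rule finite_vertices[OF G interface_subset[OF G p]])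
      then have "card (boundary G L) \<le> card (interface \<Q>)"
        using part_boundary[OF p L(1)] by (intro card_mono) auto
      then show ?thesis using 1 by simp
    next
      case (2 e P1 P2)
      then show ?thesis using L by auto
    qed
  qed
  then show ?case using p unfolding partition_of_def by blast
next
  case (glue \<A> Y \<B>)
  let ?E = "edges G"
  note A = conjunct1[OF glue.IH(1), rule_format] and dA = conjunct2[OF glue.IH(1), rule_format]
    and B = conjunct1[OF glue.IH(2), rule_format] and dB = conjunct2[OF glue.IH(2), rule_format]
  have inA: "L \<subseteq> ?E - Y" if "L \<in> \<A> - {Y}" for L using A[of L] dA[of L Y] glue(2) that by auto
  have inB: "L \<subseteq> Y" if "L \<in> \<B> - {?E - Y}" for L using B[of L] dB[of L "?E - Y"] glue(4) that by auto
  show ?case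
  proof (intro conjI ballI impI)
    fix L M assume LM: "L \<in> (\<A> - {Y}) \<union> (\<B> - {?E - Y})" "M \<in> (\<A> - {Y}) \<union> (\<B> - {?E - Y})" "L \<noteq> M"
    from LM(1,2) show "L \<inter> M = {}"
    proof (elim UnE)
      assume "L \<in> \<A> - {Y}" "M \<in> \<A> - {Y}" then show ?thesis using dA LM(3) by simp
    next
      assume "L \<in> \<B> - {?E - Y}" "M \<in> \<B> - {?E - Y}" then show ?thesis using dB LM(3) by simp
    next
      assume "L \<in> \<A> - {Y}" "M \<in> \<B> - {?E - Y}" then show ?thesis using inA[of L] inB[of M] by auto
    next
      assume "L \<in> \<B> - {?E - Y}" "M \<in> \<A> - {Y}" then show ?thesis using inA[of M] inB[of L] by auto
    qed
  qed (use A B in auto)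
qed

lemma displayed_member:
  assumes "simple_graph G" "displayed G k \<L>" "L \<in> \<L>"
  shows "L \<subseteq> edges G" "2 \<le> card L" "card (boundary G L) \<le> k" "L \<noteq> {}"
  using displayed_invariant[OF assms(1,2)] assms(3) by auto

lemma displayed_disjoint:
  assumes "simple_graph G" "displayed G k \<L>" "L \<in> \<L>" "M \<in> \<L>" "L \<noteq> M"
  shows "L \<inter> M = {}"
  using displayed_invariant[OF assms(1,2)] assms(3-5) by simp

text \<open>Pushing all of \<open>F\<close> into the leaf \<open>Z\<close> keeps the tree valid as \<open>F\<close> has minimum boundary.\<close>

lemma displayed_push:
  assumes G: "simple_graph G" and d: "displayed G k \<L>" and F: "F \<subseteq> edges G"
    and X: "X \<subseteq> F" "X \<noteq> {}"
    and min: "\<And>W. X \<subseteq> W \<Longrightarrow> W \<subseteq> F \<Longrightarrow> card (boundary G F) \<le> card (boundary G W)"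
  shows "\<forall>Z\<in>\<L>. X \<subseteq> Z \<longrightarrow> (\<exists>\<L>'. displayed G k \<L>' \<and> Z \<union> F \<in> \<L>' \<and> \<L>' \<subseteq> absorb F Z \<L>)"
    (is "\<forall>Z\<in>\<L>. X \<subseteq> Z \<longrightarrow> ?P Z \<L>")
  using d
proof (induction rule: displayed.induct)
  case (node \<Q>)
  show ?case
  proof (intro ballI impI)
    fix Z assume Z: "Z \<in> {Q \<in> \<Q>. 2 \<le> card Q}" "X \<subseteq> Z"
    have p: "partition_of G \<Q>" using node by (simp add: division_def)
    have fin: "finite L" if "L \<in> \<Q>" for L
      using p that finite_edges[OF G] by (auto simp: partition_of_def intro: finite_subset)
    have ZF: "2 \<le> card (Z \<union> F)"
      using Z(1) card_mono[of "Z \<union> F" Z] fin[of Z] finite_subset[OF F finite_edges[OF G]] by auto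
    have "displayed G k {Q \<in> absorb F Z \<Q>. 2 \<le> card Q}"
      by (rule displayed.node, rule division_absorb[OF G node(1) _ _ F Z(2) X(1) min])
        (use Z(1) in auto)
    moreover have "Z \<union> F \<in> {Q \<in> absorb F Z \<Q>. 2 \<le> card Q}" using ZF by (simp add: absorb_def)
    moreover have "{Q \<in> absorb F Z \<Q>. 2 \<le> card Q} \<subseteq> absorb F Z {Q \<in> \<Q>. 2 \<le> card Q}"
    proof
      fix Q assume Q: "Q \<in> {Q \<in> absorb F Z \<Q>. 2 \<le> card Q}"
      then consider "Q = Z \<union> F" | l where "l \<in> \<Q> - {Z}" "Q = l - F" by (auto simp: absorb_def)
      then show "Q \<in> absorb F Z {Q \<in> \<Q>. 2 \<le> card Q}"
      proof cases
        case 2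
        then have "card Q \<le> card l" using fin by (intro card_mono) auto
        then show ?thesis using 2 Q by (auto simp: absorb_def)
      qed (simp add: absorb_def)
    qed
    ultimately show "?P Z {Q \<in> \<Q>. 2 \<le> card Q}" by blast
  qed
next
  case (glue \<A> Y \<B>)
  \<comment> \<open>The glued trees play symmetric roles; this is the case that \<open>Z\<close> is
    a leaf of the first, stated for arbitrary trees so that it applies both ways.\<close>
  have half: "?P Z ((\<A> - {Y}) \<union> (\<B> - {edges G - Y}))"
    if dA: "displayed G k \<A>" "displayed G k \<B>" and Y: "Y \<in> \<A>" "edges G - Y \<in> \<B>"
      and IH1: "\<forall>Z\<in>\<A>. X \<subseteq> Z \<longrightarrow> ?P Z \<A>" and IH2: "\<forall>Z\<in>\<B>. X \<subseteq> Z \<longrightarrow> ?P Z \<B>"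
      and Z: "Z \<in> \<A> - {Y}" "X \<subseteq> Z" for \<A> \<B> Y Z
  proof -
    let ?\<L> = "(\<A> - {Y}) \<union> (\<B> - {edges G - Y})"
    have ZY: "Z \<inter> Y = {}" "Z \<subseteq> edges G" "Y \<subseteq> edges G" "Z \<noteq> {}"
      using displayed_disjoint[OF G dA(1), of Z Y] displayed_member[OF G dA(1)] Z Y by auto
    have ZB: "Z \<notin> \<B> - {edges G - Y}"
    proof
      assume "Z \<in> \<B> - {edges G - Y}"
      then have "Z \<inter> (edges G - Y) = {}" using displayed_disjoint[OF G dA(2)] Y(2) by simp
      then show False using ZY by blast
    qed
    obtain \<A>' where A': "displayed G k \<A>'" "Z \<union> F \<in> \<A>'" "\<A>' \<subseteq> absorb F Z \<A>" using IH1 Z by blast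
    have A'sub: "\<A>' - {Y - F} \<subseteq> absorb F Z ?\<L>"
    proof
      fix Q assume Q: "Q \<in> \<A>' - {Y - F}"
      then have "Q \<in> absorb F Z \<A>" using A'(3) by auto
      then show "Q \<in> absorb F Z ?\<L>" using Q unfolding absorb_iff by auto
    qed
    show ?thesis
    proof (cases "Y - F \<in> \<A>'")
      \<comment> \<open>If the glued leaf has disappeared, the second tree is no longer attached.
        Otherwise \<open>F\<close> is also pushed into the leaf \<open>edges G - Y\<close> of the
        second tree, which contains \<open>X\<close> since \<open>Z\<close> is disjoint from
        \<open>Y\<close>, and the trees are glued again along \<open>Y - F\<close>.\<close>
      case False
      then show ?thesis using A' A'sub by blast
    next
      case True
      obtain \<B>' where B': "displayed G k \<B>'" "(edges G - Y) \<union> F \<in> \<B>'"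
        "\<B>' \<subseteq> absorb F (edges G - Y) \<B>" using bspec[OF IH2 Y(2)] Z ZY by blast
      have eq: "(edges G - Y) \<union> F = edges G - (Y - F)" using F by blast
      let ?L = "(\<A>' - {Y - F}) \<union> (\<B>' - {edges G - (Y - F)})"
      have "displayed G k ?L" using displayed.glue[OF A'(1) True B'(1)] B'(2) eq by simp
      moreover have "Z \<union> F \<in> ?L" using A'(2) X by blast
      moreover have "\<B>' - {edges G - (Y - F)} \<subseteq> absorb F Z ?\<L>"
      proof
        fix Q assume "Q \<in> \<B>' - {edges G - (Y - F)}"
        then obtain l where l: "l \<in> \<B> - {edges G - Y}" "Q = l - F"
          using B'(3) eq unfolding absorb_def by auto
        then have "l \<noteq> Z" using ZB by auto
        then show "Q \<in> absorb F Z ?\<L>" using l unfolding absorb_def by blast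
      qed
      ultimately show ?thesis using A'sub by blast
    qed
  qed
  have YY: "edges G - (edges G - Y) = Y" using displayed_member(1)[OF G glue.hyps(1,2)] by (simp add: double_diff)
  show ?case
  proof (intro ballI impI)
    fix Z assume Z: "Z \<in> (\<A> - {Y}) \<union> (\<B> - {edges G - Y})" "X \<subseteq> Z"
    from Z(1) show "?P Z ((\<A> - {Y}) \<union> (\<B> - {edges G - Y}))"
    proof
      assume "Z \<in> \<A> - {Y}"
      from half[OF glue.hyps(1,3,2,4) glue.IH this Z(2)] show ?thesis .
    next
      assume ZB: "Z \<in> \<B> - {edges G - Y}"
      from half[OF glue.hyps(3,1,4) _ glue.IH(2,1) ZB Z(2)] show ?thesis
        using glue.hyps(2) unfolding YY by (simp add: Un_commute)
    qed
  qed
qed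

text \<open>With \<open>F\<close> of minimum boundary between \<open>X\<close> and the complement of
  \<open>Y\<close>, pushing enlarges the leaf \<open>X\<close> of one tree to \<open>F\<close> and
  the leaf \<open>Y\<close> of the other to the complement of \<open>F\<close>. The trees then fit
  together, and all remaining leaves have at most lost edges.\<close>

lemma displayed_exchange:
  assumes G: "simple_graph G" and dA: "displayed G k \<A>" "X \<in> \<A>" and dB: "displayed G k \<B>" "Y \<in> \<B>"
    and XY: "X \<inter> Y = {}"
  shows "\<exists>\<C>. displayed G k \<C> \<and> (\<forall>Q\<in>\<C>. \<exists>l\<in>(\<A> - {X}) \<union> (\<B> - {Y}). Q \<subseteq> l)"
proof -
  let ?E = "edges G"
  have sub: "X \<subseteq> ?E" "Y \<subseteq> ?E" "X \<noteq> {}" "Y \<noteq> {}"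
    using displayed_member[OF G dA] displayed_member[OF G dB] by simp_all
  define between where "between F \<longleftrightarrow> X \<subseteq> F \<and> F \<subseteq> ?E - Y" for F
  have "between X" using XY sub(1) by (auto simp: between_def)
  then obtain F where bF: "between F" "\<And>W. between W \<Longrightarrow> card (boundary G F) \<le> card (boundary G W)"
    using ex_has_least_nat[of between X "\<lambda>F. card (boundary G F)"] by blast
  have F: "X \<subseteq> F" "F \<subseteq> ?E - Y" using bF(1) by (auto simp: between_def)
  have min: "card (boundary G F) \<le> card (boundary G W)" if "X \<subseteq> W" "W \<subseteq> ?E - Y" for W
    using bF(2)[of W] that by (simp add: between_def)
  let ?F = "?E - F"
  have FE: "F \<subseteq> ?E" using F by blast
  obtain \<A>' where A': "displayed G k \<A>'" "X \<union> F \<in> \<A>'" "\<A>' \<subseteq> absorb F X \<A>"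
    using displayed_push[OF G dA(1) FE F(1) sub(3)] dA(2) min F by (metis subset_refl subset_trans)
  \<comment> \<open>Complements have equal boundaries, so the complement of \<open>F\<close> has
    minimum boundary among the sets between \<open>Y\<close> and itself.\<close>
  have min': "card (boundary G ?F) \<le> card (boundary G W)" if "Y \<subseteq> W" "W \<subseteq> ?F" for W
  proof -
    have "card (boundary G F) \<le> card (boundary G (?E - W))" by (rule min) (use that F FE in blast)+
    moreover have "W \<subseteq> ?E" using that by blast
    ultimately show ?thesis using boundary_compl[of W G] boundary_compl[OF FE] by simp
  qed
  have YF: "Y \<subseteq> ?F" using F sub by blast
  obtain \<B>' where B': "displayed G k \<B>'" "Y \<union> ?F \<in> \<B>'" "\<B>' \<subseteq> absorb ?F Y \<B>"
    using displayed_push[OF G dB(1) Diff_subset YF sub(4) min'] dB(2) by blast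
  have e: "X \<union> F = F" "Y \<union> ?F = ?F" using F YF by blast+
  have "displayed G k ((\<A>' - {F}) \<union> (\<B>' - {?F}))"
    using displayed.glue[OF A'(1) _ B'(1), of F] A'(2) B'(2) e by simp
  moreover have "\<exists>l\<in>(\<A> - {X}) \<union> (\<B> - {Y}). Q \<subseteq> l" if "Q \<in> (\<A>' - {F}) \<union> (\<B>' - {?F})" for Q
  proof -
    have "Q \<in> absorb F X \<A> - {X \<union> F} \<or> Q \<in> absorb ?F Y \<B> - {Y \<union> ?F}"
      using that A'(3) B'(3) e by auto
    then show ?thesis unfolding absorb_def by auto
  qed
  ultimately show ?thesis by blast
qed

text \<open>In a minimal upward closed family meeting all displayed families, every minimal member is the
  only one in some displayed family, so that two disjoint members could be exchanged.\<close>

lemma intersecting_family: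
  assumes G: "simple_graph G" and no: "\<not> displayed G k {}"
  obtains \<F> where "\<And>X. X \<in> \<F> \<Longrightarrow> X \<subseteq> edges G \<and> 2 \<le> card X"
    "\<And>X Y. X \<in> \<F> \<Longrightarrow> Y \<in> \<F> \<Longrightarrow> X \<inter> Y \<noteq> {}"
    "\<And>\<L>. displayed G k \<L> \<Longrightarrow> \<exists>L\<in>\<L>. L \<in> \<F>"
proof -
  define good where "good \<F> \<longleftrightarrow> \<F> \<subseteq> {X. X \<subseteq> edges G \<and> 2 \<le> card X} \<and>
    (\<forall>X\<in>\<F>. \<forall>Y. X \<subseteq> Y \<longrightarrow> Y \<subseteq> edges G \<longrightarrow> Y \<in> \<F>) \<and> (\<forall>\<L>. displayed G k \<L> \<longrightarrow> \<L> \<inter> \<F> \<noteq> {})" for \<F>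
  note finE = finite_edges[OF G]
  \<comment> \<open>The family of all sets with two edges or more qualifies because the empty family
    of leaves is not displayed.\<close>
  have "good {X. X \<subseteq> edges G \<and> 2 \<le> card X}"
    unfolding good_def
  proof (intro conjI ballI allI impI)
    fix X Y assume "X \<in> {X. X \<subseteq> edges G \<and> 2 \<le> card X}" "X \<subseteq> Y" "Y \<subseteq> edges G"
    moreover have "card X \<le> card Y" using calculation finE by (meson card_mono finite_subset)
    ultimately show "Y \<in> {X. X \<subseteq> edges G \<and> 2 \<le> card X}" by simp
  next
    fix \<L> assume L: "displayed G k \<L>"
    then have "\<L> \<noteq> {}" using no by auto
    then show "\<L> \<inter> {X. X \<subseteq> edges G \<and> 2 \<le> card X} \<noteq> {}" using displayed_member[OF G L] by blast
  qed simp
  then obtain \<F> where F: "good \<F>" and least: "\<And>\<H>. good \<H> \<Longrightarrow> card \<F> \<le> card \<H>"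
    using ex_has_least_nat[of good _ card] by blast
  have big: "X \<subseteq> edges G \<and> 2 \<le> card X" if "X \<in> \<F>" for X using F that by (auto simp: good_def)
  have up: "Y \<in> \<F>" if "X \<in> \<F>" "X \<subseteq> Y" "Y \<subseteq> edges G" for X Y using F that unfolding good_def by meson
  have hits: "\<L> \<inter> \<F> \<noteq> {}" if "displayed G k \<L>" for \<L> using F that unfolding good_def by meson
  have finF: "finite \<F>" by (rule finite_subset[of _ "Pow (edges G)"]) (use big finE in auto)
  have single: "\<exists>\<L>. displayed G k \<L> \<and> X \<in> \<L> \<and> \<L> \<inter> \<F> \<subseteq> {X}"
    if X: "X \<in> \<F>" and m: "\<And>Y. Y \<in> \<F> \<Longrightarrow> Y \<subseteq> X \<Longrightarrow> Y = X" for X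
  proof (rule ccontr)
    assume n: "\<not> ?thesis"
    have hit: "\<L> \<inter> (\<F> - {X}) \<noteq> {}" if L: "displayed G k \<L>" for \<L>
    proof
      assume "\<L> \<inter> (\<F> - {X}) = {}"
      moreover have "\<L> \<inter> \<F> \<noteq> {}" by (rule hits[OF L])
      ultimately have "X \<in> \<L>" "\<L> \<inter> \<F> \<subseteq> {X}" by blast+
      then show False using n L by blast
    qed
    have "good (\<F> - {X})"
      unfolding good_def
    proof (intro conjI ballI allI impI)
      fix Z Y assume Z: "Z \<in> \<F> - {X}" "Z \<subseteq> Y" "Y \<subseteq> edges G"
      then have "Y \<in> \<F>" using up by blast
      moreover have "Y \<noteq> X" using Z m by blast
      ultimately show "Y \<in> \<F> - {X}" by simp
    qed (use big hit in auto)
    then have "card \<F> \<le> card (\<F> - {X})" by (rule least)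
    moreover have "card (\<F> - {X}) < card \<F>" using finF X by (rule card_Diff1_less)
    ultimately show False by simp
  qed
  have "X \<inter> Y \<noteq> {}" if XY: "X \<in> \<F>" "Y \<in> \<F>" for X Y
  proof
    assume dis: "X \<inter> Y = {}"
    obtain X0 where X0: "X0 \<in> \<F>" "X0 \<subseteq> X" "\<And>Z. Z \<in> \<F> \<Longrightarrow> Z \<subseteq> X0 \<Longrightarrow> Z = X0"
      using finite_has_minimal2[OF finF XY(1)] by metis
    obtain Y0 where Y0: "Y0 \<in> \<F>" "Y0 \<subseteq> Y" "\<And>Z. Z \<in> \<F> \<Longrightarrow> Z \<subseteq> Y0 \<Longrightarrow> Z = Y0"
      using finite_has_minimal2[OF finF XY(2)] by metis
    obtain \<A> where A: "displayed G k \<A>" "X0 \<in> \<A>" "\<A> \<inter> \<F> \<subseteq> {X0}" using single[OF X0(1,3)] by blast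
    obtain \<B> where B: "displayed G k \<B>" "Y0 \<in> \<B>" "\<B> \<inter> \<F> \<subseteq> {Y0}" using single[OF Y0(1,3)] by blast
    have "X0 \<inter> Y0 = {}" using X0 Y0 dis by blast
    from displayed_exchange[OF G A(1,2) B(1,2) this] obtain \<C> where C: "displayed G k \<C>"
      "\<And>Q. Q \<in> \<C> \<Longrightarrow> \<exists>l\<in>(\<A> - {X0}) \<union> (\<B> - {Y0}). Q \<subseteq> l" by blast
    then obtain Q where Q: "Q \<in> \<C>" "Q \<in> \<F>" using hits[OF C(1)] by blast
    then obtain l where l: "l \<in> (\<A> - {X0}) \<union> (\<B> - {Y0})" "Q \<subseteq> l" using C(2) by blast
    then have "l \<subseteq> edges G" using displayed_member(1)[OF G A(1)] displayed_member(1)[OF G B(1)] by blast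
    then have "l \<in> \<F>" using up[OF Q(2) l(2)] by simp
    then show False using l A(3) B(3) by blast
  qed
  moreover have "\<exists>L\<in>\<L>. L \<in> \<F>" if "displayed G k \<L>" for \<L> using hits[OF that] by blast
  ultimately show ?thesis using that[of \<F>] big by blast
qed

section \<open>From trees of divisions to clearing searches\<close>

text \<open>Additional searchers standing on no vertex of \<open>C\<close> are lifted one by one
  before the search begins.\<close>

lemma clearable_extend:
  assumes G: "simple_graph G" and "clearable G k S0 C" and S: "S0 \<subseteq> S" "S \<subseteq> verts G" "card S \<le> k"
    and dis: "S \<inter> \<Union>C \<subseteq> S0"
  shows "clearable G k S C"
proof -
  have fS: "finite S" by (rule finite_vertices[OF G S(2)])
  have "clearable G k (S0 \<union> D) C" if "finite D" "D \<subseteq> S - S0" for D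
    using that
  proof (induction D rule: finite_induct)
    case empty then show ?case using assms(2) by simp
  next
    case (insert v D)
    have "card (insert v (S0 \<union> D)) \<le> card S" using insert S(1) fS by (intro card_mono) auto
    then have "clearable G k (insert v (S0 \<union> D)) C"
      using insert S dis by (intro clearable.remove) auto
    then show ?case by simp
  qed
  from this[of "S - S0"] show ?thesis using fS S(1) by (simp add: Un_absorb1)
qed

text \<open>Searchers at the dropped vertices are placed at the start instead; the rule
  \<open>place\<close> allows this since these vertices meet \<open>C\<close> but not its
  boundary.\<close>

lemma clearable_shrink:
  assumes G: "simple_graph G" and "clearable G k S C" and S0: "S0 \<subseteq> S" "S - S0 \<subseteq> \<Union>C" "boundary G C \<subseteq> S0"
  shows "clearable G k S0 C"
proof -
  have "S \<subseteq> verts G" using clearable_invariant[OF G assms(2)] by simp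
  then have fS: "finite S" by (rule finite_vertices[OF G])
  have "clearable G k (S - D) C" if "finite D" "D \<subseteq> S - S0" for D
    using that
  proof (induction D rule: finite_induct)
    case empty then show ?case using assms(2) by simp
  next
    case (insert v D)
    have "insert v (S - insert v D) = S - D" using insert by auto
    then have "clearable G k (insert v (S - insert v D)) C" using insert by simp
    then show ?case by (rule clearable.place) (use insert S0 in auto)
  qed
  from this[of "S - S0"] show ?thesis using fS S0(1) by (simp add: double_diff)
qed

text \<open>The search starts from the smallest possible position: by
  \<open>clearable_invariant\<close> every position that clears \<open>C\<close> contains its
  boundary.\<close>

definition solvable :: "'a ugraph \<Rightarrow> nat \<Rightarrow> 'a set set \<Rightarrow> bool" where
  "solvable G k C \<longleftrightarrow> clearable G k (boundary G C) C"

text \<open>Why leaves with fewer than two edges count as finished. For \<open>k = 1\<close>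
  searchers cannot occupy both ends of an edge, so an edge not inside the boundary is cleared by
  sliding towards an end \<open>y\<close> outside the boundary.\<close>

lemma solvable_small:
  assumes G: "simple_graph G" and k: "k \<ge> 1" and C: "C \<subseteq> edges G" "card C \<le> 1" "card (boundary G C) \<le> k"
  shows "solvable G k C"
proof (cases "C = {}")
  case True
  then show ?thesis unfolding solvable_def using boundary_subset[OF G] C by (auto intro: clearable.empty)
next
  case False
  have "finite C" using C(1) finite_edges[OF G] by (rule finite_subset)
  then have "card C = 1" using False C(2) by (simp add: le_Suc_eq)
  then obtain e where e: "C = {e}" by (auto simp: card_1_singleton_iff)
  have eE: "e \<in> edges G" and bs: "boundary G C \<subseteq> e" using C(1) e by (auto simp: boundary_def)
  have e2: "card e = 2" "e \<subseteq> verts G" using G eE by (auto simp: simple_graph_def)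
  show ?thesis
  proof (cases "e \<subseteq> boundary G C")
    case True
    then show ?thesis unfolding solvable_def
      using clearable.edge[of "boundary G C" G k e] boundary_subset[OF G] C(3) eE e by auto
  next
    case False
    then obtain y where y: "y \<in> e" "y \<notin> boundary G C" by blast
    then obtain x where x: "e = {x, y}" "x \<noteq> y" using e2(1) by (auto simp: card_2_iff)
    have "clearable G k (insert y {}) {}" by (rule clearable.empty) (use e2 y k in auto)
    then have "clearable G k (insert x {}) (insert {x, y} {})"
      by (rule clearable.slide) (use x eE e bs y in auto)
    then have "clearable G k {x} C" using x e by simp
    then show ?thesis unfolding solvable_def
      by (rule clearable_shrink[OF G]) (use bs x y e in auto)
  qed
qed

text \<open>With searchers on the whole interface the parts other than \<open>X\<close> are cleared
  independently, since different parts meet only there.\<close>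

lemma solvable_node:
  assumes G: "simple_graph G" and k: "k \<ge> 1" and p: "partition_of G \<Q>" and c: "card (interface \<Q>) \<le> k"
    and X: "X \<in> \<Q>" and parts: "\<And>l. l \<in> \<Q> \<Longrightarrow> l \<noteq> X \<Longrightarrow> card l \<le> 1 \<or> solvable G k l"
  shows "solvable G k (edges G - X)"
proof -
  let ?S = "interface \<Q>"
  have U: "\<Union>\<Q> = edges G" and d: "\<And>P Q. P \<in> \<Q> \<Longrightarrow> Q \<in> \<Q> \<Longrightarrow> P \<noteq> Q \<Longrightarrow> P \<inter> Q = {}"
    using p by (auto simp: partition_of_def)
  have SV: "?S \<subseteq> verts G" using interface_subset[OF G p] .
  have fS: "finite ?S" by (rule finite_vertices[OF G SV])
  have part: "clearable G k ?S l" if l: "l \<in> \<Q>" "l \<noteq> X" for l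
  proof -
    have b: "boundary G l = ?S \<inter> \<Union>l" using part_boundary[OF p l(1)] .
    have "card (boundary G l) \<le> card ?S" unfolding b using fS by (intro card_mono) auto
    moreover have "l \<subseteq> edges G" using U l(1) by blast
    ultimately have "solvable G k l" using parts[OF l] solvable_small[OF G k] c by auto
    then show ?thesis unfolding solvable_def
      by (rule clearable_extend[OF G]) (use b SV c in auto)
  qed
  have finQ: "finite \<Q>"
    by (rule finite_subset[of _ "Pow (edges G)"]) (use U finite_edges[OF G] in auto)
  have "clearable G k ?S (\<Union>\<P>)" if "finite \<P>" "\<P> \<subseteq> \<Q> - {X}" for \<P>
    using that
  proof (induction \<P> rule: finite_induct)
    case empty
    then show ?case using clearable.empty[OF SV c] by simp
  next
    case (insert l \<P>)
    have "\<Union>l \<inter> \<Union>(\<Union>\<P>) \<subseteq> ?S"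
    proof
      fix v assume "v \<in> \<Union>l \<inter> \<Union>(\<Union>\<P>)"
      then obtain m where "m \<in> \<P>" "v \<in> \<Union>m" "v \<in> \<Union>l" by blast
      moreover have "m \<noteq> l" using insert calculation by auto
      ultimately show "v \<in> ?S" using insert.prems unfolding interface_def by blast
    qed
    then have "clearable G k ?S (l \<union> \<Union>\<P>)"
      using insert part by (intro clearable.union) auto
    then show ?case by simp
  qed
  from this[of "\<Q> - {X}"] have "clearable G k ?S (\<Union>(\<Q> - {X}))" using finQ by simp
  moreover have eq: "\<Union>(\<Q> - {X}) = edges G - X"
  proof (intro subset_antisym subsetI)
    fix e assume "e \<in> \<Union>(\<Q> - {X})"
    then obtain l where "l \<in> \<Q>" "l \<noteq> X" "e \<in> l" by blast
    then show "e \<in> edges G - X" using d[of l X] X U by blast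
  next
    fix e assume e: "e \<in> edges G - X"
    then have "e \<in> \<Union>\<Q>" using U by simp
    then show "e \<in> \<Union>(\<Q> - {X})" using e by blast
  qed
  ultimately have cl: "clearable G k ?S (edges G - X)" by simp
  have XE: "X \<subseteq> edges G" using U X by blast
  show ?thesis unfolding solvable_def
  proof (rule clearable_shrink[OF G cl])
    show "boundary G (edges G - X) \<subseteq> ?S" using part_boundary[OF p X] boundary_compl[OF XE] by auto
    \<comment> \<open>An interface vertex meets two parts, one of which is not \<open>X\<close>; so
      searchers on the interface but outside the boundary can be placed at the start.\<close>
    show "?S - boundary G (edges G - X) \<subseteq> \<Union>(edges G - X)"
    proof
      fix v assume "v \<in> ?S - boundary G (edges G - X)"
      then obtain P Q where "P \<in> \<Q>" "Q \<in> \<Q>" "P \<noteq> Q" "v \<in> \<Union>P" "v \<in> \<Union>Q" by (auto simp: interface_def)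
      then have "\<exists>P\<in>\<Q> - {X}. v \<in> \<Union>P" by blast
      then show "v \<in> \<Union>(edges G - X)" unfolding eq[symmetric] by blast
    qed
  qed simp
qed

text \<open>An interface of at most \<open>k\<close> vertices makes this an ordinary node. Otherwise
  neither boundary contains the interface, so some \<open>x\<close> in it misses \<open>P\<close>
  and some \<open>y\<close> misses \<open>P'\<close>. Both must be ends of \<open>e\<close>, and
  sliding from \<open>x\<close> to \<open>y\<close> clears \<open>e\<close> and leaves the searchers
  on the boundary of \<open>P\<close>.\<close>

lemma solvable_slide:
  assumes G: "simple_graph G" and k: "k \<ge> 1" and p: "partition_of G {{e}, P, P'}"
    and e: "e \<notin> P" "e \<notin> P'" and dis: "P \<inter> P' = {}"
    and b: "card (boundary G P) \<le> k" "card (boundary G P') \<le> k"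
    and P: "card P \<le> 1 \<or> solvable G k P"
  shows "solvable G k (insert e P)"
proof (cases "card (interface {{e}, P, P'}) \<le> k")
  case True
  have "solvable G k (edges G - P')"
    by (rule solvable_node[OF G k p True]) (use P in auto)
  moreover have "edges G - P' = insert e P" using p e dis by (auto simp: partition_of_def)
  ultimately show ?thesis by simp
next
  case False
  let ?I = "interface {{e}, P, P'}"
  have U: "edges G = insert e (P \<union> P')" using p by (auto simp: partition_of_def)
  have bP: "boundary G P = ?I \<inter> \<Union>P" and bP': "boundary G P' = ?I \<inter> \<Union>P'"
    using part_boundary[OF p] by auto
  have "\<not> ?I \<subseteq> boundary G P" "\<not> ?I \<subseteq> boundary G P'"
    using False b card_mono[OF finite_boundary[OF G]] by (meson order_trans)+
  then obtain x y where x: "x \<in> ?I" "x \<notin> \<Union>P" and y: "y \<in> ?I" "y \<notin> \<Union>P'" using bP bP' by blast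
  have xe: "x \<in> e" using x by (auto simp: interface_def)
  have ye: "y \<in> e" "y \<in> \<Union>P" using y by (auto simp: interface_def)
  have xy: "x \<noteq> y" using x ye by auto
  have eE: "e \<in> edges G" using U by auto
  then have "card e = 2" using G by (auto simp: simple_graph_def)
  then have e': "e = {x, y}" using xe ye xy by (auto simp: card_2_iff)
  let ?A = "boundary G P - {y}"
  have "y \<in> boundary G P" using bP y ye by auto
  then have A: "insert y ?A = boundary G P" by auto
  have "solvable G k P" using P solvable_small[OF G k] b U by auto
  then have cl: "clearable G k (insert y ?A) P" unfolding A solvable_def .
  have bsub: "boundary G (insert e P) \<subseteq> insert x ?A"
  proof
    fix z assume "z \<in> boundary G (insert e P)"
    then obtain f g where fg: "f \<in> insert e P" "g \<in> edges G - insert e P" "z \<in> f" "z \<in> g"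
      by (auto simp: boundary_def)
    then have "g \<in> P'" using U by auto
    then have zy: "z \<noteq> y" using fg y by auto
    show "z \<in> insert x ?A"
    proof (cases "f = e")
      case True
      then show ?thesis using fg zy e' by auto
    next
      case False
      then have "z \<in> boundary G P" using fg by (auto simp: boundary_def)
      then show ?thesis using zy by simp
    qed
  qed
  have "clearable G k (insert x ?A) (insert {x, y} P)"
  proof (rule clearable.slide[OF cl])
    show "x \<notin> ?A" using x bP by auto
    show "boundary G (insert {x, y} P) \<subseteq> insert x ?A" using bsub e' by simp
  qed (use x eE e' in auto)
  then have "clearable G k (insert x ?A) (insert e P)" using e' by simp
  then show ?thesis unfolding solvable_def
    by (rule clearable_shrink[OF G]) (use bsub bP e' in auto)
qed

lemma solvable_division:
  assumes G: "simple_graph G" and k: "k \<ge> 1" and dv: "division G k \<Q>"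
    and X: "X \<in> \<Q>" "2 \<le> card X" and parts: "\<And>l. l \<in> \<Q> \<Longrightarrow> l \<noteq> X \<Longrightarrow> card l \<le> 1 \<or> solvable G k l"
  shows "solvable G k (edges G - X)"
proof -
  have p: "partition_of G \<Q>" using dv by (simp add: division_def)
  from dv show ?thesis
  proof (cases rule: divisionE)
    case 1
    then show ?thesis using solvable_node[OF G k p _ X(1) parts] by simp
  next
    case (2 e P1 P2)
    have main: "solvable G k (edges G - X)"
      if "\<Q> = {{e}, P, X}" "e \<notin> P" "e \<notin> X" "P \<inter> X = {}"
        "card (boundary G P) \<le> k" "card (boundary G X) \<le> k" for P
    proof -
      have "P \<noteq> X" using that(4) X(2) by auto
      then have "card P \<le> 1 \<or> solvable G k P" using parts[of P] that(1) by simp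
      then have "solvable G k (insert e P)"
        using solvable_slide[OF G k p[unfolded that(1)] that(2-6)] by simp
      moreover have "edges G - X = insert e P" using p that by (auto simp: partition_of_def)
      ultimately show ?thesis by simp
    qed
    have "X \<noteq> {e}" using X(2) by auto
    then have "X = P1 \<or> X = P2" using X(1) 2(1) by blast
    then show ?thesis
    proof
      assume "X = P1"
      then show ?thesis using main[of P2] 2 by (simp add: insert_commute Int_commute)
    next
      assume "X = P2"
      then show ?thesis using main[of P1] 2 by simp
    qed
  qed
qed

text \<open>The tree is read with \<open>X\<close> as its root. At a glued edge the tree not
  containing \<open>X\<close> is solved first, with the leaf \<open>edges G - Y\<close> as its root;
  this makes \<open>Y\<close> solvable, and so all leaves but \<open>X\<close> of the other
  tree.\<close>

lemma displayed_solvable: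
  assumes G: "simple_graph G" and k: "k \<ge> 1" and d: "displayed G k \<L>"
  shows "\<forall>X\<in>\<L>. (\<forall>l\<in>\<L> - {X}. solvable G k l) \<longrightarrow> solvable G k (edges G - X)" (is "?P \<L>")
  using d
proof (induction rule: displayed.induct)
  case (node \<Q>)
  show ?case
  proof (intro ballI impI, rule solvable_division[OF G k node])
    fix X l assume "\<forall>l\<in>{Q \<in> \<Q>. 2 \<le> card Q} - {X}. solvable G k l" "l \<in> \<Q>" "l \<noteq> X"
    then show "card l \<le> 1 \<or> solvable G k l" by (cases "2 \<le> card l") auto
  qed auto
next
  case (glue \<A> Y \<B>)
  let ?E = "edges G"
  have half: "solvable G k (?E - X)"
    if dA: "displayed G k \<A>" "displayed G k \<B>" and Y: "Y \<in> \<A>" "?E - Y \<in> \<B>" and IH: "?P \<A>" "?P \<B>"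
      and X: "X \<in> \<A> - {Y}" and others: "\<forall>l\<in>(\<A> - {Y}) \<union> (\<B> - {?E - Y}) - {X}. solvable G k l" for \<A> \<B> Y X
  proof -
    have mem: "Y \<subseteq> ?E" "X \<subseteq> ?E" "X \<noteq> {}" "X \<inter> Y = {}"
      using displayed_member[OF G dA(1)] displayed_disjoint[OF G dA(1), of X Y] Y X by auto
    have XB: "X \<notin> \<B> - {?E - Y}"
    proof
      assume "X \<in> \<B> - {?E - Y}"
      then have "X \<inter> (?E - Y) = {}" using displayed_disjoint[OF G dA(2)] Y(2) by simp
      then show False using mem by auto
    qed
    have "\<forall>l\<in>\<B> - {?E - Y}. solvable G k l" using others XB by blast
    then have "solvable G k (?E - (?E - Y))" by (rule mp[OF bspec[OF IH(2) Y(2)]])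
    then have "solvable G k Y" using mem by (simp add: double_diff)
    then show ?thesis using IH(1) X others by blast
  qed
  have YY: "?E - (?E - Y) = Y" using displayed_member(1)[OF G glue.hyps(1,2)] by (simp add: double_diff)
  show ?case
  proof (intro ballI impI)
    fix X assume X: "X \<in> (\<A> - {Y}) \<union> (\<B> - {?E - Y})"
      and others: "\<forall>l\<in>(\<A> - {Y}) \<union> (\<B> - {?E - Y}) - {X}. solvable G k l"
    from X show "solvable G k (?E - X)"
    proof
      assume "X \<in> \<A> - {Y}"
      then show ?thesis using half[OF glue.hyps(1,3,2,4) glue.IH _ others] by simp
    next
      assume "X \<in> \<B> - {?E - Y}"
      then show ?thesis
        using half[of \<B> \<A> "?E - Y" X] glue.hyps glue.IH others unfolding YY by (simp add: Un_commute)
    qed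
  qed
qed

text \<open>A tree without large leaves still needs a root. An empty part is added, either to a node
  of the first kind or to a division into two complementary parts: those of the glued edge, or
  \<open>P2\<close> and its complement for a node of the second kind.\<close>

lemma displayed_empty_clearable:
  assumes G: "simple_graph G" and k: "k \<ge> 1" and d: "displayed G k {}"
  shows "clearable G k {} (edges G)"
proof -
  have "solvable G k (edges G - {})"
    using d
  proof (cases rule: displayed.cases)
    case (node \<Q>)
    have p: "partition_of G \<Q>" using node by (simp add: division_def)
    have small: "card l \<le> 1" if "l \<in> \<Q>" for l
    proof -
      have "\<not> 2 \<le> card l" using node(1) that by blast
      then show ?thesis by simp
    qed
    from node(2) show ?thesis
    proof (cases rule: divisionE)
      case 1
      then show ?thesis using small
        by (intro solvable_node[OF G k partition_of_insert_empty[OF p]]) auto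
    next
      case (2 e P1 P2)
      have s: "solvable G k (insert e P1)"
        using solvable_slide[OF G k p[unfolded 2(1)] 2(2-6)] small[of P1] 2(1) by simp
      have E: "P2 \<subseteq> edges G" "edges G - P2 = insert e P1" using p 2 by (auto simp: partition_of_def)
      have "solvable G k (edges G - {})"
      proof (rule solvable_node[OF G k partition_of_insert_empty[OF partition_of_compl[OF E(1)]]])
        show "card (interface (insert {} {P2, edges G - P2})) \<le> k"
          using interface_compl[OF E(1)] 2(6) by simp
        show "card l \<le> 1 \<or> solvable G k l" if "l \<in> insert {} {P2, edges G - P2}" for l
          using that s small[of P2] 2(1) E(2) by auto
      qed simp
      then show ?thesis .
    qed
  next
    case (glue \<A> Y \<B>)
    have e: "\<A> - {Y} = {}" "\<B> - {edges G - Y} = {}" using glue(1) by blast+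
    have YE: "Y \<subseteq> edges G" "card (boundary G Y) \<le> k" using displayed_member[OF G glue(2,3)] by auto
    have s1: "solvable G k (edges G - Y)" 
      using mp[OF bspec[OF displayed_solvable[OF G k glue(2)] glue(3)]] e by simp
    have "solvable G k (edges G - (edges G - Y))"
      using mp[OF bspec[OF displayed_solvable[OF G k glue(4)] glue(5)]] e by simp
    then have s2: "solvable G k Y" using YE by (simp add: double_diff)
    show ?thesis
    proof (rule solvable_node[OF G k partition_of_insert_empty[OF partition_of_compl[OF YE(1)]]])
      show "card (interface (insert {} {Y, edges G - Y})) \<le> k" using interface_compl[OF YE(1)] YE(2) by simp
      show "card l \<le> 1 \<or> solvable G k l" if "l \<in> insert {} {Y, edges G - Y}" for l
        using that s1 s2 by auto
    qed simp
  qed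
  then show ?thesis by (simp add: solvable_def boundary_def)
qed

section \<open>From intersecting families to tight brambles\<close>

definition component :: "'a ugraph \<Rightarrow> 'a set \<Rightarrow> 'a \<Rightarrow> 'a set" where
  "component G S v = {u. (v, u) \<in> {(a, b). {a, b} \<in> edges G \<and> a \<notin> S \<and> b \<notin> S}\<^sup>*}"

definition incident :: "'a ugraph \<Rightarrow> 'a set \<Rightarrow> 'a set set" where
  "incident G C = {e \<in> edges G. e \<inter> C \<noteq> {}}"

lemma component_refl: "v \<in> component G S v"
  by (simp add: component_def)

lemma component_step:
  "a \<in> component G S v \<Longrightarrow> {a, b} \<in> edges G \<Longrightarrow> a \<notin> S \<Longrightarrow> b \<notin> S \<Longrightarrow> b \<in> component G S v"
  unfolding component_def by (auto intro: rtrancl_into_rtrancl)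

lemma component_subset:
  assumes "simple_graph G" "v \<in> verts G - S"
  shows "component G S v \<subseteq> verts G - S"
proof
  fix u assume "u \<in> component G S v"
  then show "u \<in> verts G - S" unfolding component_def mem_Collect_eq
    by (induction rule: rtrancl_induct) (use assms edge_verts[OF assms(1)] in auto)
qed

lemma component_eq:
  assumes "u \<in> component G S v"
  shows "component G S u = component G S v"
proof -
  let ?R = "{(a, b). {a, b} \<in> edges G \<and> a \<notin> S \<and> b \<notin> S}"
  have "sym (?R\<^sup>*)" by (rule sym_rtrancl) (auto simp: sym_def insert_commute)
  then have "(u, v) \<in> ?R\<^sup>*" "(v, u) \<in> ?R\<^sup>*" using assms by (auto simp: component_def dest: symD)
  then show ?thesis unfolding component_def by (auto intro: rtrancl_trans)
qed

lemma component_connected: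
  assumes G: "simple_graph G" and v: "v \<in> verts G - S"
  shows "connected_graph (induced G (component G S v))"
proof (rule connected_graph_trans[of v])
  show "v \<in> verts (induced G (component G S v))" using v component_refl by simp
  fix u assume "u \<in> verts (induced G (component G S v))"
  then have "(v, u) \<in> {(a, b). {a, b} \<in> edges G \<and> a \<notin> S \<and> b \<notin> S}\<^sup>*" by (simp add: component_def)
  then show "(v, u) \<in> (adj (induced G (component G S v)))\<^sup>*"
  proof (induction rule: rtrancl_induct)
    case (step y z)
    have "y \<in> component G S v" "z \<in> component G S v"
      using step(1,2) by (auto simp: component_def intro: rtrancl_into_rtrancl)
    then have "(y, z) \<in> adj (induced G (component G S v))" using step(2) by simp
    with step(3) show ?case by (rule rtrancl_into_rtrancl)
  qed simp
qed

lemma edge_other_end: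
  assumes "simple_graph G" "e \<in> edges G" "a \<in> e"
  obtains b where "e = {a, b}" "a \<noteq> b"
proof -
  have "card e = 2" using assms by (auto simp: simple_graph_def)
  then show ?thesis using that assms(3) by (auto simp: card_2_iff)
qed

lemma incident_component_boundary:
  assumes G: "simple_graph G" and v: "v \<in> verts G - S" and e: "e \<in> incident G (component G S v)"
  shows "e \<subseteq> component G S v \<union> S"
proof -
  obtain a where a: "a \<in> e" "a \<in> component G S v" "e \<in> edges G" using e by (auto simp: incident_def)
  obtain b where b: "e = {a, b}" using edge_other_end[OF G a(3,1)] .
  have "a \<notin> S" using component_subset[OF G v] a by auto
  then show ?thesis using component_step[OF a(2), of b] a b by auto
qed

text \<open>An edge with an end \<open>u\<close> outside \<open>S\<close> belongs to the part of the
  component of \<open>u\<close> and to no other. Edges inside \<open>S\<close> are singleton parts,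
  too small for a family of sets with at least two edges.\<close>

lemma partition_components:
  assumes G: "simple_graph G"
  defines "\<Q> S \<equiv> {incident G (component G S v) | v. v \<in> verts G - S} \<union> {{e} | e. e \<in> edges G \<and> e \<subseteq> S}"
  shows "partition_of G (\<Q> S)" "interface (\<Q> S) \<subseteq> S"
proof -
  have Qcases: "(\<exists>v. v \<in> verts G - S \<and> Q = incident G (component G S v)) \<or>
      (\<exists>e. e \<in> edges G \<and> e \<subseteq> S \<and> Q = {e})" if "Q \<in> \<Q> S" for Q using that unfolding \<Q>_def by blast
  have own: "Q = incident G (component G S u)" if "Q \<in> \<Q> S" "e \<in> Q" "u \<in> e" "u \<notin> S" for Q e u
    using Qcases[OF that(1)]
  proof (elim disjE exE conjE)
    fix v assume v: "v \<in> verts G - S" and Q: "Q = incident G (component G S v)"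
    have "u \<in> component G S v" using incident_component_boundary[OF G v, of e] that Q by auto
    then show ?thesis using component_eq Q by metis
  next
    fix f assume "f \<subseteq> S" "Q = {f}"
    then show ?thesis using that by auto
  qed
  have ends: "\<exists>u. u \<in> e" if "e \<in> edges G" for e using that G by (auto simp: simple_graph_def card_2_iff)
  have "\<Union>(\<Q> S) = edges G"
  proof (intro subset_antisym subsetI)
    fix e assume "e \<in> \<Union>(\<Q> S)"
    then show "e \<in> edges G" unfolding \<Q>_def by (auto simp: incident_def)
  next
    fix e assume e: "e \<in> edges G"
    show "e \<in> \<Union>(\<Q> S)"
    proof (cases "e \<subseteq> S")
      case True
      then have "{e} \<in> \<Q> S" using e unfolding \<Q>_def by blast
      then show ?thesis by blast
    next
      case False
      then obtain u where u: "u \<in> e" "u \<notin> S" by blast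
      have "u \<in> verts G" using G e u by (auto simp: simple_graph_def)
      then have "incident G (component G S u) \<in> \<Q> S" using u unfolding \<Q>_def by blast
      moreover have "e \<in> incident G (component G S u)" using e u component_refl[of u G S] by (auto simp: incident_def)
      ultimately show ?thesis by blast
    qed
  qed
  moreover have "P \<inter> Q = {}" if PQ: "P \<in> \<Q> S" "Q \<in> \<Q> S" "P \<noteq> Q" for P Q
  proof (rule ccontr)
    assume "P \<inter> Q \<noteq> {}"
    then obtain e where e: "e \<in> P" "e \<in> Q" by blast
    show False
    proof (cases "e \<subseteq> S")
      case False
      then obtain u where "u \<in> e" "u \<notin> S" by blast
      then show False using own[OF PQ(1) e(1)] own[OF PQ(2) e(2)] PQ(3) by blast
    next
      case True
      have "R = {e}" if R: "R \<in> \<Q> S" "e \<in> R" for R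
        using Qcases[OF R(1)]
      proof (elim disjE exE conjE)
        fix v assume v: "v \<in> verts G - S" "R = incident G (component G S v)"
        then have "e \<inter> component G S v \<noteq> {}" using R by (auto simp: incident_def)
        then show ?thesis using True component_subset[OF G v(1)] by blast
      qed (use R in auto)
      then show False using e PQ by blast
    qed
  qed
  ultimately show "partition_of G (\<Q> S)" by (auto simp: partition_of_def)
  show "interface (\<Q> S) \<subseteq> S"
  proof
    fix u assume "u \<in> interface (\<Q> S)"
    then obtain P Q e f where "P \<in> \<Q> S" "Q \<in> \<Q> S" "P \<noteq> Q" "e \<in> P" "u \<in> e" "f \<in> Q" "u \<in> f"
      unfolding interface_def by blast
    then show "u \<in> S" using own[of P e u] own[of Q f u] by blast
  qed
qed

lemma card_ge_2_not_singleton: "2 \<le> card Q \<Longrightarrow> Q \<noteq> {e}"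
  by auto

text \<open>The division into \<open>{e}\<close>, \<open>X - {e}\<close> and the complement of
  \<open>X\<close> is of the second kind. A singleton is too small for the family and the complement
  is disjoint from \<open>X\<close>, so the part hit is the remaining one.\<close>

lemma family_special:
  assumes G: "simple_graph G"
    and big: "\<And>X. X \<in> \<F> \<Longrightarrow> X \<subseteq> edges G \<and> 2 \<le> card X"
    and inter: "\<And>X Y. X \<in> \<F> \<Longrightarrow> Y \<in> \<F> \<Longrightarrow> X \<inter> Y \<noteq> {}"
    and hit: "\<And>\<Q>. division G k \<Q> \<Longrightarrow> \<exists>Q\<in>\<Q>. Q \<in> \<F>"
    and X: "X \<in> \<F>" "e \<in> X" and b: "card (boundary G X) \<le> k" "card (boundary G (X - {e})) \<le> k"
  shows "X - {e} \<in> \<F>"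
proof -
  let ?Q = "{{e}, X - {e}, edges G - X}"
  have XE: "X \<subseteq> edges G" using big X by blast
  have p: "partition_of G ?Q" using XE X(2) unfolding partition_of_def by auto
  have "division G k ?Q"
    unfolding division_def
  proof (intro conjI disjI2 exI)
    show "?Q = {{e}, X - {e}, edges G - X}" ..
  qed (use p X(2) b boundary_compl[OF XE] in auto)
  from hit[OF this] obtain Q where Q: "Q \<in> ?Q" "Q \<in> \<F>" by blast
  moreover have "Q \<noteq> {e}" by (rule card_ge_2_not_singleton[OF conjunct2[OF big[OF Q(2)]]])
  moreover have "Q \<noteq> edges G - X" using inter[OF X(1) Q(2)] by auto
  ultimately show ?thesis by auto
qed

text \<open>This excludes bramble elements with one vertex. Every part of the star has at most
  \<open>k\<close> boundary vertices, so if the star belonged to the family, edges could be deleted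
  one at a time until fewer than two remain.\<close>

lemma star_not_in_family:
  assumes G: "simple_graph G"
    and big: "\<And>X. X \<in> \<F> \<Longrightarrow> X \<subseteq> edges G \<and> 2 \<le> card X"
    and inter: "\<And>X Y. X \<in> \<F> \<Longrightarrow> Y \<in> \<F> \<Longrightarrow> X \<inter> Y \<noteq> {}"
    and hit: "\<And>\<Q>. division G k \<Q> \<Longrightarrow> \<exists>Q\<in>\<Q>. Q \<in> \<F>"
    and S: "finite S" "card S \<le> k" and star: "\<And>e. e \<in> incident G {v} \<Longrightarrow> e \<subseteq> insert v S"
  shows "incident G {v} \<notin> \<F>"
proof -
  let ?I = "incident G {v}"
  have finI: "finite ?I" using finite_edges[OF G] by (auto simp: incident_def)
  have other: "\<exists>w\<in>S. e = {v, w}" if e: "e \<in> ?I" for e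
  proof -
    have "e \<in> edges G" "v \<in> e" using e by (auto simp: incident_def)
    then obtain w where "e = {v, w}" "v \<noteq> w" using edge_other_end[OF G] by metis
    then show ?thesis using star[OF e] by auto
  qed
  have "?I \<subseteq> (\<lambda>w. {v, w}) ` S" using other by blast
  then have cardI: "card ?I \<le> k" using S card_mono[of "(\<lambda>w. {v, w}) ` S" ?I] card_image_le[OF S(1), of "\<lambda>w. {v, w}"] by simp
  have b: "card (boundary G X) \<le> k" if X: "X \<subseteq> ?I" for X
  proof (cases "X = ?I")
    case True
    have "boundary G X \<subseteq> S"
    proof
      fix z assume "z \<in> boundary G X"
      then obtain e f where ef: "e \<in> X" "f \<in> edges G - X" "z \<in> e" "z \<in> f" by (auto simp: boundary_def)
      then have "z \<noteq> v" using True by (auto simp: incident_def)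
      then show "z \<in> S" using ef X star[of e] by auto
    qed
    then show ?thesis using S card_mono[of S "boundary G X"] by simp
  next
    case False
    \<comment> \<open>The boundary of a proper part of the star consists of at most the centre and
      the outer ends; having fewer than \<open>k\<close> edges, the part has at most
      \<open>k\<close> such vertices.\<close>
    let ?W = "{w. {v, w} \<in> X}"
    have finX: "finite X" using X finI by (rule finite_subset)
    have injW: "inj_on (\<lambda>w. {v, w}) ?W" by (auto simp: inj_on_def doubleton_eq_iff)
    have imW: "(\<lambda>w. {v, w}) ` ?W \<subseteq> X" by auto
    have finW: "finite ?W" using finite_subset[OF imW finX] injW by (rule finite_imageD)
    have "card ?W \<le> card X" using card_inj_on_le[OF injW imW finX] .
    moreover have "card X < card ?I" using False X finI by (intro psubset_card_mono) auto
    moreover have "boundary G X \<subseteq> insert v ?W"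
    proof
      fix z assume "z \<in> boundary G X"
      then obtain e where e: "e \<in> X" "z \<in> e" by (auto simp: boundary_def)
      then obtain w where "e = {v, w}" using other X by blast
      then show "z \<in> insert v ?W" using e by auto
    qed
    then have "card (boundary G X) \<le> card (insert v ?W)" using finW by (intro card_mono) auto
    moreover have "card (insert v ?W) \<le> Suc (card ?W)" by (rule card_insert_le_m1) auto
    ultimately show ?thesis using cardI by simp
  qed
  have "X \<notin> \<F>" if "X \<subseteq> ?I" for X
    using that
  proof (induction "card X" arbitrary: X rule: less_induct)
    case less
    show ?case
    proof
      assume XF: "X \<in> \<F>"
      then have "2 \<le> card X" using big by blast
      then obtain e where e: "e \<in> X" by fastforce
      have "X - {e} \<in> \<F>"
        by (rule family_special[OF G big inter hit XF e b b]) (use less in auto)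
      moreover have "card (X - {e}) < card X"
        by (rule card_Diff1_less[OF finite_subset[OF less.prems finI] e])
      ultimately show False using less by blast
    qed
  qed
  then show ?thesis by simp
qed

text \<open>Disjoint elements share an edge because the family is intersecting. If it were the only
  edge between them, the edges at \<open>B1\<close> without it would still belong to the family by a
  division of the second kind, yet no longer meet the edges at \<open>B2\<close>.\<close>

lemma family_imp_bramble:
  assumes G: "simple_graph G"
    and big: "\<And>X. X \<in> \<F> \<Longrightarrow> X \<subseteq> edges G \<and> 2 \<le> card X"
    and inter: "\<And>X Y. X \<in> \<F> \<Longrightarrow> Y \<in> \<F> \<Longrightarrow> X \<inter> Y \<noteq> {}"
    and hit: "\<And>\<Q>. division G k \<Q> \<Longrightarrow> \<exists>Q\<in>\<Q>. Q \<in> \<F>"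
  shows "\<exists>\<B>. tight_bramble G \<B> \<and> \<not> bramble_order G \<B> \<le> k"
proof -
  have finV: "finite (verts G)" using G by (simp add: simple_graph_def)
  define \<B> where "\<B> = {component G S v | S v. S \<subseteq> verts G \<and> card S \<le> k \<and> v \<in> verts G - S \<and>
    incident G (component G S v) \<in> \<F>}"
  have ex: "\<exists>B\<in>\<B>. B \<inter> S = {}" if S: "S \<subseteq> verts G" "card S \<le> k" for S
  proof -
    note p = partition_components[OF G, of S]
    \<comment> \<open>The components of \<open>G - S\<close> and the edges inside \<open>S\<close>
      form a division of the first kind, so the family contains the edges at some component.\<close>
    let ?Q = "{incident G (component G S v) | v. v \<in> verts G - S} \<union> {{e} | e. e \<in> edges G \<and> e \<subseteq> S}"
    have "card (interface ?Q) \<le> card S" using p(2) finite_subset[OF S(1) finV] by (rule card_mono[rotated])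
    then have "division G k ?Q" using p(1) S(2) by (simp add: division_def)
    from hit[OF this] obtain Q where Q: "Q \<in> ?Q" "Q \<in> \<F>" by blast
    have "Q \<noteq> {e}" for e by (rule card_ge_2_not_singleton[OF conjunct2[OF big[OF Q(2)]]])
    then obtain v where v: "v \<in> verts G - S" "Q = incident G (component G S v)" using Q(1) by blast
    then have "component G S v \<in> \<B>" using Q(2) S unfolding \<B>_def by blast
    moreover have "component G S v \<inter> S = {}" using component_subset[OF G v(1)] by blast
    ultimately show ?thesis by blast
  qed
  have mem: "\<exists>S v. S \<subseteq> verts G \<and> card S \<le> k \<and> v \<in> verts G - S \<and> incident G B \<in> \<F> \<and> B = component G S v"
    if "B \<in> \<B>" for B using that unfolding \<B>_def by blast
  have "tight_bramble G \<B>"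
    unfolding tight_bramble_def
  proof (intro conjI ballI)
    fix B assume "B \<in> \<B>"
    then obtain S v where B: "S \<subseteq> verts G" "card S \<le> k" "v \<in> verts G - S" "incident G B \<in> \<F>" "B = component G S v"
      using mem by blast
    show BV: "B \<subseteq> verts G" using component_subset[OF G B(3)] B(5) by blast
    show "connected_graph (induced G B)" using component_connected[OF G B(3)] B(5) by simp
    show "2 \<le> card B"
    proof (rule ccontr)
      assume "\<not> 2 \<le> card B"
      moreover have "finite B" using BV finV by (rule finite_subset)
      moreover have vB: "v \<in> B" using B(5) component_refl by simp
      ultimately have "card B = 1" by (cases "card B") auto
      then have Bv: "B = {v}" using vB by (auto simp: card_1_singleton_iff)
      have "incident G {v} \<notin> \<F>"
      proof (rule star_not_in_family[OF G big inter hit finite_subset[OF B(1) finV] B(2)])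
        fix e assume "e \<in> incident G {v}"
        then show "e \<subseteq> insert v S"
          using incident_component_boundary[OF G B(3), of e] unfolding B(5)[symmetric] Bv by simp
      qed
      then show False using B(4) Bv by simp
    qed
  next
    fix B1 B2 assume "B1 \<in> \<B>" "B2 \<in> \<B>"
    then obtain S1 v1 S2 v2 where B1: "S1 \<subseteq> verts G" "card S1 \<le> k" "v1 \<in> verts G - S1" "incident G B1 \<in> \<F>"
      "B1 = component G S1 v1" and B2: "v2 \<in> verts G - S2" "incident G B2 \<in> \<F>" "B2 = component G S2 v2"
      using mem by meson
    show "touching G B1 B2"
    proof (rule ccontr)
      assume nt: "\<not> touching G B1 B2"
      then have dis: "B1 \<inter> B2 = {}" by (simp add: touching_def)
      have uniq: "{a, b} = {c, d}" if "{a, b} \<in> edges G" "{c, d} \<in> edges G" "a \<in> B1" "c \<in> B1" "b \<in> B2" "d \<in> B2"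
        for a b c d using nt that unfolding touching_def by blast
      obtain e where e: "e \<in> incident G B1" "e \<in> incident G B2" using inter[OF B1(4) B2(2)] by blast
      then obtain x where x: "x \<in> e" "x \<in> B1" and eE: "e \<in> edges G" by (auto simp: incident_def)
      obtain y where y: "e = {x, y}" "x \<noteq> y" using edge_other_end[OF G eE x(1)] .
      have yB: "y \<in> B2" using e(2) y x(2) dis by (auto simp: incident_def)
      have only: "f = e" if f: "f \<in> incident G B1" "f \<in> incident G B2" for f
      proof -
        obtain a where a: "a \<in> f" "a \<in> B1" "f \<in> edges G" using f(1) by (auto simp: incident_def)
        obtain b where ab: "f = {a, b}" using edge_other_end[OF G a(3,1)] .
        have "b \<in> B2" using f(2) ab a(2) dis by (auto simp: incident_def)
        then show ?thesis using uniq[of a b x y] a ab x y yB eE by simp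
      qed
      let ?X = "incident G B1"
      have fin1: "finite S1" using B1(1) finV by (rule finite_subset)
      have sub1: "f \<subseteq> B1 \<union> S1" if "f \<in> ?X" for f
        using incident_component_boundary[OF G B1(3), of f] that B1(5) by simp
      have yS: "y \<in> S1" using sub1[OF e(1)] y yB dis by auto
      have xS: "x \<notin> S1" using x(2) component_subset[OF G B1(3)] B1(5) by auto
      have out: "z \<notin> B1" if "z \<in> f" "f \<in> edges G - ?X" for z f using that by (auto simp: incident_def)
      have "boundary G ?X \<subseteq> S1"
      proof
        fix z assume "z \<in> boundary G ?X"
        then obtain f g where "f \<in> ?X" "z \<in> f" "z \<in> g" "g \<in> edges G - ?X" by (auto simp: boundary_def)
        then show "z \<in> S1" using sub1 out by blast
      qed
      then have b1: "card (boundary G ?X) \<le> k" using card_mono[OF fin1] B1(2) by (meson order_trans)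
      \<comment> \<open>Without \<open>e\<close> no remaining edge contains \<open>y\<close>, while
        \<open>x\<close> may enter the boundary; exchanging \<open>y\<close> for \<open>x\<close> in
        \<open>S1\<close> keeps the size.\<close>
      have "boundary G (?X - {e}) \<subseteq> insert x (S1 - {y})"
      proof
        fix z assume "z \<in> boundary G (?X - {e})"
        then obtain f g where fg: "f \<in> ?X" "f \<noteq> e" "z \<in> f" "z \<in> g" "g \<in> edges G" "g \<notin> ?X - {e}"
          by (auto simp: boundary_def)
        have "z \<noteq> y"
        proof
          assume "z = y"
          then have "f \<in> incident G B2" using fg yB by (auto simp: incident_def)
          then show False using only fg by blast
        qed
        moreover have "z \<in> S1 \<or> z = x"
        proof (cases "g = e")
          case True
          then show ?thesis using fg(4) y \<open>z \<noteq> y\<close> by auto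
        next
          case False
          then have "z \<notin> B1" using fg out[of z g] by auto
          then show ?thesis using sub1[OF fg(1)] fg(3) by auto
        qed
        ultimately show "z \<in> insert x (S1 - {y})" by auto
      qed
      then have "card (boundary G (?X - {e})) \<le> card (insert x (S1 - {y}))"
        using fin1 by (intro card_mono) auto
      also have "\<dots> = card S1"
        using fin1 yS xS by (metis DiffD1 card.insert card.remove finite_Diff)
      finally have b2: "card (boundary G (?X - {e})) \<le> k" using B1(2) by simp
      have "?X - {e} \<in> \<F>" by (rule family_special[OF G big inter hit B1(4) e(1) b1 b2])
      then have "(?X - {e}) \<inter> incident G B2 \<noteq> {}" using inter B2(2) by blast
      then show False using only by blast
    qed
  qed
  moreover have "\<not> bramble_order G \<B> \<le> k"
  proof
    assume le: "bramble_order G \<B> \<le> k"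
    let ?C = "{S. is_cover G \<B> S}"
    have fin: "finite ?C" by (rule finite_subset[of _ "Pow (verts G)"]) (use finV in \<open>auto simp: is_cover_def\<close>)
    have "verts G \<in> ?C"
    proof -
      have "verts G \<inter> B \<noteq> {}" if "B \<in> \<B>" for B
        using mem[OF that] component_refl by fastforce
      then show ?thesis by (simp add: is_cover_def)
    qed
    then have "Min (card ` ?C) \<in> card ` ?C" using fin by (intro Min_in) auto
    then obtain S where "is_cover G \<B> S" "card S = bramble_order G \<B>" by (auto simp: bramble_order_def)
    then show False using ex[of S] le unfolding is_cover_def by (metis Int_commute)
  qed
  ultimately show ?thesis by blast
qed

lemma bramble_imp_clearable:
  assumes G: "simple_graph G" and k: "k \<ge> 1"
    and br: "\<And>\<B>. tight_bramble G \<B> \<Longrightarrow> bramble_order G \<B> \<le> k"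
  shows "clearable G k {} (edges G)"
proof (rule displayed_empty_clearable[OF G k], rule ccontr)
  assume "\<not> displayed G k {}"
  from intersecting_family[OF G this] obtain \<F> where
    big: "\<And>X. X \<in> \<F> \<Longrightarrow> X \<subseteq> edges G \<and> 2 \<le> card X"
    and inter: "\<And>X Y. X \<in> \<F> \<Longrightarrow> Y \<in> \<F> \<Longrightarrow> X \<inter> Y \<noteq> {}"
    and hits: "\<And>\<L>. displayed G k \<L> \<Longrightarrow> \<exists>L\<in>\<L>. L \<in> \<F>" by blast
  have "\<exists>Q\<in>\<Q>. Q \<in> \<F>" if "division G k \<Q>" for \<Q>
    using hits[OF displayed.node[OF that]] by blast
  from family_imp_bramble[OF G big inter this] show False using br by blast
qed

theorem theorem10:
  fixes G :: "'a ugraph" and k :: nat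
  assumes "simple_graph G" and "k \<ge> 1"
  shows "((\<exists>(T :: nat ugraph) \<chi>. loose_tree_decomposition G T \<chi> \<and> decomposition_width T \<chi> \<le> k)
            \<longleftrightarrow> minor_of_tree_product G k) \<and>
         (minor_of_tree_product G k \<longleftrightarrow> ctp G \<le> enat k) \<and>
         (minor_of_tree_product G k \<longleftrightarrow> (\<forall>\<B>. tight_bramble G \<B> \<longrightarrow> bramble_order G \<B> \<le> k)) \<and>
         ((\<forall>\<B>. tight_bramble G \<B> \<longrightarrow> bramble_order G \<B> \<le> k) \<longleftrightarrow> avms G \<le> enat k) \<and>
         (avms G \<le> enat k \<longleftrightarrow> mavms G \<le> enat k)"
proof -
  note G = assms(1) and k = assms(2)
  let ?loose = "\<exists>(T :: nat ugraph) \<chi>. loose_tree_decomposition G T \<chi> \<and> decomposition_width T \<chi> \<le> k"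
  let ?bramble = "\<forall>\<B>. tight_bramble G \<B> \<longrightarrow> bramble_order G \<B> \<le> k"
  have minor_bramble: "\<forall>\<B>. tight_bramble G \<B> \<longrightarrow> bramble_order G \<B> \<le> j" if "minor_of_tree_product G j" for j
    using that minor_imp_bramble[OF G] unfolding minor_of_tree_product_def by blast
  have loose_bramble: "?loose \<Longrightarrow> ?bramble" using loose_imp_bramble[OF G] by blast
  have avms_bramble: "avms G \<le> enat k \<Longrightarrow> ?bramble" using avms_imp_bramble[OF G] by blast
  have mavms_avms: "mavms G \<le> enat k \<Longrightarrow> avms G \<le> enat k" by (rule order_trans[OF avms_le_mavms])
  have bramble_all: "?loose" "minor_of_tree_product G k" "mavms G \<le> enat k" if b: ?bramble
  proof -
    have c: "clearable G k {} (edges G)" by (rule bramble_imp_clearable[OF G k]) (rule b[rule_format])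
    note d = clearable_imp_decomposable[OF G k c]
    show "?loose" "minor_of_tree_product G k" "mavms G \<le> enat k"
      by (rule decomposable_imp_loose[OF G d] decomposable_imp_minor[OF G d] clearable_imp_mavms[OF G c])+
  qed
  have "minor_of_tree_product G k \<longleftrightarrow> ctp G \<le> enat k"
  proof
    assume "minor_of_tree_product G k"
    then show "ctp G \<le> enat k" unfolding ctp_def using k by (intro Inf_lower) auto
  next
    \<comment> \<open>The minimum is attained at some \<open>j \<le> k\<close>; the passage from
      \<open>j\<close> to \<open>k\<close> goes by way of brambles, where the bound is
      monotone.\<close>
    assume le: "ctp G \<le> enat k"
    from Inf_enat_leD[OF le[unfolded ctp_def]] obtain j where j: "minor_of_tree_product G j" "j \<le> k" by auto
    then have "?bramble" using minor_bramble[OF j(1)] j(2) by (meson order_trans)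
    then show "minor_of_tree_product G k" by (rule bramble_all)
  qed
  moreover have "?loose \<longleftrightarrow> ?bramble" using loose_bramble bramble_all(1) by (rule iffI)
  moreover have "minor_of_tree_product G k \<longleftrightarrow> ?bramble"
    using minor_bramble bramble_all(2) by (rule iffI)
  moreover have "avms G \<le> enat k \<longleftrightarrow> ?bramble"
    using avms_bramble mavms_avms[OF bramble_all(3)] by (rule iffI)
  moreover have "mavms G \<le> enat k \<longleftrightarrow> ?bramble"
    using avms_bramble[OF mavms_avms] bramble_all(3) by (rule iffI)
  ultimately show ?thesis by simp
qed

end
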